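(* Let $p$ be a prime, let $G$ be a finite $p$-group of nilpotency class $2$ and let $w$ be a word. Then the function $N_{w,G}$ is a generalized character of $G$.
   Context: A word in $k$ variables is an element $w$ of the free group on $x_1,\dots,x_k$ ($k\ge 1$). For $g_1,\dots,g_k\in G$, $w(g_1,\dots,g_k)$ is the image of $w$ under the homomorphism to $G$ with $x_i\mapsto g_i$. For $g\in G$, $N_{w,G}(g)=|\{(g_1,\dots,g_k)\in G^{k}\mid w(g_1,\dots,g_k)=g\}|$; this is a class function on $G$. A generalized character of $G$ is a $\mathbb{Z}$-linear combination of the irreducible complex characters of $G$. *)

theory Defs
  imports
    "HOL-Algebra.Generated_Groups"
    "HOL-Computational_Algebra.Primes"
    "Jordan_Normal_Form.VS_Connect"
begin

section \<open>Free groups and words\<close>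

text \<open>A letter \<open>(i, True)\<close> stands for the generator $x_i$ and \<open>(i, False)\<close> for $x_i^{-1}$.
  The free group is realised on the reduced words: every element of the abstract free group is
  represented by exactly one reduced word. The lemmas below show that this is a group and that
  it has the universal property.\<close>

type_synonym 'i letter = "'i \<times> bool"

definition letter_inv :: "'i letter \<Rightarrow> 'i letter" where
  "letter_inv a = (fst a, \<not> snd a)"

definition reduced :: "'i letter list \<Rightarrow> bool" where
  "reduced = successively (\<lambda>a b. b \<noteq> letter_inv a)"

fun free_cons :: "'i letter \<Rightarrow> 'i letter list \<Rightarrow> 'i letter list" where
  "free_cons a [] = [a]"
| "free_cons a (b # w) = (if b = letter_inv a then w else a # b # w)"

definition free_group :: "'i set \<Rightarrow> 'i letter list monoid" where
  "free_group X =
    \<lparr>carrier = {w. reduced w \<and> fst ` set w \<subseteq> X}, mult = foldr free_cons, one = []\<rparr>"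

definition letter_eval :: "('a, 'b) monoid_scheme \<Rightarrow> ('i \<Rightarrow> 'a) \<Rightarrow> 'i letter \<Rightarrow> 'a" where
  "letter_eval G g a = (if snd a then g (fst a) else inv\<^bsub>G\<^esub> (g (fst a)))"

text \<open>\<open>word_eval G g\<close> is the homomorphism to \<open>G\<close> with $x_i \mapsto g_i$;
  see \<open>word_eval_hom\<close>, \<open>word_eval_gen\<close> and \<open>word_eval_unique\<close> below.\<close>

fun word_eval :: "('a, 'b) monoid_scheme \<Rightarrow> ('i \<Rightarrow> 'a) \<Rightarrow> 'i letter list \<Rightarrow> 'a" where
  "word_eval G g [] = \<one>\<^bsub>G\<^esub>"
| "word_eval G g (a # w) = letter_eval G g a \<otimes>\<^bsub>G\<^esub> word_eval G g w"

lemma letter_inv_inv [simp]: "letter_inv (letter_inv a) = a"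
  by (simp add: letter_inv_def)

lemma fst_letter_inv [simp]: "fst (letter_inv a) = fst a"
  by (simp add: letter_inv_def)

lemma reduced_Nil [simp]: "reduced []"
  by (simp add: reduced_def)

lemma reduced_Cons:
  "reduced (a # w) \<longleftrightarrow> reduced w \<and> (w \<noteq> [] \<longrightarrow> hd w \<noteq> letter_inv a)"
  by (cases w) (auto simp: reduced_def)

lemma free_cons_reduced: "reduced w \<Longrightarrow> reduced (free_cons a w)"
  by (cases w) (auto simp: reduced_Cons)

lemma free_cons_set: "set (free_cons a w) \<subseteq> insert a (set w)"
  by (cases w) auto

lemma free_cons_cancel:
  assumes "reduced w"
  shows "free_cons a (free_cons (letter_inv a) w) = w"
proof (cases w)
  case (Cons b v)
  then show ?thesis using assms by (cases v) (auto simp: reduced_Cons)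
qed simp

lemma foldr_free_cons_reduced: "reduced v \<Longrightarrow> reduced (foldr free_cons u v)"
  by (induction u) (auto simp: free_cons_reduced)

lemma foldr_free_cons_set: "set (foldr free_cons u v) \<subseteq> set u \<union> set v"
  using free_cons_set by (induction u) fastforce+

lemma foldr_free_cons_free_cons:
  assumes "reduced w"
  shows "foldr free_cons (free_cons a u) w = free_cons a (foldr free_cons u w)"
  using assms free_cons_cancel[OF foldr_free_cons_reduced, of w a]
  by (cases u) auto

lemma foldr_free_cons_assoc:
  assumes "reduced w"
  shows "foldr free_cons (foldr free_cons u v) w = foldr free_cons u (foldr free_cons v w)"
  using assms by (induction u) (auto simp: foldr_free_cons_free_cons)

lemma foldr_free_cons_Nil: "reduced u \<Longrightarrow> foldr free_cons u [] = u"
proof (induction u)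
  case (Cons a u)
  then show ?case by (cases u) (auto simp: reduced_Cons)
qed simp

lemma free_group_left_inv:
  "reduced w \<Longrightarrow> foldr free_cons (rev (map letter_inv w)) w = []"
proof (induction w)
  case (Cons a w)
  then show ?case by (simp add: reduced_Cons)
qed simp

lemma reduced_inverse:
  assumes "reduced w"
  shows "reduced (rev (map letter_inv w))"
proof -
  have "successively (\<lambda>a b. a \<noteq> letter_inv b) (map letter_inv w)"
    using assms unfolding reduced_def
    by (induction w rule: induct_list012) (auto simp: letter_inv_def)
  then show ?thesis by (simp add: reduced_def)
qed

lemma group_free_group: "group (free_group X)"
proof (rule groupI)
  fix x y assume "x \<in> carrier (free_group X)" "y \<in> carrier (free_group X)"
  then show "x \<otimes>\<^bsub>free_group X\<^esub> y \<in> carrier (free_group X)"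
    using foldr_free_cons_set[of x y]
    by (fastforce simp: free_group_def foldr_free_cons_reduced)
next
  fix x assume x: "x \<in> carrier (free_group X)"
  show "\<exists>y\<in>carrier (free_group X). y \<otimes>\<^bsub>free_group X\<^esub> x = \<one>\<^bsub>free_group X\<^esub>"
    using x reduced_inverse[of x] free_group_left_inv[of x]
    by (intro bexI[of _ "rev (map letter_inv x)"])
       (auto simp: free_group_def image_image)
qed (auto simp: free_group_def foldr_free_cons_assoc)

context group
begin

lemma letter_eval_closed:
  "g ` X \<subseteq> carrier G \<Longrightarrow> fst a \<in> X \<Longrightarrow> letter_eval G g a \<in> carrier G"
  by (auto simp: letter_eval_def)

lemma letter_eval_inv:
  "g ` X \<subseteq> carrier G \<Longrightarrow> fst a \<in> X \<Longrightarrow>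
    letter_eval G g (letter_inv a) = inv (letter_eval G g a)"
  by (auto simp: letter_eval_def letter_inv_def)

lemma word_eval_closed:
  assumes "g ` X \<subseteq> carrier G" "fst ` set w \<subseteq> X"
  shows "word_eval G g w \<in> carrier G"
  using assms(2) by (induction w) (auto intro!: letter_eval_closed[OF assms(1)])

lemma word_eval_free_cons:
  assumes "g ` X \<subseteq> carrier G" "fst a \<in> X" "fst ` set w \<subseteq> X"
  shows "word_eval G g (free_cons a w) = letter_eval G g a \<otimes> word_eval G g w"
proof (cases w)
  case (Cons b v)
  have a: "letter_eval G g a \<in> carrier G" and v: "word_eval G g v \<in> carrier G"
    using assms Cons by (auto intro!: letter_eval_closed[OF assms(1)] word_eval_closed[OF assms(1)])
  show ?thesis
    using a v Cons letter_eval_inv[OF assms(1,2)] by (simp add: m_assoc[symmetric])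
qed simp

lemma word_eval_foldr:
  assumes "g ` X \<subseteq> carrier G" "fst ` set u \<subseteq> X" "fst ` set v \<subseteq> X"
  shows "word_eval G g (foldr free_cons u v) = word_eval G g u \<otimes> word_eval G g v"
  using assms(2)
proof (induction u)
  case Nil
  then show ?case using word_eval_closed[OF assms(1,3)] by simp
next
  case (Cons a u)
  have "fst ` set (foldr free_cons u v) \<subseteq> X"
    using Cons.prems assms(3) foldr_free_cons_set[of u v] by fastforce
  then have "word_eval G g (foldr free_cons (a # u) v)
      = letter_eval G g a \<otimes> word_eval G g (foldr free_cons u v)"
    using Cons.prems word_eval_free_cons[OF assms(1)] by simp
  moreover have "letter_eval G g a \<in> carrier G" "word_eval G g u \<in> carrier G"
    using Cons.prems
    by (auto intro!: letter_eval_closed[OF assms(1)] word_eval_closed[OF assms(1)])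
  ultimately show ?case
    using Cons word_eval_closed[OF assms(1,3)] by (simp add: m_assoc)
qed

lemma word_eval_hom:
  assumes "g ` X \<subseteq> carrier G"
  shows "word_eval G g \<in> hom (free_group X) G"
  using word_eval_closed[OF assms] word_eval_foldr[OF assms]
  by (auto simp: hom_def free_group_def)

lemma word_eval_gen:
  "g ` X \<subseteq> carrier G \<Longrightarrow> i \<in> X \<Longrightarrow> word_eval G g [(i, True)] = g i"
  by (auto simp: letter_eval_def)

lemma word_eval_unique:
  assumes g: "g ` X \<subseteq> carrier G" and h: "h \<in> hom (free_group X) G"
    and gen: "\<And>i. i \<in> X \<Longrightarrow> h [(i, True)] = g i"
    and w: "w \<in> carrier (free_group X)"
  shows "h w = word_eval G g w"
proof -
  interpret F: group "free_group X" by (rule group_free_group)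
  interpret group_hom "free_group X" G h
    by (unfold_locales) (rule h)
  have letter: "h [a] = letter_eval G g a" if "fst a \<in> X" for a
  proof (cases "snd a")
    case True
    then have "a = (fst a, True)" by (simp add: prod_eq_iff)
    then have "h [a] = g (fst a)" using gen[OF that] by simp
    then show ?thesis using True by (simp add: letter_eval_def)
  next
    case False
    have pos: "[(fst a, True)] \<in> carrier (free_group X)"
      and neg: "[a] \<in> carrier (free_group X)"
      using that by (auto simp: free_group_def reduced_Cons)
    have "[a] \<otimes>\<^bsub>free_group X\<^esub> [(fst a, True)] = \<one>\<^bsub>free_group X\<^esub>"
      using False by (simp add: free_group_def letter_inv_def)
    then have "[a] = inv\<^bsub>free_group X\<^esub> [(fst a, True)]"
      using F.inv_equality[OF _ pos neg] by simp
    then have "h [a] = inv (h [(fst a, True)])" using hom_inv[OF pos] by simp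
    then show ?thesis using False gen[OF that] by (simp add: letter_eval_def)
  qed
  show ?thesis using w
  proof (induction w)
    case Nil
    then show ?case using hom_one by (simp add: free_group_def)
  next
    case (Cons a w)
    have a: "fst a \<in> X" "[a] \<in> carrier (free_group X)" and w: "w \<in> carrier (free_group X)"
      using Cons.prems by (auto simp: free_group_def reduced_Cons)
    have "a # w = [a] \<otimes>\<^bsub>free_group X\<^esub> w"
      using Cons.prems by (cases w) (auto simp: free_group_def reduced_Cons)
    then have "h (a # w) = h [a] \<otimes> h w" using hom_mult[OF a(2) w] by simp
    then show ?case using letter[OF a(1)] Cons.IH[OF w] by simp
  qed
qed

end

text \<open>$N_{w,G}(x)$ for a word \<open>w\<close> in \<open>k\<close> variables, which are indexed by $0,\dots,k-1$.\<close>

definition word_count ::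
    "nat \<Rightarrow> nat letter list \<Rightarrow> ('a, 'b) monoid_scheme \<Rightarrow> 'a \<Rightarrow> nat" where
  "word_count k w G x = card {g \<in> {..<k} \<rightarrow>\<^sub>E carrier G. word_eval G g w = x}"


section \<open>Finite p-groups and nilpotency class\<close>

definition finite_p_group :: "nat \<Rightarrow> ('a, 'b) monoid_scheme \<Rightarrow> bool" where
  "finite_p_group p G \<longleftrightarrow> group G \<and> finite (carrier G) \<and> (\<exists>n. Coset.order G = p ^ n)"

text \<open>Indices are shifted: \<open>lower_central G n\<close> is $\gamma_{n+1}(G)$.\<close>

primrec lower_central :: "('a, 'b) monoid_scheme \<Rightarrow> nat \<Rightarrow> 'a set" where
  "lower_central G 0 = carrier G"
| "lower_central G (Suc n) = generate G
    (\<Union>x\<in>lower_central G n. \<Union>y\<in>carrier G.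
      {x \<otimes>\<^bsub>G\<^esub> y \<otimes>\<^bsub>G\<^esub> inv\<^bsub>G\<^esub> x \<otimes>\<^bsub>G\<^esub> inv\<^bsub>G\<^esub> y})"

definition has_nilpotency_class :: "('a, 'b) monoid_scheme \<Rightarrow> nat \<Rightarrow> bool" where
  "has_nilpotency_class G c \<longleftrightarrow>
    lower_central G c = {\<one>\<^bsub>G\<^esub>} \<and> (\<forall>n<c. lower_central G n \<noteq> {\<one>\<^bsub>G\<^esub>})"


section \<open>Complex characters\<close>

text \<open>\<open>general_linear n\<close> is $\mathrm{GL}_n(\mathbb{C})$, the group of units of the matrix ring.\<close>

abbreviation general_linear :: "nat \<Rightarrow> complex mat monoid" where
  "general_linear n \<equiv> units_of (ring_mat TYPE(complex) n ())"

definition irreducible_rep ::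
    "('a, 'b) monoid_scheme \<Rightarrow> nat \<Rightarrow> ('a \<Rightarrow> complex mat) \<Rightarrow> bool" where
  "irreducible_rep G n \<rho> \<longleftrightarrow>
    \<rho> \<in> hom G (general_linear n) \<and> n > 0 \<and>
    (\<forall>W. subspace class_ring W (module_vec TYPE(complex) n) \<and>
         (\<forall>g\<in>carrier G. \<forall>v\<in>W. \<rho> g *\<^sub>v v \<in> W)
       \<longrightarrow> W = {0\<^sub>v n} \<or> W = carrier_vec n)"

definition mat_trace :: "complex mat \<Rightarrow> complex" where
  "mat_trace A = (\<Sum>i<dim_row A. A $$ (i, i))"

definition irreducible_characters :: "('a, 'b) monoid_scheme \<Rightarrow> ('a \<Rightarrow> complex) set" where
  "irreducible_characters G =
    {\<chi>. \<exists>n \<rho>. irreducible_rep G n \<rho> \<and> \<chi> = (\<lambda>g\<in>carrier G. mat_trace (\<rho> g))}"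

definition generalized_character ::
    "('a, 'b) monoid_scheme \<Rightarrow> ('a \<Rightarrow> complex) \<Rightarrow> bool" where
  "generalized_character G f \<longleftrightarrow>
    (\<exists>S c. finite S \<and> S \<subseteq> irreducible_characters G \<and>
      (\<forall>g\<in>carrier G. f g = (\<Sum>\<chi>\<in>S. of_int (c \<chi>) * \<chi> g)))"

end

theory Submission
  imports Defs "HOL-Number_Theory.Cong" "HOL-Algebra.Multiplicative_Group"
    "HOL-Algebra.Weak_Morphisms"
begin

text \<open>Write $f = N_{w,G}$ and $Z = Z(G)$, and argue by induction on $|G|$. For a central subgroup
  $B$ one has $\sum_{b \in B} f(xb) = |B|^k N_{w,G/B}(xB)$, so these sums are known to be $|B|^k$
  times generalized characters.

  If $Z$ contains $A \cong C_p \times C_p$, then $p \delta_1 = \sum_B 1_B - 1_A$ on $A$, where $B$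
  runs over the subgroups of order $p$, and convolving with $f$ expresses $f$ through quotients.

  Otherwise $Z = \langle \zeta \rangle$ is cyclic of order $q = p^r$. Let $B$ be its subgroup of
  order $p$. It suffices to treat $f^\circ(x) = f(x) - \frac{1}{p} \sum_{b \in B} f(xb)$, which
  vanishes outside $Z$ because every noncentral $x$ is conjugate to all of $xB$. If some exponent
  sum of $w$ is not divisible by $q$, shifting a variable by a central element shows $f^\circ = 0$.
  If all of them are, then $w(t) = \zeta^{\Phi(t)}$ with $\Phi$ a quadratic map into the integers
  modulo $q$. Two properties of $\Phi$ finish the proof. First, for every $u$ prime to $p$ there is
  a bijection $\beta$ of $G^k$ with $\Phi(\beta(t)) = u \Phi(t)$, so $f^\circ$ is
  $\frac{D}{p} (p 1_{\{1\}} - 1_B)$ with $D = f(1) - f(b)$ for a generator $b$ of $B$. Second, $D$ is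
  divisible by $|L|$ for every abelian subgroup $L$ containing $Z$, since $\Phi$ is affine along the
  cosets of $L$ in one variable. Taking $L$ self-centralizing, a faithful character $\lambda$ of
  $Z$ extends to $L$, the characters $\mathrm{Ind}_L^G \lambda^u$ are irreducible, vanish outside
  $Z$ and equal $|G:L| \lambda^u$ on $Z$; so $f^\circ$ is $D / (|G:L| q)$ times their sum over the
  units $u$ modulo $q$, and $|G:L| q$ divides $|L|$.\<close>

section \<open>Generalized characters\<close>

text \<open>The obstacle is the bijection \<open>\<beta>\<close>. Raising all variables to the power
  \<open>u\<close> multiplies the part of the exponent that comes from q-th powers by
  \<open>u\<close>, but the part that comes from commutators by \<open>u ^ 2\<close>, and
  \<open>u\<close> need not be a square modulo q. So only one of two paired variables may be raised
  to the power \<open>u\<close>. Substitutions multiplying one variable by a product of powers of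
  the others ("pivots") arrange this: one variable then carries a whole linear form, and its pairing
  with the rest is the linear form for the next pivot. The symmetry under units makes f on Z depend
  on the order of the element alone, which leaves a single free constant D. Summing the powers of
  the faithful character over the units gives a Ramanujan sum, q/p times p 1_{1} - 1_B; hence the
  denominator |G:L| q. That it divides |L| follows from |G| q <= |L|^2: an element adjoined to an
  isotropic subgroup enlarges it by at least the factor that its centralizer loses, and between
  powers of p an inequality is a divisibility. Every division by p is paid for by the factor |B|^k,
  where k >= 1.\<close>

lemma generalized_character_irreducible:
  assumes "\<chi> \<in> irreducible_characters G"
  shows "generalized_character G \<chi>"
  unfolding generalized_character_def
  using assms by (intro exI[of _ "{\<chi>}"] exI[of _ "\<lambda>_. 1"]) auto

lemma generalized_character_lincomb:
  assumes "generalized_character G f" "generalized_character G g"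
  shows "generalized_character G (\<lambda>x. of_int m * f x + of_int n * g x)"
proof -
  obtain S c where S: "finite S" "S \<subseteq> irreducible_characters G"
    "\<And>x. x \<in> carrier G \<Longrightarrow> f x = (\<Sum>\<chi>\<in>S. of_int (c \<chi>) * \<chi> x)"
    using assms(1) unfolding generalized_character_def by auto
  obtain T d where T: "finite T" "T \<subseteq> irreducible_characters G"
    "\<And>x. x \<in> carrier G \<Longrightarrow> g x = (\<Sum>\<chi>\<in>T. of_int (d \<chi>) * \<chi> x)"
    using assms(2) unfolding generalized_character_def by auto
  define c' where "c' \<chi> = (if \<chi> \<in> S then c \<chi> else 0)" for \<chi>
  define d' where "d' \<chi> = (if \<chi> \<in> T then d \<chi> else 0)" for \<chi>
  have f: "f x = (\<Sum>\<chi>\<in>S \<union> T. of_int (c' \<chi>) * \<chi> x)" if "x \<in> carrier G" for x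
    unfolding S(3)[OF that] c'_def using S(1) T(1)
    by (intro sum.mono_neutral_cong_left) auto
  have g: "g x = (\<Sum>\<chi>\<in>S \<union> T. of_int (d' \<chi>) * \<chi> x)" if "x \<in> carrier G" for x
    unfolding T(3)[OF that] d'_def using S(1) T(1)
    by (intro sum.mono_neutral_cong_left) auto
  show ?thesis
    unfolding generalized_character_def
    by (intro exI[of _ "S \<union> T"] exI[of _ "\<lambda>\<chi>. m * c' \<chi> + n * d' \<chi>"])
      (use S(1,2) T(1,2) in \<open>auto simp: f g sum_distrib_left sum.distrib algebra_simps\<close>)
qed

lemma generalized_character_cong:
  assumes "generalized_character G f" "\<And>x. x \<in> carrier G \<Longrightarrow> g x = f x"
  shows "generalized_character G g"
  using assms unfolding generalized_character_def by metis

lemma generalized_character_0: "generalized_character G (\<lambda>_. 0)"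
  unfolding generalized_character_def by (intro exI[of _ "{}"]) auto

lemma generalized_character_cmult:
  "generalized_character G f \<Longrightarrow> generalized_character G (\<lambda>x. of_int m * f x)"
  using generalized_character_lincomb[of G f f m 0] by simp

lemma generalized_character_add:
  "generalized_character G f \<Longrightarrow> generalized_character G g \<Longrightarrow>
    generalized_character G (\<lambda>x. f x + g x)"
  using generalized_character_lincomb[of G f g 1 1] by simp

lemma generalized_character_diff:
  "generalized_character G f \<Longrightarrow> generalized_character G g \<Longrightarrow>
    generalized_character G (\<lambda>x. f x - g x)"
  using generalized_character_lincomb[of G f g 1 "-1"] by simp

lemma generalized_character_sum:
  "(\<And>i. i \<in> A \<Longrightarrow> generalized_character G (f i)) \<Longrightarrow>
    generalized_character G (\<lambda>x. \<Sum>i\<in>A. f i x)"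
  by (induction A rule: infinite_finite_induct)
    (auto intro: generalized_character_0 generalized_character_add)

text \<open>By surjectivity the same operators act, so the invariant subspaces are the same. This
  carries the induction hypothesis from a quotient back to the group.\<close>

lemma irreducible_rep_pullback:
  assumes h: "h \<in> hom G H" and surj: "h ` carrier G = carrier H"
    and \<rho>: "irreducible_rep H n \<rho>"
  shows "irreducible_rep G n (\<rho> \<circ> h)"
  unfolding irreducible_rep_def
proof (intro conjI allI impI)
  have r: "\<rho> \<in> hom H (general_linear n)" "n > 0"
    using \<rho> unfolding irreducible_rep_def by auto
  show "\<rho> \<circ> h \<in> hom G (general_linear n)" "n > 0"
    using h r hom_in_carrier[OF h] hom_in_carrier[OF r(1)]
    by (auto intro!: homI simp: hom_mult[OF h] hom_mult[OF r(1)])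
next
  fix W
  assume W: "VectorSpace.subspace class_ring W (module_vec TYPE(complex) n) \<and>
    (\<forall>g\<in>carrier G. \<forall>v\<in>W. (\<rho> \<circ> h) g *\<^sub>v v \<in> W)"
  have "\<forall>g\<in>carrier H. \<forall>v\<in>W. \<rho> g *\<^sub>v v \<in> W"
    unfolding surj[symmetric] using W by auto
  then show "W = {0\<^sub>v n} \<or> W = carrier_vec n"
    using \<rho> W unfolding irreducible_rep_def by blast
qed

lemma generalized_character_pullback:
  assumes h: "h \<in> hom G H" and surj: "h ` carrier G = carrier H"
    and f: "generalized_character H f"
  shows "generalized_character G (f \<circ> h)"
proof -
  obtain S c where S: "finite S" "S \<subseteq> irreducible_characters H"
    "\<And>x. x \<in> carrier H \<Longrightarrow> f x = (\<Sum>\<chi>\<in>S. of_int (c \<chi>) * \<chi> x)"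
    using f unfolding generalized_character_def by auto
  have hc: "h x \<in> carrier H" if "x \<in> carrier G" for x
    using surj that by auto
  have "generalized_character G (\<lambda>x. \<Sum>\<chi>\<in>S. of_int (c \<chi>) * \<chi> (h x))"
  proof (intro generalized_character_sum generalized_character_cmult)
    fix \<chi> assume "\<chi> \<in> S"
    then obtain n \<rho> where \<rho>: "irreducible_rep H n \<rho>" "\<chi> = (\<lambda>g\<in>carrier H. mat_trace (\<rho> g))"
      using S(2) unfolding irreducible_characters_def by auto
    have "(\<lambda>g\<in>carrier G. mat_trace ((\<rho> \<circ> h) g)) \<in> irreducible_characters G"
      unfolding irreducible_characters_def
      using irreducible_rep_pullback[OF h surj \<rho>(1)] by blast
    from generalized_character_irreducible[OF this]
    show "generalized_character G (\<lambda>x. \<chi> (h x))"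
      by (rule generalized_character_cong) (simp add: \<rho>(2) hc)
  qed
  then show ?thesis
    by (rule generalized_character_cong) (simp add: S(3) hc)
qed

section \<open>Irreducible monomial characters\<close>

lemma (in group) m_inv_cancel [simp]:
  assumes "x \<in> carrier G" "y \<in> carrier G"
  shows "x \<otimes> (inv x \<otimes> y) = y" "inv x \<otimes> (x \<otimes> y) = y"
  using assms by (simp_all add: m_assoc[symmetric])

text \<open>Used twice: with \<open>L\<close> a self-centralizing subgroup, and with
  \<open>L\<close> the whole trivial group and \<open>\<mu>\<close> constantly 1.\<close>

locale monomial_induction = group G for G (structure) +
  fixes L :: "'a set" and \<mu> :: "'a \<Rightarrow> complex"
  assumes fin: "finite (carrier G)"
    and L_normal: "L \<lhd> G"
    and \<mu>_mult: "\<And>x y. x \<in> L \<Longrightarrow> y \<in> L \<Longrightarrow> \<mu> (x \<otimes> y) = \<mu> x * \<mu> y"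
    and \<mu>_one: "\<mu> \<one> = 1"
begin

lemma L_sub: "subgroup L G"
  using L_normal by (simp add: normal_def)

lemma L_carr: "x \<in> L \<Longrightarrow> x \<in> carrier G"
  using L_sub subgroup.subset by blast

lemma L_one [simp]: "\<one> \<in> L"
  by (rule subgroup.one_closed[OF L_sub])

lemma L_mult: "x \<in> L \<Longrightarrow> y \<in> L \<Longrightarrow> x \<otimes> y \<in> L"
  by (rule subgroup.m_closed[OF L_sub])

lemma L_inv: "x \<in> L \<Longrightarrow> inv x \<in> L"
  by (rule subgroup.m_inv_closed[OF L_sub])

lemma L_conj: "x \<in> carrier G \<Longrightarrow> l \<in> L \<Longrightarrow> inv x \<otimes> l \<otimes> x \<in> L"
  by (rule normal.inv_op_closed1[OF L_normal])

lemma L_conj': "x \<in> carrier G \<Longrightarrow> l \<in> L \<Longrightarrow> x \<otimes> l \<otimes> inv x \<in> L"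
  by (rule normal.inv_op_closed2[OF L_normal])

text \<open>The extension by zero that enters the usual formula for an induced character.\<close>

definition \<nu> :: "'a \<Rightarrow> complex" where
  "\<nu> x = (if x \<in> L then \<mu> x else 0)"

lemma mem_L_mult_iff:
  assumes x: "x \<in> carrier G" and y: "y \<in> L"
  shows "x \<otimes> y \<in> L \<longleftrightarrow> x \<in> L" "y \<otimes> x \<in> L \<longleftrightarrow> x \<in> L"
proof -
  have yc: "y \<in> carrier G" and yi: "inv y \<in> L" using y by (simp_all only: L_carr L_inv)
  have "x \<otimes> y \<otimes> inv y = x" "inv y \<otimes> (y \<otimes> x) = x"
    using x yc by (simp_all add: m_assoc)
  then show "x \<otimes> y \<in> L \<longleftrightarrow> x \<in> L" "y \<otimes> x \<in> L \<longleftrightarrow> x \<in> L"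
    using L_mult y yi by metis+
qed

lemma \<nu>_mult: "x \<in> carrier G \<Longrightarrow> y \<in> L \<Longrightarrow> \<nu> (x \<otimes> y) = \<nu> x * \<mu> y"
  unfolding \<nu>_def by (cases "x \<in> L") (simp_all add: mem_L_mult_iff \<mu>_mult)

lemma \<nu>_mult': "x \<in> carrier G \<Longrightarrow> y \<in> L \<Longrightarrow> \<nu> (y \<otimes> x) = \<mu> y * \<nu> x"
  unfolding \<nu>_def by (cases "x \<in> L") (simp_all add: mem_L_mult_iff \<mu>_mult)

lemma \<mu>_inv: "y \<in> L \<Longrightarrow> \<mu> (inv y) * \<mu> y = 1"
  using \<mu>_mult[of "inv y" y] by (simp add: \<mu>_one L_inv L_carr)

lemma \<nu>_conj:
  assumes "x \<in> carrier G" "y \<in> L"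
  shows "\<nu> (inv y \<otimes> x \<otimes> y) = \<nu> x"
proof -
  have "y \<in> carrier G" "inv y \<in> L" using assms by (simp_all add: L_carr L_inv)
  then have "\<nu> (inv y \<otimes> x \<otimes> y) = \<mu> (inv y) * \<nu> x * \<mu> y"
    using assms by (simp add: \<nu>_mult \<nu>_mult')
  then show ?thesis using \<mu>_inv[OF assms(2)] by (simp add: mult.commute mult.left_commute)
qed

text \<open>Representatives of the left cosets of \<open>L\<close>, numbered from 0 because they
  will index the rows and columns of a matrix.\<close>

lemma transversal:
  obtains n :: nat and r :: "nat \<Rightarrow> 'a"
  where "n > 0" "\<And>i. i < n \<Longrightarrow> r i \<in> carrier G"
    "\<And>g. g \<in> carrier G \<Longrightarrow> \<exists>!i. i < n \<and> inv (r i) \<otimes> g \<in> L"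
proof -
  \<comment> \<open>\<open>c g\<close> is the left coset of \<open>g\<close>; the next facts make
    these sets the classes of an equivalence relation.\<close>
  define c where "c g = {h \<in> carrier G. inv g \<otimes> h \<in> L}" for g
  have c_self: "g \<in> c g" if "g \<in> carrier G" for g
    using that by (simp add: c_def)
  have c_sub: "c h \<subseteq> c g" if "h \<in> c g" "g \<in> carrier G" for g h
  proof
    fix x assume x: "x \<in> c h"
    have hx: "h \<in> carrier G" "x \<in> carrier G" "inv g \<otimes> h \<in> L" "inv h \<otimes> x \<in> L"
      using that x by (simp_all add: c_def)
    have "(inv g \<otimes> h) \<otimes> (inv h \<otimes> x) \<in> L"
      by (rule L_mult[OF hx(3,4)])
    also have "(inv g \<otimes> h) \<otimes> (inv h \<otimes> x) = inv g \<otimes> x"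
      using that hx by (simp add: m_assoc)
    finally show "x \<in> c g" using that x by (simp add: c_def)
  qed
  have c_sym: "g \<in> c h" if "h \<in> c g" "g \<in> carrier G" for g h
  proof -
    have "inv (inv g \<otimes> h) \<in> L" using that by (intro L_inv) (auto simp: c_def)
    then show ?thesis using that by (auto simp: c_def inv_mult_group)
  qed
  have c_eq: "c g = c h \<longleftrightarrow> h \<in> c g" if "g \<in> carrier G" "h \<in> carrier G" for g h
  proof
    assume "c g = c h"
    then show "h \<in> c g" using c_self[OF that(2)] by simp
  next
    assume h: "h \<in> c g"
    then show "c g = c h"
      using c_sub[OF h that(1)] c_sub[OF c_sym[OF h that(1)] that(2)] by (rule_tac equalityI)
  qed
  have finC: "finite (c ` carrier G)" using fin by simp
  define n where "n = card (c ` carrier G)"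
  obtain e where e: "bij_betw e {0..<n} (c ` carrier G)"
    using ex_bij_betw_nat_finite[OF finC] unfolding n_def by blast
  define r where "r i = inv_into (carrier G) c (e i)" for i
  have e_im: "e ` {0..<n} = c ` carrier G" and e_inj: "inj_on e {0..<n}"
    using e by (auto simp: bij_betw_def)
  have r: "r i \<in> carrier G \<and> c (r i) = e i" if "i < n" for i
  proof -
    have "e i \<in> c ` carrier G" using e_im that by (metis atLeastLessThan_iff image_eqI zero_le)
    then show ?thesis unfolding r_def using inv_into_into f_inv_into_f by metis
  qed
  show ?thesis
  proof (rule that[of n r])
    show "n > 0" unfolding n_def using finC one_closed by (auto simp: card_gt_0_iff)
    show "r i \<in> carrier G" if "i < n" for i using r[OF that] by simp
    fix g assume g: "g \<in> carrier G"
    have iff: "inv (r i) \<otimes> g \<in> L \<longleftrightarrow> e i = c g" if "i < n" for i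
    proof -
      have "g \<in> c (r i) \<longleftrightarrow> inv (r i) \<otimes> g \<in> L" using g by (simp add: c_def)
      then show ?thesis using r[OF that] c_eq[of "r i" g] g by simp
    qed
    have "c g \<in> e ` {0..<n}" unfolding e_im using g by (rule imageI)
    then obtain i where i: "i < n" "c g = e i" by auto
    have "i' = i" if "i' < n" "e i' = c g" for i'
      using inj_onD[OF e_inj, of i' i] i that by simp
    then show "\<exists>!i. i < n \<and> inv (r i) \<otimes> g \<in> L"
      using i iff by (intro ex1I[of _ i]) (simp, metis)
  qed
qed

declare L_carr[simp] L_inv[simp]

text \<open>The subgroup \<open>L\<close> acts diagonally on the induced module, with pairwise distinct characters
  on the coordinates, so an invariant subspace contains a unit vector.\<close>

lemma induced_irreducible_character:
  assumes separated: "\<And>g. g \<in> carrier G \<Longrightarrow> g \<notin> L \<Longrightarrow> \<exists>l\<in>L. \<mu> (inv g \<otimes> l \<otimes> g) \<noteq> \<mu> l"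
  shows "(\<lambda>g\<in>carrier G. (\<Sum>x\<in>carrier G. \<nu> (inv x \<otimes> g \<otimes> x)) / of_nat (card L))
    \<in> irreducible_characters G"
proof -
  obtain n :: nat and r where n: "n > 0" and r [simp]: "\<And>i. i < n \<Longrightarrow> r i \<in> carrier G"
    and tr: "\<And>g. g \<in> carrier G \<Longrightarrow> \<exists>!i. i < n \<and> inv (r i) \<otimes> g \<in> L"
    by (rule transversal, rule that)
  have r_eq: "i = j" if "i < n" "j < n" "inv (r i) \<otimes> r j \<in> L" for i j
    using tr[OF r[OF that(2)]] that by (metis L_one l_inv r)
  \<comment> \<open>The induced module in the basis of cosets: if
    \<open>g \<otimes> r j = r i \<otimes> l\<close> with \<open>l\<close> in \<open>L\<close>, then
    column \<open>j\<close> has the entry \<open>\<mu> l\<close> in row \<open>i\<close> and zeros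
    elsewhere.\<close>
  define \<rho> where "\<rho> g = mat n n (\<lambda>(i, j). \<nu> (inv (r i) \<otimes> g \<otimes> r j))" for g
  have \<rho>_carrier [simp]: "\<rho> g \<in> carrier_mat n n" for g by (simp add: \<rho>_def)
  have \<rho>_mult: "\<rho> (g \<otimes> h) = \<rho> g * \<rho> h" if [simp]: "g \<in> carrier G" "h \<in> carrier G" for g h
  proof (rule eq_matI)
    fix i k assume "i < dim_row (\<rho> g * \<rho> h)" "k < dim_col (\<rho> g * \<rho> h)"
    then have [simp]: "i < n" "k < n" by (auto simp: \<rho>_def)
    \<comment> \<open>Column \<open>k\<close> of \<open>\<rho> h\<close> has a single nonzero entry,
      in the row of the coset of \<open>h \<otimes> r k\<close>, so the matrix product has only one
      term.\<close>
    obtain j where j: "j < n" "inv (r j) \<otimes> (h \<otimes> r k) \<in> L"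
      and uniq: "\<And>j'. j' < n \<Longrightarrow> inv (r j') \<otimes> (h \<otimes> r k) \<in> L \<Longrightarrow> j' = j"
      using tr[of "h \<otimes> r k"] by auto
    have "(\<rho> g * \<rho> h) $$ (i, k) = (\<Sum>j'<n. \<nu> (inv (r i) \<otimes> g \<otimes> r j') * \<nu> (inv (r j') \<otimes> h \<otimes> r k))"
      by (simp add: \<rho>_def scalar_prod_def lessThan_atLeast0)
    also have "\<dots> = (\<Sum>j'\<in>{j}. \<nu> (inv (r i) \<otimes> g \<otimes> r j') * \<nu> (inv (r j') \<otimes> h \<otimes> r k))"
    proof (intro sum.mono_neutral_right ballI)
      fix j' assume j': "j' \<in> {..<n} - {j}"
      then have "inv (r j') \<otimes> h \<otimes> r k \<notin> L"
        using uniq[of j'] by (auto simp: m_assoc)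
      then show "\<nu> (inv (r i) \<otimes> g \<otimes> r j') * \<nu> (inv (r j') \<otimes> h \<otimes> r k) = 0"
        by (simp add: \<nu>_def)
    qed (use j in auto)
    also have "\<dots> = \<nu> ((inv (r i) \<otimes> g \<otimes> r j) \<otimes> (inv (r j) \<otimes> (h \<otimes> r k)))"
      using j by (subst \<nu>_mult) (simp_all add: m_assoc \<nu>_def)
    also have "(inv (r i) \<otimes> g \<otimes> r j) \<otimes> (inv (r j) \<otimes> (h \<otimes> r k)) =
        inv (r i) \<otimes> g \<otimes> (r j \<otimes> inv (r j)) \<otimes> (h \<otimes> r k)"
      using j(1) by (simp add: m_assoc del: r_inv)
    also have "\<dots> = inv (r i) \<otimes> (g \<otimes> h) \<otimes> r k"
      using j(1) by (simp add: m_assoc)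
    finally show "\<rho> (g \<otimes> h) $$ (i, k) = (\<rho> g * \<rho> h) $$ (i, k)" by (simp add: \<rho>_def)
  qed (auto simp: \<rho>_def)
  \<comment> \<open>Normality of \<open>L\<close> makes \<open>\<rho> l\<close> diagonal for
    \<open>l\<close> in \<open>L\<close>, the entries being conjugates of
    \<open>\<mu>\<close>.\<close>
  have \<nu>_diag: "\<nu> (inv (r i) \<otimes> l \<otimes> r j) = (if i = j then \<mu> (inv (r i) \<otimes> l \<otimes> r i) else 0)"
    if [simp]: "l \<in> L" "i < n" "j < n" for l i j
  proof (cases "i = j")
    case False
    have "inv (r i) \<otimes> l \<otimes> r j \<notin> L"
    proof
      assume "inv (r i) \<otimes> l \<otimes> r j \<in> L"
      moreover have "inv (inv (r j) \<otimes> l \<otimes> r j) \<in> L" by (intro L_inv L_conj) auto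
      ultimately have "(inv (r i) \<otimes> l \<otimes> r j) \<otimes> inv (inv (r j) \<otimes> l \<otimes> r j) \<in> L" by (rule L_mult)
      also have "(inv (r i) \<otimes> l \<otimes> r j) \<otimes> inv (inv (r j) \<otimes> l \<otimes> r j) = inv (r i) \<otimes> r j"
        by (simp add: inv_mult_group m_assoc)
      finally show False using r_eq[of i j] False by simp
    qed
    then show ?thesis using False by (simp add: \<nu>_def)
  qed (auto simp: \<nu>_def L_conj)
  have \<rho>_one: "\<rho> \<one> = 1\<^sub>m n"
  proof (rule eq_matI)
    fix i j assume "i < dim_row (1\<^sub>m n :: complex mat)" "j < dim_col (1\<^sub>m n :: complex mat)"
    then show "\<rho> \<one> $$ (i, j) = 1\<^sub>m n $$ (i, j)"
      using \<nu>_diag[of \<one> i j] by (simp add: \<rho>_def \<mu>_one)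
  qed (auto simp: \<rho>_def)
  have \<rho>_hom: "\<rho> \<in> hom G (general_linear n)"
  proof (rule homI)
    fix g assume g: "g \<in> carrier G"
    have "\<rho> g * \<rho> (inv g) = 1\<^sub>m n" "\<rho> (inv g) * \<rho> g = 1\<^sub>m n"
      using g by (simp_all add: \<rho>_mult[symmetric] \<rho>_one)
    then show "\<rho> g \<in> carrier (general_linear n)"
      by (auto simp: units_of_def Units_def ring_mat_simps intro!: bexI[of _ "\<rho> (inv g)"])
  qed (simp add: \<rho>_mult units_of_def ring_mat_simps)
  have diag: "(\<rho> l *\<^sub>v v) $ i = \<mu> (inv (r i) \<otimes> l \<otimes> r i) * v $ i"
    if "l \<in> L" "v \<in> carrier_vec n" "i < n" for l v i
  proof -
    have "(\<rho> l *\<^sub>v v) $ i = (\<Sum>j<n. \<nu> (inv (r i) \<otimes> l \<otimes> r j) * v $ j)"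
      using that by (simp add: \<rho>_def scalar_prod_def lessThan_atLeast0)
    also have "\<dots> = (\<Sum>j<n. if i = j then \<mu> (inv (r i) \<otimes> l \<otimes> r i) * v $ j else 0)"
      using that by (intro sum.cong) (auto simp: \<nu>_diag)
    finally show ?thesis using that by simp
  qed
  \<comment> \<open>This is \<open>separated\<close> for \<open>inv (r j) \<otimes> r k\<close>,
    with the witness conjugated by \<open>r j\<close>.\<close>
  have sep: "\<exists>l\<in>L. \<mu> (inv (r j) \<otimes> l \<otimes> r j) \<noteq> \<mu> (inv (r k) \<otimes> l \<otimes> r k)"
    if [simp]: "j < n" "k < n" and "j \<noteq> k" for j k
  proof -
    have "inv (r j) \<otimes> r k \<notin> L" using r_eq[of j k] that by auto
    then obtain l where l [simp]: "l \<in> L" and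
      ne: "\<mu> (inv (inv (r j) \<otimes> r k) \<otimes> l \<otimes> (inv (r j) \<otimes> r k)) \<noteq> \<mu> l"
      using separated[of "inv (r j) \<otimes> r k"] by auto
    have "inv (r j) \<otimes> (r j \<otimes> l \<otimes> inv (r j)) \<otimes> r j = (inv (r j) \<otimes> r j) \<otimes> l \<otimes> (inv (r j) \<otimes> r j)"
      by (simp add: m_assoc del: l_inv)
    then have 1: "inv (r j) \<otimes> (r j \<otimes> l \<otimes> inv (r j)) \<otimes> r j = l" by simp
    have 2: "inv (inv (r j) \<otimes> r k) \<otimes> l \<otimes> (inv (r j) \<otimes> r k) =
        inv (r k) \<otimes> (r j \<otimes> l \<otimes> inv (r j)) \<otimes> r k"
      by (simp add: m_assoc inv_mult_group)
    show ?thesis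
      using ne 1 2 L_conj'[of "r j" l] by (intro bexI[of _ "r j \<otimes> l \<otimes> inv (r j)"]) auto
  qed
  have "irreducible_rep G n \<rho>"
    unfolding irreducible_rep_def
  proof (intro conjI allI impI)
    show "\<rho> \<in> hom G (general_linear n)" "n > 0" by fact+
    fix W
    assume W: "VectorSpace.subspace class_ring W (module_vec TYPE(complex) n) \<and>
      (\<forall>g\<in>carrier G. \<forall>v\<in>W. \<rho> g *\<^sub>v v \<in> W)"
    have sm: "submodule class_ring W (module_vec TYPE(complex) n)"
      using W by (simp add: VectorSpace.subspace_def)
    have W_carr: "v \<in> carrier_vec n" if "v \<in> W" for v
      using submodule.subset[OF sm] that by (auto simp: module_vec_simps)
    have W_add: "u + v \<in> W" if "u \<in> W" "v \<in> W" for u v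
      using submodule.m_closed[OF sm that] by (simp add: module_vec_simps)
    have W_smult: "c \<cdot>\<^sub>v v \<in> W" if "v \<in> W" for c v
      using submodule.smult_closed[OF sm, of c v] that by (simp add: module_vec_simps)
    have W_inv: "\<rho> g *\<^sub>v v \<in> W" if "g \<in> carrier G" "v \<in> W" for g v
      using W that by blast
    show "W = {0\<^sub>v n} \<or> W = carrier_vec n"
    proof (cases "W \<subseteq> {0\<^sub>v n}")
      case True
      have "0\<^sub>v n \<in> W" using submodule.zero_closed[OF sm] by (simp add: module_vec_simps)
      then show ?thesis using True by auto
    next
      case False
      then obtain v where v: "v \<in> W" "v \<noteq> 0\<^sub>v n" by auto
      then obtain j where j [simp]: "j < n" and vj: "v $ j \<noteq> 0"
        using eq_vecI[of v "0\<^sub>v n"] W_carr[OF v(1)] by fastforce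
      \<comment> \<open>The coordinates in \<open>K\<close> are killed one at a time while
        coordinate \<open>j\<close> stays normalized to 1.\<close>
      have "\<exists>u\<in>W. u $ j = 1 \<and> (\<forall>k\<in>K. u $ k = 0)" if "finite K" "K \<subseteq> {..<n} - {j}" for K
        using that
      proof (induction K rule: finite_induct)
        case empty
        then show ?case
          using W_smult[OF v(1), of "1 / v $ j"] vj W_carr[OF v(1)]
          by (intro bexI[of _ "(1 / v $ j) \<cdot>\<^sub>v v"]) auto
      next
        case (insert k K)
        then obtain u where u: "u \<in> W" "u $ j = 1" "\<And>i. i \<in> K \<Longrightarrow> u $ i = 0" by auto
        have k [simp]: "k < n" "k \<noteq> j" and K: "\<And>i. i \<in> K \<Longrightarrow> i < n" using insert.prems by auto
        let ?c = "\<lambda>l i. \<mu> (inv (r i) \<otimes> l \<otimes> r i)"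
        obtain l where l: "l \<in> L" "?c l j \<noteq> ?c l k"
          using sep[OF j k(1)] k(2) by metis
        \<comment> \<open>Coordinate \<open>i\<close> is multiplied by
          \<open>?c l i - ?c l k\<close> and then rescaled: this kills coordinate \<open>k\<close>,
          keeps the zeros already made, and restores the 1 at \<open>j\<close>.\<close>
        define w where "w = (1 / (?c l j - ?c l k)) \<cdot>\<^sub>v (\<rho> l *\<^sub>v u + (- ?c l k) \<cdot>\<^sub>v u)"
        have "w \<in> W"
          unfolding w_def using l u by (intro W_smult W_add W_inv) auto
        moreover have "w $ i = (?c l i - ?c l k) / (?c l j - ?c l k) * u $ i" if "i < n" for i
        proof -
          have "w $ i = (1 / (?c l j - ?c l k)) * ((\<rho> l *\<^sub>v u) $ i + (- ?c l k) * u $ i)"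
            using that W_carr[OF u(1)] unfolding w_def
            by (simp add: \<rho>_def)
          also have "(\<rho> l *\<^sub>v u) $ i = ?c l i * u $ i"
            using diag[OF l(1) W_carr[OF u(1)] that] .
          finally show ?thesis by (simp add: field_simps)
        qed
        ultimately show ?case
          using u l K by (intro bexI[of _ w]) auto
      qed
      from this[of "{..<n} - {j}"] obtain u where u: "u \<in> W" "u $ j = 1"
        "\<And>k. k < n \<Longrightarrow> k \<noteq> j \<Longrightarrow> u $ k = 0" by auto
      have u_unit: "u = unit_vec n j"
        using u W_carr[OF u(1)] by (intro eq_vecI) (auto simp: unit_vec_def)
      \<comment> \<open>The element \<open>r i \<otimes> inv (r j)\<close> maps the coset of
        \<open>r j\<close> to that of \<open>r i\<close>, with coefficient
        \<open>\<mu> \<one>\<close>.\<close>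
      have unit: "unit_vec n i \<in> W" if [simp]: "i < n" for i
      proof -
        have "\<rho> (r i \<otimes> inv (r j)) *\<^sub>v u = unit_vec n i"
        proof (rule eq_vecI)
          fix i' assume "i' < dim_vec (unit_vec n i)"
          then have [simp]: "i' < n" by simp
          have "(\<rho> (r i \<otimes> inv (r j)) *\<^sub>v u) $ i' = \<nu> (inv (r i') \<otimes> (r i \<otimes> inv (r j)) \<otimes> r j)"
            unfolding u_unit by (simp add: \<rho>_def)
          also have "inv (r i') \<otimes> (r i \<otimes> inv (r j)) \<otimes> r j = inv (r i') \<otimes> \<one> \<otimes> r i"
            by (simp add: m_assoc)
          also have "\<nu> \<dots> = unit_vec n i $ i'"
            by (subst \<nu>_diag) (auto simp: \<mu>_one unit_vec_def)
          finally show "(\<rho> (r i \<otimes> inv (r j)) *\<^sub>v u) $ i' = unit_vec n i $ i'" .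
        qed (simp add: \<rho>_def)
        then show ?thesis using W_inv[of "r i \<otimes> inv (r j)" u] u(1) by simp
      qed
      have "v \<in> W" if v: "v \<in> carrier_vec n" for v
      proof -
        have "vec n (\<lambda>i. if i < m then v $ i else 0) \<in> W" if "m \<le> n" for m
          using that
        proof (induction m)
          case 0
          have "vec n (\<lambda>i. if i < 0 then v $ i else 0) = 0 \<cdot>\<^sub>v u"
            using W_carr[OF u(1)] by (intro eq_vecI) auto
          then show ?case using W_smult[OF u(1)] by simp
        next
          case (Suc m)
          have "vec n (\<lambda>i. if i < Suc m then v $ i else 0) =
              vec n (\<lambda>i. if i < m then v $ i else 0) + v $ m \<cdot>\<^sub>v unit_vec n m"
            using Suc.prems by (intro eq_vecI) (auto simp: less_Suc_eq unit_vec_def)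
          then show ?case using Suc unit[of m] W_smult W_add by simp
        qed
        moreover have "vec n (\<lambda>i. if i < n then v $ i else 0) = v"
          using v by (intro eq_vecI) auto
        ultimately show ?thesis by (metis le_refl)
      qed
      then show ?thesis using W_carr by auto
    qed
  qed
  moreover have "mat_trace (\<rho> g) = (\<Sum>x\<in>carrier G. \<nu> (inv x \<otimes> g \<otimes> x)) / of_nat (card L)"
    if [simp]: "g \<in> carrier G" for g
  proof -
    \<comment> \<open>In the sum over \<open>r i \<otimes> l\<close> the term does not depend on
      \<open>l\<close>, since \<open>\<nu>\<close> is invariant under conjugation by
      \<open>L\<close>; each diagonal entry of \<open>\<rho> g\<close> is therefore counted
      \<open>card L\<close> times.\<close>
    have bij: "bij_betw (\<lambda>(i, l). r i \<otimes> l) ({..<n} \<times> L) (carrier G)"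
    proof (intro bij_betwI')
      fix p q assume pq: "p \<in> {..<n} \<times> L" "q \<in> {..<n} \<times> L"
      obtain i l j m where [simp]: "p = (i, l)" "q = (j, m)" by fastforce
      have [simp]: "i < n" "j < n" "l \<in> L" "m \<in> L" using pq by auto
      show "((case p of (i, l) \<Rightarrow> r i \<otimes> l) = (case q of (i, l) \<Rightarrow> r i \<otimes> l)) = (p = q)"
      proof
        assume eq: "(case p of (i, l) \<Rightarrow> r i \<otimes> l) = (case q of (i, l) \<Rightarrow> r i \<otimes> l)"
        then have "r i \<otimes> l = r j \<otimes> m" by simp
        then have "inv (r i) \<otimes> (r i \<otimes> l) \<otimes> inv m = inv (r i) \<otimes> (r j \<otimes> m) \<otimes> inv m" by simp
        then have "l \<otimes> inv m = inv (r i) \<otimes> r j" by (simp add: m_assoc)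
        then have "inv (r i) \<otimes> r j \<in> L" by (metis L_inv L_mult \<open>l \<in> L\<close> \<open>m \<in> L\<close>)
        then have "i = j" using r_eq by simp
        then show "p = q" using eq by simp
      qed simp
    next
      fix p assume "p \<in> {..<n} \<times> L"
      then show "(case p of (i, l) \<Rightarrow> r i \<otimes> l) \<in> carrier G" by auto
    next
      fix x assume x: "x \<in> carrier G"
      then obtain i where "i < n" "inv (r i) \<otimes> x \<in> L" using tr by blast
      then show "\<exists>p\<in>{..<n} \<times> L. x = (case p of (i, l) \<Rightarrow> r i \<otimes> l)"
        using x by (intro bexI[of _ "(i, inv (r i) \<otimes> x)"]) (auto simp: m_assoc[symmetric])
    qed
    have "(\<Sum>x\<in>carrier G. \<nu> (inv x \<otimes> g \<otimes> x)) =
        (\<Sum>(i, l)\<in>{..<n} \<times> L. \<nu> (inv (r i \<otimes> l) \<otimes> g \<otimes> (r i \<otimes> l)))"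
      using sum.reindex_bij_betw[OF bij, of "\<lambda>x. \<nu> (inv x \<otimes> g \<otimes> x)"]
      by (simp add: case_prod_unfold)
    also have "\<dots> = (\<Sum>(i, l)\<in>{..<n} \<times> L. \<nu> (inv (r i) \<otimes> g \<otimes> r i))"
    proof (intro sum.cong refl, clarsimp)
      fix i l assume [simp]: "i < n" "l \<in> L"
      have "inv (r i \<otimes> l) \<otimes> g \<otimes> (r i \<otimes> l) = inv l \<otimes> (inv (r i) \<otimes> g \<otimes> r i) \<otimes> l"
        by (simp add: inv_mult_group m_assoc)
      then show "\<nu> (inv (r i \<otimes> l) \<otimes> g \<otimes> (r i \<otimes> l)) = \<nu> (inv (r i) \<otimes> g \<otimes> r i)"
        by (simp add: \<nu>_conj)
    qed
    also have "\<dots> = of_nat (card L) * (\<Sum>i<n. \<nu> (inv (r i) \<otimes> g \<otimes> r i))"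
      by (simp add: sum.cartesian_product[symmetric] sum_distrib_left)
    finally have "(\<Sum>x\<in>carrier G. \<nu> (inv x \<otimes> g \<otimes> x)) = of_nat (card L) * mat_trace (\<rho> g)"
      by (simp add: mat_trace_def \<rho>_def)
    moreover have "card L \<noteq> 0"
      using finite_subset[OF subgroup.subset[OF L_sub] fin] L_one by (metis card_eq_0_iff empty_iff)
    ultimately show ?thesis by simp
  qed
  ultimately show ?thesis
    unfolding irreducible_characters_def
    by (intro CollectI exI[of _ n] exI[of _ \<rho>] conjI) (auto simp: restrict_def)
qed

end

section \<open>Quadratic maps modulo a prime power\<close>

text \<open>The pivot is an entry of minimal \<open>p\<close>-adic valuation.\<close>

lemma pivot_exists:
  fixes v :: "'i \<Rightarrow> int" and p r :: nat
  assumes p: "prime p" and I: "finite I" "I \<noteq> {}"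
  obtains m \<rho> where "m \<in> I" "\<And>j. j \<in> I \<Longrightarrow> [v j + v m * int (\<rho> j) = 0] (mod int (p ^ r))"
proof -
  \<comment> \<open>The p-part of \<open>v j\<close>, capped at \<open>p ^ r\<close>. Being powers
    of \<open>p\<close>, these numbers are totally ordered by divisibility, so a minimal one divides
    all.\<close>
  define d where "d j = nat (gcd (v j) (int (p ^ r)))" for j
  have q: "p ^ r > 0" using p by (simp add: prime_gt_0_nat)
  have int_d: "int (d j) = gcd (v j) (int (p ^ r))" for j
    unfolding d_def by simp
  have "\<exists>e. d j = p ^ e" for j
  proof -
    have "int (d j) dvd int (p ^ r)" unfolding int_d by simp
    then have "d j dvd p ^ r" by (simp only: int_dvd_int_iff)
    then show ?thesis using divides_primepow_nat[OF p] by blast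
  qed
  then obtain e where e: "\<And>j. d j = p ^ e j" by metis
  obtain m where m: "m \<in> I" "\<And>j. j \<in> I \<Longrightarrow> e m \<le> e j"
    using ex_is_arg_min_if_finite[OF I, of e] by (auto simp: is_arg_min_def not_less)
  have "\<exists>k::nat. [v j + v m * int k = 0] (mod int (p ^ r))" if "j \<in> I" for j
  proof -
    have "d m dvd d j" using m(2)[OF that] by (simp add: e le_imp_power_dvd)
    then have "gcd (v m) (int (p ^ r)) dvd gcd (v j) (int (p ^ r))"
      unfolding int_d[symmetric] by simp
    then have "gcd (v m) (int (p ^ r)) dvd v j" by simp
    then obtain c where c: "v j = gcd (v m) (int (p ^ r)) * c" by (elim dvdE)
    obtain a b where ab: "a * v m + b * int (p ^ r) = gcd (v m) (int (p ^ r))"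
      using bezout_int by blast
    \<comment> \<open>A solution of \<open>v m * k = - v j\<close>, reduced to a natural number
      because it will serve as an exponent of group elements.\<close>
    define k where "k = nat ((- (a * c)) mod int (p ^ r))"
    have "[int k = - (a * c)] (mod int (p ^ r))"
      unfolding k_def using q by (simp add: cong_def)
    then have "[v j + v m * int k = v j + v m * (- (a * c))] (mod int (p ^ r))"
      by (intro cong_add cong_mult) auto
    also have "v j + v m * (- (a * c)) = int (p ^ r) * (b * c)"
      unfolding c ab[symmetric] by (simp add: algebra_simps)
    also have "[\<dots> = 0] (mod int (p ^ r))" by (simp add: cong_0_iff)
    finally show ?thesis by blast
  qed
  then show ?thesis using m(1) that by metis
qed

text \<open>Every nonzero subgroup of the integers modulo \<open>p ^ r\<close> contains the smallest
  one, generated by \<open>p ^ (r - 1)\<close>: by Bezout the multiples of \<open>d\<close> include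
  some \<open>p ^ e\<close> with \<open>e < r\<close>.\<close>

lemma exists_multiple_cong_socle:
  fixes d :: int and p r :: nat
  assumes p: "prime p" and d: "\<not> [d = 0] (mod int (p ^ r))"
  obtains n :: nat where "[int n * d = int (p ^ (r - 1))] (mod int (p ^ r))"
proof -
  have q: "p ^ r > 0" using p by (simp add: prime_gt_0_nat)
  have "gcd d (int (p ^ r)) dvd int (p ^ r)" by simp
  then have "nat (gcd d (int (p ^ r))) dvd p ^ r" by (simp add: nat_dvd_iff)
  then obtain e where e: "e \<le> r" "nat (gcd d (int (p ^ r))) = p ^ e"
    using divides_primepow_nat[OF p] by blast
  then have g: "gcd d (int (p ^ r)) = int (p ^ e)" by (metis gcd_ge_0_int nat_0_le)
  have "e \<noteq> r"
  proof
    assume "e = r"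
    then have "int (p ^ r) dvd d" using g by (metis gcd_dvd1)
    then show False using d by (simp add: cong_0_iff)
  qed
  then have er: "p ^ (r - 1) = p ^ e * p ^ (r - 1 - e)" using e(1) by (simp flip: power_add)
  obtain a c where ac: "a * d + c * int (p ^ r) = int (p ^ e)"
    using bezout_int[of d "int (p ^ r)"] g by metis
  define n where "n = nat ((a * int (p ^ (r - 1 - e))) mod int (p ^ r))"
  have "[int n = a * int (p ^ (r - 1 - e))] (mod int (p ^ r))"
    unfolding n_def using q by (simp add: cong_def)
  then have "[int n * d = a * int (p ^ (r - 1 - e)) * d] (mod int (p ^ r))"
    by (rule cong_scalar_right)
  moreover have "[a * int (p ^ (r - 1 - e)) * d = int (p ^ (r - 1))] (mod int (p ^ r))"
  proof -
    have "int (p ^ (r - 1)) - a * int (p ^ (r - 1 - e)) * d = int (p ^ r) * (c * int (p ^ (r - 1 - e)))"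
      unfolding er of_nat_mult ac[symmetric] by (simp add: algebra_simps)
    then show ?thesis by (metis cong_iff_dvd_diff cong_sym dvd_triv_left)
  qed
  ultimately show ?thesis using that cong_trans by blast
qed

text \<open>A tuple over \<open>insert m J\<close> is a tuple over \<open>J\<close> together with a
  value at \<open>m\<close>, and the two parts may be permuted separately. The restriction makes the
  argument of \<open>\<beta>\<close> extensional on \<open>J\<close>.\<close>

lemma bij_betw_PiE_insert:
  assumes m: "m \<notin> J" and \<beta>: "bij_betw \<beta> (J \<rightarrow>\<^sub>E C) (J \<rightarrow>\<^sub>E C)" and s: "bij_betw s C C"
  shows "bij_betw (\<lambda>t. (\<beta> (restrict t J))(m := s (t m))) (insert m J \<rightarrow>\<^sub>E C) (insert m J \<rightarrow>\<^sub>E C)"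
proof (rule bij_betw_byWitness[where f' =
      "\<lambda>t. (inv_into (J \<rightarrow>\<^sub>E C) \<beta> (restrict t J))(m := inv_into C s (t m))"])
  have R: "restrict t J \<in> J \<rightarrow>\<^sub>E C" "t m \<in> C" if "t \<in> insert m J \<rightarrow>\<^sub>E C" for t
    using that by auto
  have U: "restrict (x(m := c)) J = x" if "x \<in> J \<rightarrow>\<^sub>E C" for x c
    using m PiE_arb[OF that] by (intro ext) (auto simp: restrict_def)
  have V: "x(m := c) \<in> insert m J \<rightarrow>\<^sub>E C" if "x \<in> J \<rightarrow>\<^sub>E C" "c \<in> C" for x c
    using that m by (simp add: insert_absorb PiE_fun_upd)
  have W: "(restrict t J)(m := t m) = t" if "t \<in> insert m J \<rightarrow>\<^sub>E C" for t
    using PiE_arb[OF that] by (intro ext) (auto simp: restrict_def)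
  have \<beta>1: "\<beta> x \<in> J \<rightarrow>\<^sub>E C" "inv_into (J \<rightarrow>\<^sub>E C) \<beta> x \<in> J \<rightarrow>\<^sub>E C"
    "inv_into (J \<rightarrow>\<^sub>E C) \<beta> (\<beta> x) = x" "\<beta> (inv_into (J \<rightarrow>\<^sub>E C) \<beta> x) = x" if "x \<in> J \<rightarrow>\<^sub>E C" for x
    using bij_betw_apply[OF \<beta> that] bij_betw_apply[OF bij_betw_inv_into[OF \<beta>] that]
      bij_betw_inv_into_left[OF \<beta> that] bij_betw_inv_into_right[OF \<beta> that] by blast+
  have s1: "s x \<in> C" "inv_into C s x \<in> C" "inv_into C s (s x) = x" "s (inv_into C s x) = x"
    if "x \<in> C" for x
    using bij_betw_apply[OF s that] bij_betw_apply[OF bij_betw_inv_into[OF s] that]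
      bij_betw_inv_into_left[OF s that] bij_betw_inv_into_right[OF s that] by blast+
  show "\<forall>t\<in>insert m J \<rightarrow>\<^sub>E C. (inv_into (J \<rightarrow>\<^sub>E C) \<beta> (restrict ((\<beta> (restrict t J))(m := s (t m))) J))
      (m := inv_into C s (((\<beta> (restrict t J))(m := s (t m))) m)) = t"
    using R \<beta>1 s1 by (simp add: U W)
  show "\<forall>t\<in>insert m J \<rightarrow>\<^sub>E C. (\<beta> (restrict ((inv_into (J \<rightarrow>\<^sub>E C) \<beta> (restrict t J))(m := inv_into C s (t m))) J))
      (m := s (((inv_into (J \<rightarrow>\<^sub>E C) \<beta> (restrict t J))(m := inv_into C s (t m))) m)) = t"
    using R \<beta>1 s1 by (simp add: U W)
  show "(\<lambda>t. (\<beta> (restrict t J))(m := s (t m))) ` (insert m J \<rightarrow>\<^sub>E C) \<subseteq> insert m J \<rightarrow>\<^sub>E C"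
    using R \<beta>1(1) s1(1) V by (intro image_subsetI) metis
  show "(\<lambda>t. (inv_into (J \<rightarrow>\<^sub>E C) \<beta> (restrict t J))(m := inv_into C s (t m))) ` (insert m J \<rightarrow>\<^sub>E C)
      \<subseteq> insert m J \<rightarrow>\<^sub>E C"
    using R \<beta>1(2) s1(2) V by (intro image_subsetI) metis
qed

text \<open>The inverse is the power map for an inverse of \<open>u\<close> modulo the group order.
  It is in general only a bijection of sets, not a homomorphism.\<close>

lemma (in group) bij_betw_pow_coprime:
  assumes fin: "finite (carrier G)" and u: "coprime u (card (carrier G))"
  shows "bij_betw (\<lambda>x. x [^] u) (carrier G) (carrier G)"
proof -
  obtain v where v: "[u * v = 1] (mod card (carrier G))"
    using cong_solve_coprime_nat[OF u] by auto
  have id: "x [^] (u * v) = x" if x: "x \<in> carrier G" for x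
  proof -
    have "ord x dvd card (carrier G)"
      using ord_dvd_group_order[OF x] by (simp add: Coset.order_def)
    then have "[u * v = 1] (mod ord x)" using v cong_dvd_modulus_nat by blast
    then have "int (ord x) dvd int 1 - int (u * v)"
      by (metis cong_iff_dvd_diff cong_int_iff cong_sym)
    then have "x [^] int (u * v) = x [^] int 1" using int_pow_eq[OF x] by blast
    then show ?thesis using x by (simp only: int_pow_int) simp
  qed
  show ?thesis
    by (rule bij_betw_byWitness[where f' = "\<lambda>x. x [^] v"])
      (auto simp: nat_pow_pow id mult.commute[of v])
qed

text \<open>An abstract commutator pairing. Its values are integers known modulo \<open>q\<close>
  only, being exponents of a generator of the center. Additivity in the second argument follows from
  \<open>b_skew\<close>; \<open>b_alt\<close> is a separate assumption because skew symmetry alone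
  gives \<open>2 * b x x = 0\<close>, which is weaker when \<open>q\<close> is even.\<close>

locale alternating_map = group G for G (structure) +
  fixes q :: int and b :: "'a \<Rightarrow> 'a \<Rightarrow> int"
  assumes b_mult: "\<lbrakk>x \<in> carrier G; y \<in> carrier G; z \<in> carrier G\<rbrakk> \<Longrightarrow>
      [b (x \<otimes> y) z = b x z + b y z] (mod q)"
    and b_skew: "\<lbrakk>x \<in> carrier G; y \<in> carrier G\<rbrakk> \<Longrightarrow> [b x y = - b y x] (mod q)"
    and b_alt: "x \<in> carrier G \<Longrightarrow> [b x x = 0] (mod q)"
begin

lemma b_mult2:
  assumes "x \<in> carrier G" "y \<in> carrier G" "z \<in> carrier G"
  shows "[b z (x \<otimes> y) = b z x + b z y] (mod q)"
proof -
  have "[b z (x \<otimes> y) = - b (x \<otimes> y) z] (mod q)" using assms by (intro b_skew) auto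
  also have "[- b (x \<otimes> y) z = - (b x z + b y z)] (mod q)"
    using assms by (simp only: cong_minus_minus_iff b_mult)
  also have "- (b x z + b y z) = - b x z + - b y z" by simp
  also have "[\<dots> = b z x + b z y] (mod q)"
    using assms by (intro cong_add cong_sym[OF b_skew])
  finally show ?thesis .
qed

lemma b_one: "z \<in> carrier G \<Longrightarrow> [b \<one> z = 0] (mod q)"
  using b_mult[of \<one> \<one> z] by (simp add: cong_iff_dvd_diff)

lemma b_pow:
  assumes "x \<in> carrier G" "z \<in> carrier G"
  shows "[b (x [^] n) z = int n * b x z] (mod q)"
proof (induction n)
  case (Suc n)
  have "[b (x [^] Suc n) z = b (x [^] n) z + b x z] (mod q)"
    using assms b_mult[of "x [^] n" x z] by simp
  also have "[b (x [^] n) z + b x z = int n * b x z + b x z] (mod q)"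
    by (intro cong_add Suc cong_refl)
  finally show ?case by (simp add: algebra_simps)
qed (use assms b_one in simp)

lemma b_pow2:
  assumes "x \<in> carrier G" "z \<in> carrier G"
  shows "[b z (x [^] n) = int n * b z x] (mod q)"
proof -
  have "[b z (x [^] n) = - b (x [^] n) z] (mod q)" using assms by (intro b_skew) auto
  also have "[- b (x [^] n) z = - (int n * b x z)] (mod q)"
    using assms by (simp only: cong_minus_minus_iff b_pow)
  also have "- (int n * b x z) = int n * (- b x z)" by simp
  also have "[\<dots> = int n * b z x] (mod q)"
    using assms by (intro cong_mult cong_refl cong_sym[OF b_skew])
  finally show ?thesis .
qed

lemma b_inv:
  assumes "x \<in> carrier G" "z \<in> carrier G"
  shows "[b (inv x) z = - b x z] (mod q)"
proof -
  have "[b x z + b (inv x) z = b \<one> z] (mod q)"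
    using b_mult[of x "inv x" z] assms by (simp add: cong_sym)
  from cong_trans[OF this b_one[OF assms(2)]] show ?thesis
    by (simp add: cong_iff_dvd_diff add.commute)
qed

lemma b_int_pow:
  assumes "x \<in> carrier G" "z \<in> carrier G"
  shows "[b (x [^] (n::int)) z = n * b x z] (mod q)"
proof (cases n rule: int_cases2)
  case (nonneg m)
  then show ?thesis using assms by (simp add: int_pow_int b_pow)
next
  case (nonpos m)
  have "[b (inv (x [^] m)) z = - b (x [^] m) z] (mod q)" using assms by (intro b_inv) auto
  also have "[- b (x [^] m) z = - (int m * b x z)] (mod q)"
    unfolding cong_minus_minus_iff using assms by (rule b_pow)
  finally show ?thesis using nonpos assms by (simp add: int_pow_neg_int)
qed

end

text \<open>The model for \<open>\<psi> x\<close> is the exponent of the q-th power of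
  \<open>x\<close>, and \<open>\<kappa> * b x y\<close> is the price of collecting the q-th power of
  a product in class two.\<close>

locale quadratic_map = alternating_map +
  fixes \<psi> :: "'a \<Rightarrow> int" and \<kappa> :: int
  assumes \<psi>_mult: "\<lbrakk>x \<in> carrier G; y \<in> carrier G\<rbrakk> \<Longrightarrow>
      [\<psi> (x \<otimes> y) = \<psi> x + \<psi> y + \<kappa> * b x y] (mod q)"
begin

lemma \<psi>_one: "[\<psi> \<one> = 0] (mod q)"
proof -
  have "[\<psi> (\<one> \<otimes> \<one>) = \<psi> \<one> + \<psi> \<one> + \<kappa> * b \<one> \<one>] (mod q)" by (intro \<psi>_mult) auto
  also have "[\<psi> \<one> + \<psi> \<one> + \<kappa> * b \<one> \<one> = \<psi> \<one> + \<psi> \<one> + \<kappa> * 0] (mod q)"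
    by (intro cong_add cong_mult cong_refl b_one one_closed)
  finally show ?thesis by (simp add: cong_iff_dvd_diff)
qed

text \<open>The error terms are multiples of \<open>b x x\<close>, so \<open>\<psi>\<close> is
  linear along powers of one element, whereas \<open>b\<close> picks up a factor from each of its
  arguments.\<close>

lemma \<psi>_pow:
  assumes "x \<in> carrier G"
  shows "[\<psi> (x [^] n) = int n * \<psi> x] (mod q)"
proof (induction n)
  case (Suc n)
  have "[\<psi> (x [^] Suc n) = \<psi> (x [^] n) + \<psi> x + \<kappa> * b (x [^] n) x] (mod q)"
    using assms \<psi>_mult[of "x [^] n" x] by simp
  also have "[\<psi> (x [^] n) + \<psi> x + \<kappa> * b (x [^] n) x = int n * \<psi> x + \<psi> x + \<kappa> * (int n * b x x)] (mod q)"
    using assms by (intro cong_add cong_mult Suc cong_refl b_pow)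
  also have "[int n * \<psi> x + \<psi> x + \<kappa> * (int n * b x x) = int n * \<psi> x + \<psi> x + \<kappa> * (int n * 0)] (mod q)"
    using assms by (intro cong_add cong_mult b_alt cong_refl)
  finally show ?case by (simp add: algebra_simps)
qed (simp add: \<psi>_one)

abbreviation tuples :: "'i set \<Rightarrow> ('i \<Rightarrow> 'a) set" where
  "tuples I \<equiv> I \<rightarrow>\<^sub>E carrier G"

text \<open>The matrix \<open>a\<close> in \<open>quad\<close> is arbitrary: as \<open>b\<close> is alternating, only the differences
  \<open>a i j - a j i\<close> matter.\<close>

definition lin :: "'i set \<Rightarrow> ('i \<Rightarrow> int) \<Rightarrow> 'a \<Rightarrow> ('i \<Rightarrow> 'a) \<Rightarrow> int" where
  "lin I v h t = (\<Sum>j\<in>I. v j * b h (t j))"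

definition quad :: "'i set \<Rightarrow> ('i \<Rightarrow> 'i \<Rightarrow> int) \<Rightarrow> ('i \<Rightarrow> 'a) \<Rightarrow> int" where
  "quad I a t = (\<Sum>i\<in>I. \<Sum>j\<in>I. a i j * b (t i) (t j))"

text \<open>The exponent of the value of a word whose exponent sums are \<open>q * n j\<close>; the
  matrix \<open>a\<close> collects the commutators produced by sorting the letters.\<close>

definition wordform :: "'i set \<Rightarrow> ('i \<Rightarrow> int) \<Rightarrow> ('i \<Rightarrow> 'i \<Rightarrow> int) \<Rightarrow> ('i \<Rightarrow> 'a) \<Rightarrow> int" where
  "wordform I n a t = (\<Sum>j\<in>I. n j * \<psi> (t j)) + quad I a t"

section \<open>Calculus of the linear and quadratic forms in tuples\<close>

lemma lin_local: "(\<And>j. j \<in> I \<Longrightarrow> t j = t' j) \<Longrightarrow> lin I v h t = lin I v h t'"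
  unfolding lin_def by (intro sum.cong) auto

lemma quad_local: "(\<And>j. j \<in> I \<Longrightarrow> t j = t' j) \<Longrightarrow> quad I a t = quad I a t'"
  unfolding quad_def by (intro sum.cong) auto

lemma lin_mult:
  assumes "\<And>j. j \<in> I \<Longrightarrow> t j \<in> carrier G" "h \<in> carrier G" "h' \<in> carrier G"
  shows "[lin I v (h \<otimes> h') t = lin I v h t + lin I v h' t] (mod q)"
proof -
  have "[lin I v (h \<otimes> h') t = (\<Sum>j\<in>I. v j * (b h (t j) + b h' (t j)))] (mod q)"
    unfolding lin_def using assms by (intro cong_sum cong_mult cong_refl b_mult) auto
  then show ?thesis by (simp add: lin_def algebra_simps sum.distrib)
qed

lemma lin_pow:
  assumes "\<And>j. j \<in> I \<Longrightarrow> t j \<in> carrier G" "h \<in> carrier G"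
  shows "[lin I v (h [^] n) t = int n * lin I v h t] (mod q)"
proof -
  have "[lin I v (h [^] n) t = (\<Sum>j\<in>I. v j * (int n * b h (t j)))] (mod q)"
    unfolding lin_def using assms by (intro cong_sum cong_mult cong_refl b_pow) auto
  then show ?thesis by (simp add: lin_def algebra_simps sum_distrib_left)
qed

lemma quad_add: "quad I a t + quad I a' t = quad I (\<lambda>i j. a i j + a' i j) t"
  by (simp add: quad_def algebra_simps sum.distrib)

lemma quad_scale: "c * quad I a t = quad I (\<lambda>i j. c * a i j) t"
  by (simp add: quad_def algebra_simps sum_distrib_left)

lemma lin_add: "lin I v h t + lin I v' h t = lin I (\<lambda>i. v i + v' i) h t"
  by (simp add: lin_def algebra_simps sum.distrib)

lemma lin_scale: "c * lin I v h t = lin I (\<lambda>i. c * v i) h t"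
  by (simp add: lin_def algebra_simps sum_distrib_left)

text \<open>The diagonal term vanishes, and skew symmetry merges column \<open>m\<close> into row
  \<open>m\<close>. What couples \<open>t m\<close> to the other variables is thus a
  \<open>lin\<close> form whose parameter \<open>h\<close> is \<open>t m\<close> itself.\<close>

lemma quad_insert:
  assumes "finite J" "m \<notin> J" "\<And>j. j \<in> insert m J \<Longrightarrow> t j \<in> carrier G"
  shows "[quad (insert m J) a t = lin J (\<lambda>j. a m j - a j m) (t m) t + quad J a t] (mod q)"
proof -
  have eq: "quad (insert m J) a t = a m m * b (t m) (t m) + (\<Sum>j\<in>J. a m j * b (t m) (t j)) +
      ((\<Sum>j\<in>J. a j m * b (t j) (t m)) + quad J a t)"
    using assms(1,2) by (simp add: quad_def sum.distrib)
  have "[\<dots> = a m m * 0 + (\<Sum>j\<in>J. a m j * b (t m) (t j)) +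
      ((\<Sum>j\<in>J. a j m * (- b (t m) (t j))) + quad J a t)] (mod q)"
    using assms(3) by (intro cong_add cong_mult cong_sum cong_refl b_alt b_skew) auto
  also have "a m m * 0 + (\<Sum>j\<in>J. a m j * b (t m) (t j)) +
      ((\<Sum>j\<in>J. a j m * (- b (t m) (t j))) + quad J a t) =
      lin J (\<lambda>j. a m j - a j m) (t m) t + quad J a t"
    by (simp add: lin_def algebra_simps sum_subtractf sum_negf)
  finally show ?thesis unfolding eq .
qed

text \<open>The witness is a product of the powers \<open>t j [^] \<rho> j\<close> in the order in
  which the set induction adds the indices. The failure of \<open>\<psi>\<close> to be additive on
  it is a quadratic form whose matrix \<open>d\<close> is the same for all \<open>t\<close>;
  invariance under \<open>restrict\<close> says that only coordinates in \<open>J\<close>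
  enter.\<close>

lemma product_exists:
  fixes \<rho> :: "'i \<Rightarrow> nat"
  assumes "finite J"
  shows "\<exists>Y d. \<forall>t. (\<forall>j\<in>J. t j \<in> carrier G) \<longrightarrow> Y t \<in> carrier G \<and> Y (restrict t J) = Y t \<and>
    (\<forall>h\<in>carrier G. [b h (Y t) = lin J (int \<circ> \<rho>) h t] (mod q)) \<and>
    [\<psi> (Y t) = (\<Sum>j\<in>J. int (\<rho> j) * \<psi> (t j)) + quad J d t] (mod q)"
  using assms
proof (induction J rule: finite_induct)
  case empty
  have "[b h \<one> = 0] (mod q)" if "h \<in> carrier G" for h
    using b_pow2[of \<one> h 0] that by simp
  then show ?case
    by (intro exI[of _ "\<lambda>_. \<one>"]) (auto simp: lin_def quad_def \<psi>_one)
next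
  case (insert m J)
  then obtain Y d where "\<forall>t. (\<forall>j\<in>J. t j \<in> carrier G) \<longrightarrow> Y t \<in> carrier G \<and> Y (restrict t J) = Y t \<and>
    (\<forall>h\<in>carrier G. [b h (Y t) = lin J (int \<circ> \<rho>) h t] (mod q)) \<and>
    [\<psi> (Y t) = (\<Sum>j\<in>J. int (\<rho> j) * \<psi> (t j)) + quad J d t] (mod q)"
    by (elim exE) (rule that)
  note Yd = this[rule_format]
  define Y' where "Y' t = Y t \<otimes> t m [^] \<rho> m" for t
  \<comment> \<open>Row \<open>m\<close> is the defect
    \<open>\<kappa> * b (Y t) (t m [^] \<rho> m)\<close>, with a sign from exchanging the arguments.
    Column \<open>m\<close> may be zero, as \<open>quad_insert\<close> sees only the difference of
    row and column.\<close>
  define d' where "d' i j = (if i = m then - (\<kappa> * int (\<rho> m) * int (\<rho> j)) else if j = m then 0 else d i j)" for i j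
  show ?case
  proof (intro exI[of _ Y'] exI[of _ d'] allI impI)
    fix t assume "\<forall>j\<in>insert m J. t j \<in> carrier G"
    then have t [simp]: "t m \<in> carrier G" "\<And>j. j \<in> J \<Longrightarrow> t j \<in> carrier G" by auto
    have Y [simp]: "Y t \<in> carrier G" and Y_r: "Y (restrict t J) = Y t"
      and Y_b: "\<And>h. h \<in> carrier G \<Longrightarrow> [b h (Y t) = lin J (int \<circ> \<rho>) h t] (mod q)"
      and Y_\<psi>: "[\<psi> (Y t) = (\<Sum>j\<in>J. int (\<rho> j) * \<psi> (t j)) + quad J d t] (mod q)"
      using Yd[of t] by auto
    have "Y (restrict (restrict t (insert m J)) J) = Y (restrict t (insert m J))"
      using Yd[of "restrict t (insert m J)"] by simp
    also have "restrict (restrict t (insert m J)) J = restrict t J" by (auto simp: restrict_def fun_eq_iff)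
    finally have "Y (restrict t (insert m J)) = Y t" using Y_r by metis
    then have r: "Y' (restrict t (insert m J)) = Y' t" by (simp add: Y'_def)
    have bY': "[b h (Y' t) = lin (insert m J) (int \<circ> \<rho>) h t] (mod q)" if h [simp]: "h \<in> carrier G" for h
    proof -
      have "[b h (Y' t) = b h (Y t) + b h (t m [^] \<rho> m)] (mod q)"
        unfolding Y'_def by (intro b_mult2) auto
      also have "[b h (Y t) + b h (t m [^] \<rho> m) = lin J (int \<circ> \<rho>) h t + int (\<rho> m) * b h (t m)] (mod q)"
        by (intro cong_add Y_b b_pow2) auto
      finally show ?thesis using insert.hyps by (simp add: lin_def algebra_simps)
    qed
    have b1: "[b (Y t) (t m [^] \<rho> m) = - (int (\<rho> m) * lin J (int \<circ> \<rho>) (t m) t)] (mod q)"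
    proof -
      have "[b (Y t) (t m [^] \<rho> m) = int (\<rho> m) * b (Y t) (t m)] (mod q)" by (intro b_pow2) auto
      also have "[int (\<rho> m) * b (Y t) (t m) = int (\<rho> m) * (- b (t m) (Y t))] (mod q)"
        by (intro cong_mult cong_refl b_skew) auto
      also have "int (\<rho> m) * (- b (t m) (Y t)) = - (int (\<rho> m) * b (t m) (Y t))" by simp
      also have "[\<dots> = - (int (\<rho> m) * lin J (int \<circ> \<rho>) (t m) t)] (mod q)"
        unfolding cong_minus_minus_iff by (intro cong_mult cong_refl Y_b) auto
      finally show ?thesis .
    qed
    have "[\<psi> (Y' t) = \<psi> (Y t) + \<psi> (t m [^] \<rho> m) + \<kappa> * b (Y t) (t m [^] \<rho> m)] (mod q)"
      unfolding Y'_def by (intro \<psi>_mult) auto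
    also have "[\<psi> (Y t) + \<psi> (t m [^] \<rho> m) + \<kappa> * b (Y t) (t m [^] \<rho> m) =
        ((\<Sum>j\<in>J. int (\<rho> j) * \<psi> (t j)) + quad J d t) + int (\<rho> m) * \<psi> (t m) +
        \<kappa> * (- (int (\<rho> m) * lin J (int \<circ> \<rho>) (t m) t))] (mod q)"
      by (intro cong_add cong_mult cong_refl Y_\<psi> \<psi>_pow b1) auto
    also have "((\<Sum>j\<in>J. int (\<rho> j) * \<psi> (t j)) + quad J d t) + int (\<rho> m) * \<psi> (t m) +
        \<kappa> * (- (int (\<rho> m) * lin J (int \<circ> \<rho>) (t m) t)) =
        (\<Sum>j\<in>insert m J. int (\<rho> j) * \<psi> (t j)) +
        (lin J (\<lambda>j. - (\<kappa> * int (\<rho> m) * int (\<rho> j))) (t m) t + quad J d t)"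
    proof -
      have "\<kappa> * (- (int (\<rho> m) * lin J (int \<circ> \<rho>) (t m) t)) = lin J (\<lambda>j. - (\<kappa> * int (\<rho> m) * int (\<rho> j))) (t m) t"
        by (simp add: lin_def sum_distrib_left sum_negf mult.assoc)
      then show ?thesis using insert.hyps by simp
    qed
    finally have 1: "[\<psi> (Y' t) = (\<Sum>j\<in>insert m J. int (\<rho> j) * \<psi> (t j)) +
        (lin J (\<lambda>j. - (\<kappa> * int (\<rho> m) * int (\<rho> j))) (t m) t + quad J d t)] (mod q)" .
    have "quad J d' t = quad J d t"
      using insert.hyps unfolding quad_def d'_def by (intro sum.cong) auto
    moreover have "lin J (\<lambda>j. d' m j - d' j m) (t m) t = lin J (\<lambda>j. - (\<kappa> * int (\<rho> m) * int (\<rho> j))) (t m) t"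
      using insert.hyps unfolding lin_def d'_def by (intro sum.cong) auto
    moreover have "[quad (insert m J) d' t = lin J (\<lambda>j. d' m j - d' j m) (t m) t + quad J d' t] (mod q)"
      using insert.hyps by (intro quad_insert) auto
    ultimately have "[(\<Sum>j\<in>insert m J. int (\<rho> j) * \<psi> (t j)) +
        (lin J (\<lambda>j. - (\<kappa> * int (\<rho> m) * int (\<rho> j))) (t m) t + quad J d t) =
        (\<Sum>j\<in>insert m J. int (\<rho> j) * \<psi> (t j)) + quad (insert m J) d' t] (mod q)"
      by (intro cong_add cong_refl) (simp add: cong_sym)
    with 1 have "[\<psi> (Y' t) = (\<Sum>j\<in>insert m J. int (\<rho> j) * \<psi> (t j)) + quad (insert m J) d' t] (mod q)"
      by (rule cong_trans)
    moreover have "Y' t \<in> carrier G" unfolding Y'_def by simp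
    ultimately show "Y' t \<in> carrier G \<and> Y' (restrict t (insert m J)) = Y' t \<and>
      (\<forall>h\<in>carrier G. [b h (Y' t) = lin (insert m J) (int \<circ> \<rho>) h t] (mod q)) \<and>
      [\<psi> (Y' t) = (\<Sum>j\<in>insert m J. int (\<rho> j) * \<psi> (t j)) + quad (insert m J) d' t] (mod q)"
      using r bY' by blast
  qed
qed

text \<open>\<open>E\<close> multiplies the variable \<open>t m\<close> by a product of the \<open>t j [^] \<rho> j\<close> in some order;
  \<open>d\<close> accounts for the reordering.\<close>

definition pivot_map :: "'i set \<Rightarrow> 'i \<Rightarrow> ('i \<Rightarrow> nat) \<Rightarrow> ('i \<Rightarrow> 'i \<Rightarrow> int) \<Rightarrow> (('i \<Rightarrow> 'a) \<Rightarrow> 'i \<Rightarrow> 'a) \<Rightarrow> bool" where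
  "pivot_map J m \<rho> d E \<longleftrightarrow> bij_betw E (tuples (insert m J)) (tuples (insert m J)) \<and>
    (\<forall>t\<in>tuples (insert m J). (\<forall>j\<in>J. E t j = t j) \<and>
      (\<forall>h\<in>carrier G. [b h (E t m) = b h (t m) + lin J (int \<circ> \<rho>) h t] (mod q)) \<and>
      [\<psi> (E t m) = \<psi> (t m) + (\<Sum>j\<in>J. int (\<rho> j) * \<psi> (t j)) +
        \<kappa> * lin J (int \<circ> \<rho>) (t m) t + quad J d t] (mod q))"

lemma pivot_mapD:
  assumes "pivot_map J m \<rho> d E"
  shows "bij_betw E (tuples (insert m J)) (tuples (insert m J))"
    and "t \<in> tuples (insert m J) \<Longrightarrow> j \<in> J \<Longrightarrow> E t j = t j"
    and "t \<in> tuples (insert m J) \<Longrightarrow> h \<in> carrier G \<Longrightarrow>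
      [b h (E t m) = b h (t m) + lin J (int \<circ> \<rho>) h t] (mod q)"
    and "t \<in> tuples (insert m J) \<Longrightarrow> [\<psi> (E t m) = \<psi> (t m) + (\<Sum>j\<in>J. int (\<rho> j) * \<psi> (t j)) +
      \<kappa> * lin J (int \<circ> \<rho>) (t m) t + quad J d t] (mod q)"
proof -
  note * = assms[unfolded pivot_map_def]
  show "bij_betw E (tuples (insert m J)) (tuples (insert m J))" by (rule conjunct1[OF *])
  assume t: "t \<in> tuples (insert m J)"
  note ** = bspec[OF conjunct2[OF *] t]
  show "j \<in> J \<Longrightarrow> E t j = t j" by (rule bspec[OF conjunct1[OF **]])
  show "h \<in> carrier G \<Longrightarrow> [b h (E t m) = b h (t m) + lin J (int \<circ> \<rho>) h t] (mod q)"
    by (rule bspec[OF conjunct1[OF conjunct2[OF **]]])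
  show "[\<psi> (E t m) = \<psi> (t m) + (\<Sum>j\<in>J. int (\<rho> j) * \<psi> (t j)) +
      \<kappa> * lin J (int \<circ> \<rho>) (t m) t + quad J d t] (mod q)"
    by (rule conjunct2[OF conjunct2[OF **]])
qed

text \<open>The factor \<open>Y t\<close> multiplied to \<open>t m\<close> does not involve
  \<open>t m\<close>, so multiplication by \<open>inv (Y t)\<close> undoes the substitution.\<close>

lemma pivot_map_exists:
  assumes J: "finite J" "m \<notin> J"
  shows "\<exists>d E. pivot_map J m \<rho> d E"
proof -
  obtain Y d where Yd: "\<forall>t. (\<forall>j\<in>J. t j \<in> carrier G) \<longrightarrow> Y t \<in> carrier G \<and> Y (restrict t J) = Y t \<and>
    (\<forall>h\<in>carrier G. [b h (Y t) = lin J (int \<circ> \<rho>) h t] (mod q)) \<and>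
    [\<psi> (Y t) = (\<Sum>j\<in>J. int (\<rho> j) * \<psi> (t j)) + quad J d t] (mod q)"
    using product_exists[OF J(1), of \<rho>] by (elim exE) (rule that)
  have Y_local: "Y (t(m := x)) = Y t" if "\<forall>j\<in>J. t j \<in> carrier G" for t x
  proof -
    have "restrict (t(m := x)) J = restrict t J" using J(2) by (auto simp: restrict_def fun_eq_iff)
    moreover have "\<forall>j\<in>J. (t(m := x)) j \<in> carrier G" using that J(2) by auto
    ultimately show ?thesis using Yd that by metis
  qed
  define E where "E t = t(m := t m \<otimes> Y t)" for t
  define E' where "E' t = t(m := t m \<otimes> inv (Y t))" for t
  have tJ: "\<forall>j\<in>J. t j \<in> carrier G" "t m \<in> carrier G" if "t \<in> tuples (insert m J)" for t
    using that by auto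
  have Yc: "Y t \<in> carrier G" if "t \<in> tuples (insert m J)" for t
    using Yd tJ(1)[OF that] by blast
  have upd: "t(m := x) \<in> tuples (insert m J)" if "t \<in> tuples (insert m J)" "x \<in> carrier G" for t x
    using that by (simp add: PiE_iff extensional_def)
  have "bij_betw E (tuples (insert m J)) (tuples (insert m J))"
  proof (rule bij_betw_byWitness[where f' = E'])
    show "\<forall>t\<in>tuples (insert m J). E' (E t) = t"
      using Yc tJ by (auto simp: E_def E'_def Y_local m_assoc simp del: PiE_iff)
    show "\<forall>t\<in>tuples (insert m J). E (E' t) = t"
      using Yc tJ by (auto simp: E_def E'_def Y_local m_assoc simp del: PiE_iff)
    show "E ` tuples (insert m J) \<subseteq> tuples (insert m J)"
      unfolding E_def using Yc tJ(2) upd by (intro image_subsetI) simp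
    show "E' ` tuples (insert m J) \<subseteq> tuples (insert m J)"
      unfolding E'_def using Yc tJ(2) upd by (intro image_subsetI) simp
  qed
  moreover have "(\<forall>j\<in>J. E t j = t j) \<and>
      (\<forall>h\<in>carrier G. [b h (E t m) = b h (t m) + lin J (int \<circ> \<rho>) h t] (mod q)) \<and>
      [\<psi> (E t m) = \<psi> (t m) + (\<Sum>j\<in>J. int (\<rho> j) * \<psi> (t j)) +
        \<kappa> * lin J (int \<circ> \<rho>) (t m) t + quad J d t] (mod q)"
    if t: "t \<in> tuples (insert m J)" for t
  proof (intro conjI ballI)
    have Y [simp]: "Y t \<in> carrier G" and tm [simp]: "t m \<in> carrier G"
      and Y_b: "\<And>h. h \<in> carrier G \<Longrightarrow> [b h (Y t) = lin J (int \<circ> \<rho>) h t] (mod q)"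
      and Y_\<psi>: "[\<psi> (Y t) = (\<Sum>j\<in>J. int (\<rho> j) * \<psi> (t j)) + quad J d t] (mod q)"
      using Yd tJ[OF t] by blast+
    show "E t j = t j" if "j \<in> J" for j using that J(2) by (auto simp: E_def)
    show "[b h (E t m) = b h (t m) + lin J (int \<circ> \<rho>) h t] (mod q)" if "h \<in> carrier G" for h
    proof -
      have "[b h (E t m) = b h (t m) + b h (Y t)] (mod q)"
        unfolding E_def using that by (simp add: b_mult2)
      also have "[b h (t m) + b h (Y t) = b h (t m) + lin J (int \<circ> \<rho>) h t] (mod q)"
        using that by (intro cong_add cong_refl Y_b)
      finally show ?thesis .
    qed
    have "[\<psi> (E t m) = \<psi> (t m) + \<psi> (Y t) + \<kappa> * b (t m) (Y t)] (mod q)"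
      unfolding E_def by (simp add: \<psi>_mult)
    also have "[\<psi> (t m) + \<psi> (Y t) + \<kappa> * b (t m) (Y t) =
        \<psi> (t m) + ((\<Sum>j\<in>J. int (\<rho> j) * \<psi> (t j)) + quad J d t) + \<kappa> * lin J (int \<circ> \<rho>) (t m) t] (mod q)"
      by (intro cong_add cong_mult cong_refl Y_b Y_\<psi> tm)
    finally show "[\<psi> (E t m) = \<psi> (t m) + (\<Sum>j\<in>J. int (\<rho> j) * \<psi> (t j)) +
        \<kappa> * lin J (int \<circ> \<rho>) (t m) t + quad J d t] (mod q)"
      by (simp add: algebra_simps)
  qed
  ultimately show ?thesis unfolding pivot_map_def by blast
qed

text \<open>Multiplying \<open>t m\<close> by a product of the others leaves its coupling to them
  unchanged; the additional commutators involve only variables in \<open>J\<close> and are absorbed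
  into the matrix on \<open>J\<close>.\<close>

lemma quad_pivot:
  assumes J: "finite J" "m \<notin> J" and E: "pivot_map J m \<rho> d E" and t: "t \<in> tuples (insert m J)"
  shows "[quad (insert m J) a (E t) = lin J (\<lambda>j. a m j - a j m) (t m) t +
    quad J (\<lambda>i j. a i j - (a m i - a i m) * int (\<rho> j)) t] (mod q)"
proof -
  have Et: "E t \<in> tuples (insert m J)" by (rule bij_betw_apply[OF pivot_mapD(1)[OF E] t])
  note EJ = pivot_mapD(2)[OF E t] and Eb = pivot_mapD(3)[OF E t]
  have tc: "\<And>j. j \<in> insert m J \<Longrightarrow> t j \<in> carrier G" "\<And>j. j \<in> insert m J \<Longrightarrow> E t j \<in> carrier G"
    using t Et by (auto dest: PiE_mem)
  define c where "c j = a m j - a j m" for j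
  have bEt: "[b (E t m) (t j) = b (t m) (t j) - lin J (int \<circ> \<rho>) (t j) t] (mod q)" if j: "j \<in> J" for j
  proof -
    have "[b (E t m) (t j) = - b (t j) (E t m)] (mod q)"
      using tc j by (intro b_skew) auto
    also have "[- b (t j) (E t m) = - (b (t j) (t m) + lin J (int \<circ> \<rho>) (t j) t)] (mod q)"
      unfolding cong_minus_minus_iff using tc j by (intro Eb) auto
    also have "- (b (t j) (t m) + lin J (int \<circ> \<rho>) (t j) t) = - b (t j) (t m) - lin J (int \<circ> \<rho>) (t j) t"
      by simp
    also have "[\<dots> = b (t m) (t j) - lin J (int \<circ> \<rho>) (t j) t] (mod q)"
      using tc j by (intro cong_diff cong_refl cong_sym[OF b_skew]) auto
    finally show ?thesis .
  qed
  have "[quad (insert m J) a (E t) = lin J c (E t m) (E t) + quad J a (E t)] (mod q)"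
    unfolding c_def using J tc(2) by (intro quad_insert)
  also have "lin J c (E t m) (E t) = lin J c (E t m) t" using EJ by (intro lin_local)
  also have "quad J a (E t) = quad J a t" using EJ by (intro quad_local)
  also have "[lin J c (E t m) t + quad J a t =
      (\<Sum>j\<in>J. c j * (b (t m) (t j) - lin J (int \<circ> \<rho>) (t j) t)) + quad J a t] (mod q)"
    unfolding lin_def[of J c] by (intro cong_add cong_sum cong_mult cong_refl bEt)
  also have "(\<Sum>j\<in>J. c j * (b (t m) (t j) - lin J (int \<circ> \<rho>) (t j) t)) =
      lin J c (t m) t + quad J (\<lambda>i j. - (c i * int (\<rho> j))) t"
    by (simp add: lin_def quad_def right_diff_distrib sum_subtractf sum_distrib_left sum_negf mult.assoc)
  also have "lin J c (t m) t + quad J (\<lambda>i j. - (c i * int (\<rho> j))) t + quad J a t =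
      lin J c (t m) t + quad J (\<lambda>i j. a i j - c i * int (\<rho> j)) t"
    by (simp add: quad_add add.assoc add.commute[of "- _"])
  finally show ?thesis unfolding c_def .
qed

text \<open>After a pivot, \<open>lin\<close> depends on the variable \<open>t m\<close> alone, and \<open>quad\<close> is a form
  \<open>lin J c (t m) t\<close> plus a form in the remaining variables. Raising \<open>t m\<close> to the power \<open>\<epsilon>\<close>
  and applying the induction hypothesis with \<open>\<epsilon>\<close> and \<open>\<epsilon>'\<close> exchanged scales both summands by
  \<open>u = \<epsilon> * \<epsilon>'\<close>.\<close>

lemma scaling_exists:
  fixes I :: "'i set" and p r :: nat
  assumes q: "q = int (p ^ r)" and p: "prime p"
    and fin: "finite (carrier G)" and u: "coprime u (card (carrier G))"
    and I: "finite I" and \<epsilon>: "(\<epsilon> = 1 \<and> \<epsilon>' = u) \<or> (\<epsilon> = u \<and> \<epsilon>' = 1)"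
  shows "\<exists>\<beta>. bij_betw \<beta> (tuples I) (tuples I) \<and> (\<forall>t\<in>tuples I.
    (\<forall>h\<in>carrier G. [lin I v h (\<beta> t) = int \<epsilon> * lin I v h t] (mod q)) \<and>
    [quad I a (\<beta> t) = int u * quad I a t] (mod q))"
  using I \<epsilon>
proof (induction "card I" arbitrary: I v a \<epsilon> \<epsilon>')
  case 0
  then show ?case by (intro exI[of _ id]) (auto simp: lin_def quad_def)
next
  case (Suc k)
  note \<epsilon> = Suc.prems(2)
  have "I \<noteq> {}" using Suc.hyps(2) by auto
  \<comment> \<open>After the substitution, \<open>v j + v m * int (\<rho> j)\<close> is the
    coefficient of \<open>t j\<close> in \<open>lin\<close>, so this choice removes every variable
    but \<open>t m\<close>.\<close>
  then obtain m \<rho> where m: "m \<in> I" and \<rho>: "\<And>j. j \<in> I \<Longrightarrow> [v j + v m * int (\<rho> j) = 0] (mod q)"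
    using pivot_exists[OF p Suc.prems(1), of v r] unfolding q by metis
  define J where "J = I - {m}"
  have J: "finite J" "m \<notin> J" and IJ: "I = insert m J" and cJ: "k = card J"
    using Suc m by (auto simp: J_def)
  obtain d E where E: "pivot_map J m \<rho> d E" using pivot_map_exists[OF J] by metis
  note Ebij = pivot_mapD(1)[OF E, folded IJ]
    and EJ = pivot_mapD(2)[OF E, folded IJ]
    and Eb = pivot_mapD(3)[OF E, folded IJ]
  define c where "c j = a m j - a j m" for j
  define a' where "a' i j = a i j - (a m i - a i m) * int (\<rho> j)" for i j
  have lin_E: "[lin I v h (E t) = v m * b h (t m)] (mod q)" if "t \<in> tuples I" "h \<in> carrier G" for t h
  proof -
    have "lin I v h (E t) = v m * b h (E t m) + (\<Sum>j\<in>J. v j * b h (t j))"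
      using J EJ[OF that(1)] unfolding IJ lin_def by simp
    also have "[\<dots> = v m * (b h (t m) + lin J (int \<circ> \<rho>) h t) + (\<Sum>j\<in>J. v j * b h (t j))] (mod q)"
      by (intro cong_add cong_mult cong_refl Eb that)
    also have "v m * (b h (t m) + lin J (int \<circ> \<rho>) h t) + (\<Sum>j\<in>J. v j * b h (t j)) =
        v m * b h (t m) + (\<Sum>j\<in>J. (v j + v m * int (\<rho> j)) * b h (t j))"
      by (simp add: lin_def distrib_left distrib_right sum.distrib sum_distrib_left mult.assoc)
    also have "[\<dots> = v m * b h (t m) + (\<Sum>j\<in>J. 0 * b h (t j))] (mod q)"
      using \<rho> IJ by (intro cong_add cong_sum cong_mult cong_refl) auto
    finally show ?thesis by simp
  qed
  have quad_E: "[quad I a (E t) = lin J c (t m) t + quad J a' t] (mod q)" if "t \<in> tuples I" for t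
    using quad_pivot[OF J E, of t a] that unfolding IJ c_def a'_def .
  have "(\<epsilon>' = 1 \<and> \<epsilon> = u) \<or> (\<epsilon>' = u \<and> \<epsilon> = 1)" using \<epsilon> by auto
  \<comment> \<open>One \<open>\<beta>\<close> has to serve all \<open>h\<close> at once, because it
    is applied with \<open>h = s m\<close>, which varies with the tuple.\<close>
  from Suc.hyps(1)[OF cJ J(1) this, of c a'] obtain \<beta> where \<beta>: "bij_betw \<beta> (tuples J) (tuples J)"
    and \<beta>_lin: "\<And>t h. t \<in> tuples J \<Longrightarrow> h \<in> carrier G \<Longrightarrow> [lin J c h (\<beta> t) = int \<epsilon>' * lin J c h t] (mod q)"
    and \<beta>_quad: "\<And>t. t \<in> tuples J \<Longrightarrow> [quad J a' (\<beta> t) = int u * quad J a' t] (mod q)"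
    by blast
  define \<gamma> where "\<gamma> t = (\<beta> (restrict t J))(m := t m [^] \<epsilon>)" for t
  have "coprime \<epsilon> (card (carrier G))" using \<epsilon> u by auto
  then have \<gamma>: "bij_betw \<gamma> (tuples I) (tuples I)"
    unfolding \<gamma>_def IJ by (intro bij_betw_PiE_insert J \<beta> bij_betw_pow_coprime fin)
  define E' where "E' = inv_into (tuples I) E"
  have E': "bij_betw E' (tuples I) (tuples I)" unfolding E'_def by (rule bij_betw_inv_into[OF Ebij])
  show ?case
  \<comment> \<open>\<open>\<gamma>\<close> scales the forms in pivoted coordinates; conjugation by
    \<open>E\<close> returns to the original ones.\<close>
  proof (intro exI[of _ "E \<circ> \<gamma> \<circ> E'"] conjI ballI)
    show "bij_betw (E \<circ> \<gamma> \<circ> E') (tuples I) (tuples I)"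
      using E' \<gamma> Ebij by (blast intro: bij_betw_trans)
    fix t assume "t \<in> tuples I"
    then obtain s where s: "s \<in> tuples I" and ts: "t = E s" and E's: "E' t = s"
      unfolding E'_def using bij_betw_inv_into_right[OF Ebij] bij_betw_apply[OF E'] E'_def by metis
    have sm: "s m \<in> carrier G" and sJ: "restrict s J \<in> tuples J" "\<And>j. j \<in> J \<Longrightarrow> s j \<in> carrier G"
      using s unfolding IJ by auto
    have \<gamma>s: "\<gamma> s \<in> tuples I" by (rule bij_betw_apply[OF \<gamma> s])
    have \<gamma>m: "\<gamma> s m = s m [^] \<epsilon>" by (simp add: \<gamma>_def)
    have \<gamma>J: "\<gamma> s j = \<beta> (restrict s J) j" if "j \<in> J" for j using that J(2) by (auto simp: \<gamma>_def)
    show "[lin I v h ((E \<circ> \<gamma> \<circ> E') t) = int \<epsilon> * lin I v h t] (mod q)" if h: "h \<in> carrier G" for h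
    proof -
      have "[lin I v h (E (\<gamma> s)) = v m * b h (s m [^] \<epsilon>)] (mod q)"
        using lin_E[OF \<gamma>s h] by (simp add: \<gamma>m)
      also have "[v m * b h (s m [^] \<epsilon>) = v m * (int \<epsilon> * b h (s m))] (mod q)"
        using sm h by (intro cong_mult cong_refl b_pow2)
      also have "v m * (int \<epsilon> * b h (s m)) = int \<epsilon> * (v m * b h (s m))" by simp
      also have "[\<dots> = int \<epsilon> * lin I v h (E s)] (mod q)"
        using s h by (intro cong_mult cong_refl cong_sym[OF lin_E])
      finally show ?thesis by (simp add: E's ts[symmetric])
    qed
    have \<beta>s: "\<beta> (restrict s J) \<in> tuples J" by (rule bij_betw_apply[OF \<beta> sJ(1)])
    have "[quad I a (E (\<gamma> s)) = lin J c (s m [^] \<epsilon>) (\<gamma> s) + quad J a' (\<gamma> s)] (mod q)"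
      using quad_E[OF \<gamma>s] by (simp add: \<gamma>m)
    also have "lin J c (s m [^] \<epsilon>) (\<gamma> s) = lin J c (s m [^] \<epsilon>) (\<beta> (restrict s J))"
      using \<gamma>J by (rule lin_local)
    also have "quad J a' (\<gamma> s) = quad J a' (\<beta> (restrict s J))"
      using \<gamma>J by (rule quad_local)
    also have "[lin J c (s m [^] \<epsilon>) (\<beta> (restrict s J)) + quad J a' (\<beta> (restrict s J)) =
        int \<epsilon> * lin J c (s m) (\<beta> (restrict s J)) + int u * quad J a' (restrict s J)] (mod q)"
      using \<beta>s by (intro cong_add lin_pow \<beta>_quad sJ(1) sm) auto
    also have "[int \<epsilon> * lin J c (s m) (\<beta> (restrict s J)) + int u * quad J a' (restrict s J) =
        int \<epsilon> * (int \<epsilon>' * lin J c (s m) (restrict s J)) + int u * quad J a' (restrict s J)] (mod q)"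
      by (intro cong_add cong_mult cong_refl \<beta>_lin sJ(1) sm)
    also have "lin J c (s m) (restrict s J) = lin J c (s m) s" by (rule lin_local) simp
    also have "quad J a' (restrict s J) = quad J a' s" by (rule quad_local) simp
    also have "int \<epsilon> * (int \<epsilon>' * lin J c (s m) s) + int u * quad J a' s =
        int u * (lin J c (s m) s + quad J a' s)"
      using \<epsilon> by (auto simp: distrib_left)
    also have "[\<dots> = int u * quad I a (E s)] (mod q)"
      by (intro cong_mult cong_refl cong_sym[OF quad_E] s)
    finally show "[quad I a ((E \<circ> \<gamma> \<circ> E') t) = int u * quad I a t] (mod q)"
      by (simp add: E's ts[symmetric])
  qed
qed

text \<open>The pivot is now taken for the exponents \<open>n\<close>, so that \<open>\<psi>\<close>
  survives at the variable \<open>t m\<close> only. Raising \<open>t m\<close> to the power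
  \<open>u\<close> scales \<open>\<psi> (t m)\<close> and the coupling of \<open>t m\<close> to the
  rest by \<open>u\<close>. The remaining variables must then preserve that coupling and scale their
  own quadratic form by \<open>u\<close>, which is \<open>scaling_exists\<close> with
  \<open>\<epsilon> = 1\<close>.\<close>

lemma wordform_scaling:
  fixes I :: "'i set" and p r :: nat
  assumes q: "q = int (p ^ r)" and p: "prime p"
    and fin: "finite (carrier G)" and u: "coprime u (card (carrier G))"
    and I: "finite I"
  shows "\<exists>\<beta>. bij_betw \<beta> (tuples I) (tuples I) \<and>
    (\<forall>t\<in>tuples I. [wordform I n a (\<beta> t) = int u * wordform I n a t] (mod q))"
proof (cases "I = {}")
  case True
  then show ?thesis by (intro exI[of _ id]) (auto simp: wordform_def quad_def)
next
  case False
  then obtain m \<rho> where m: "m \<in> I" and \<rho>: "\<And>j. j \<in> I \<Longrightarrow> [n j + n m * int (\<rho> j) = 0] (mod q)"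
    using pivot_exists[OF p I, of n r] unfolding q by metis
  define J where "J = I - {m}"
  have J: "finite J" "m \<notin> J" and IJ: "I = insert m J"
    using I m by (auto simp: J_def)
  obtain d E where E: "pivot_map J m \<rho> d E" using pivot_map_exists[OF J] by metis
  note Ebij = pivot_mapD(1)[OF E, folded IJ]
    and EJ = pivot_mapD(2)[OF E, folded IJ]
    and E\<psi> = pivot_mapD(4)[OF E, folded IJ]
  \<comment> \<open>The summands with \<open>n m\<close>, here and in \<open>a'\<close>, come from
    the failure of \<open>\<psi>\<close> to be additive on the pivot product.\<close>
  define c where "c j = (a m j - a j m) + n m * \<kappa> * int (\<rho> j)" for j
  define a' where "a' i j = (a i j - (a m i - a i m) * int (\<rho> j)) + n m * d i j" for i j
  have form_E: "[wordform I n a (E t) = n m * \<psi> (t m) + lin J c (t m) t + quad J a' t] (mod q)"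
    if t: "t \<in> tuples I" for t
  proof -
    have 0: "wordform I n a (E t) = n m * \<psi> (E t m) + (\<Sum>j\<in>J. n j * \<psi> (t j)) + quad I a (E t)"
      using J EJ[OF t] unfolding IJ wordform_def by simp
    have 1: "[n m * \<psi> (E t m) + (\<Sum>j\<in>J. n j * \<psi> (t j)) + quad I a (E t) = n m * (\<psi> (t m) + (\<Sum>j\<in>J. int (\<rho> j) * \<psi> (t j)) +
        \<kappa> * lin J (int \<circ> \<rho>) (t m) t + quad J d t) + (\<Sum>j\<in>J. n j * \<psi> (t j)) +
        (lin J (\<lambda>j. a m j - a j m) (t m) t + quad J (\<lambda>i j. a i j - (a m i - a i m) * int (\<rho> j)) t)] (mod q)"
      using quad_pivot[OF J E, of t a] t unfolding IJ
      by (intro cong_add cong_mult cong_refl E\<psi>[unfolded IJ])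
    have 2: "n m * (\<psi> (t m) + (\<Sum>j\<in>J. int (\<rho> j) * \<psi> (t j)) +
        \<kappa> * lin J (int \<circ> \<rho>) (t m) t + quad J d t) + (\<Sum>j\<in>J. n j * \<psi> (t j)) +
        (lin J (\<lambda>j. a m j - a j m) (t m) t + quad J (\<lambda>i j. a i j - (a m i - a i m) * int (\<rho> j)) t) =
        n m * \<psi> (t m) + (\<Sum>j\<in>J. (n j + n m * int (\<rho> j)) * \<psi> (t j)) + (lin J c (t m) t + quad J a' t)"
    proof -
      have "lin J c (t m) t = lin J (\<lambda>j. a m j - a j m) (t m) t + n m * \<kappa> * lin J (int \<circ> \<rho>) (t m) t"
        unfolding lin_scale lin_add c_def by simp
      moreover have "quad J a' t =
          quad J (\<lambda>i j. a i j - (a m i - a i m) * int (\<rho> j)) t + n m * quad J d t"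
        unfolding quad_scale quad_add a'_def by simp
      ultimately show ?thesis
        by (simp add: distrib_left distrib_right sum.distrib sum_distrib_left mult.assoc)
    qed
    have 3: "[n m * \<psi> (t m) + (\<Sum>j\<in>J. (n j + n m * int (\<rho> j)) * \<psi> (t j)) + (lin J c (t m) t + quad J a' t) =
        n m * \<psi> (t m) + (\<Sum>j\<in>J. 0 * \<psi> (t j)) + (lin J c (t m) t + quad J a' t)] (mod q)"
      using \<rho> IJ by (intro cong_add cong_sum cong_mult cong_refl) auto
    from cong_trans[OF 1[unfolded 2] 3] show ?thesis unfolding 0 by (simp add: add.assoc)
  qed
  have "(1 = (1::nat) \<and> u = u) \<or> (1 = u \<and> u = 1)" by simp
  from scaling_exists[OF q p fin u J(1) this, of c a'] obtain \<beta> where \<beta>: "bij_betw \<beta> (tuples J) (tuples J)"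
    and \<beta>_lin: "\<And>t h. t \<in> tuples J \<Longrightarrow> h \<in> carrier G \<Longrightarrow> [lin J c h (\<beta> t) = lin J c h t] (mod q)"
    and \<beta>_quad: "\<And>t. t \<in> tuples J \<Longrightarrow> [quad J a' (\<beta> t) = int u * quad J a' t] (mod q)"
    by auto
  define \<gamma> where "\<gamma> t = (\<beta> (restrict t J))(m := t m [^] u)" for t
  have \<gamma>: "bij_betw \<gamma> (tuples I) (tuples I)"
    unfolding \<gamma>_def IJ by (intro bij_betw_PiE_insert J \<beta> bij_betw_pow_coprime fin u)
  define E' where "E' = inv_into (tuples I) E"
  have E': "bij_betw E' (tuples I) (tuples I)" unfolding E'_def by (rule bij_betw_inv_into[OF Ebij])
  show ?thesis
  proof (intro exI[of _ "E \<circ> \<gamma> \<circ> E'"] conjI ballI)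
    show "bij_betw (E \<circ> \<gamma> \<circ> E') (tuples I) (tuples I)"
      using E' \<gamma> Ebij by (blast intro: bij_betw_trans)
    fix t assume "t \<in> tuples I"
    then obtain s where s: "s \<in> tuples I" and ts: "t = E s" and E's: "E' t = s"
      unfolding E'_def using bij_betw_inv_into_right[OF Ebij] bij_betw_apply[OF E'] E'_def by metis
    have sm: "s m \<in> carrier G" and sJ: "restrict s J \<in> tuples J" "\<And>j. j \<in> J \<Longrightarrow> s j \<in> carrier G"
      using s unfolding IJ by auto
    have \<gamma>s: "\<gamma> s \<in> tuples I" by (rule bij_betw_apply[OF \<gamma> s])
    have \<gamma>m: "\<gamma> s m = s m [^] u" by (simp add: \<gamma>_def)
    have \<gamma>J: "\<gamma> s j = \<beta> (restrict s J) j" if "j \<in> J" for j using that J(2) by (auto simp: \<gamma>_def)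
    have \<beta>s: "\<beta> (restrict s J) \<in> tuples J" by (rule bij_betw_apply[OF \<beta> sJ(1)])
    have "[wordform I n a (E (\<gamma> s)) = n m * \<psi> (s m [^] u) + lin J c (s m [^] u) (\<gamma> s) + quad J a' (\<gamma> s)] (mod q)"
      using form_E[OF \<gamma>s] by (simp add: \<gamma>m)
    also have "lin J c (s m [^] u) (\<gamma> s) = lin J c (s m [^] u) (\<beta> (restrict s J))"
      using \<gamma>J by (rule lin_local)
    also have "quad J a' (\<gamma> s) = quad J a' (\<beta> (restrict s J))"
      using \<gamma>J by (rule quad_local)
    also have "[n m * \<psi> (s m [^] u) + lin J c (s m [^] u) (\<beta> (restrict s J)) + quad J a' (\<beta> (restrict s J)) =
        n m * (int u * \<psi> (s m)) + int u * lin J c (s m) (\<beta> (restrict s J)) + int u * quad J a' (restrict s J)] (mod q)"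
      using \<beta>s by (intro cong_add cong_mult cong_refl \<psi>_pow lin_pow \<beta>_quad sJ(1) sm) auto
    also have "[n m * (int u * \<psi> (s m)) + int u * lin J c (s m) (\<beta> (restrict s J)) + int u * quad J a' (restrict s J) =
        n m * (int u * \<psi> (s m)) + int u * lin J c (s m) (restrict s J) + int u * quad J a' (restrict s J)] (mod q)"
      by (intro cong_add cong_mult cong_refl \<beta>_lin sJ(1) sm)
    also have "lin J c (s m) (restrict s J) = lin J c (s m) s" by (rule lin_local) simp
    also have "quad J a' (restrict s J) = quad J a' s" by (rule quad_local) simp
    also have "n m * (int u * \<psi> (s m)) + int u * lin J c (s m) s + int u * quad J a' s =
        int u * (n m * \<psi> (s m) + lin J c (s m) s + quad J a' s)"
      by (simp add: algebra_simps)
    also have "[\<dots> = int u * wordform I n a (E s)] (mod q)"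
      by (intro cong_mult cong_refl cong_sym[OF form_E] s)
    finally show "[wordform I n a ((E \<circ> \<gamma> \<circ> E') t) = int u * wordform I n a t] (mod q)"
      by (simp add: E's ts[symmetric])
  qed
qed

text \<open>On each coset of \<open>L\<close> in the variable \<open>t m\<close> the form is constant plus a homomorphism
  \<open>\<delta>\<close> on \<open>L\<close>. If \<open>\<delta>\<close> is nonzero, its image contains the class of \<open>p ^ (r - 1)\<close> and both
  values are taken equally often; otherwise the coset contributes \<open>0\<close> or \<open>\<plusminus>card L\<close>.\<close>

lemma card_isotropic_dvd:
  fixes I :: "'i set" and p r :: nat
  assumes q: "q = int (p ^ r)" and p: "prime p"
    and fin: "finite (carrier G)" and I: "finite I" "m \<in> I"
    and L: "subgroup L G" and L_iso: "\<And>x y. x \<in> L \<Longrightarrow> y \<in> L \<Longrightarrow> [b x y = 0] (mod q)"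
  shows "int (card L) dvd
    int (card {t \<in> tuples I. [wordform I n a t = 0] (mod q)}) -
    int (card {t \<in> tuples I. [wordform I n a t = int (p ^ (r - 1))] (mod q)})"
proof -
  have Lc [simp]: "x \<in> carrier G" if "x \<in> L" for x using subgroup.mem_carrier[OF L that] .
  have finT: "finite (tuples I)" using I(1) fin by (intro finite_PiE) auto
  define e where "e = int (p ^ (r - 1))"
  define h :: "('i \<Rightarrow> 'a) \<Rightarrow> int" where "h t = of_bool [wordform I n a t = 0] (mod q) - of_bool [wordform I n a t = e] (mod q)" for t
  define J where "J = I - {m}"
  have J: "finite J" "m \<notin> J" and IJ: "I = insert m J" using I by (auto simp: J_def)
  define c where "c j = a m j - a j m" for j
  \<comment> \<open>A fibre of \<open>g\<close> fixes all variables but one and lets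
    \<open>t m\<close> run over a left coset of \<open>L\<close>.\<close>
  define g where "g t = (restrict t J, t m <# L)" for t :: "'i \<Rightarrow> 'a"
  have dvd: "int (card L) dvd sum h {x \<in> tuples I. g x = y}" for y
  proof (cases "{x \<in> tuples I. g x = y} = {}")
    case True
    show ?thesis by (simp only: True sum.empty dvd_0_right)
  next
    case False
    then obtain t where t: "t \<in> tuples I" and gt: "g t = y" by blast
    have tm [simp]: "t m \<in> carrier G" and tJ: "\<And>j. j \<in> J \<Longrightarrow> t j \<in> carrier G"
      using t unfolding IJ by auto
    define s where "s l = t(m := t m \<otimes> l)" for l
    have s_tup: "s l \<in> tuples I" if "l \<in> L" for l
      using t that I(2) unfolding s_def by (simp add: PiE_iff extensional_def)
    have bij: "bij_betw s L {x \<in> tuples I. g x = y}"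
    proof (intro bij_betw_imageI inj_onI equalityI subsetI)
      fix l l' assume l: "l \<in> L" "l' \<in> L" "s l = s l'"
      then have "t m \<otimes> l = t m \<otimes> l'" unfolding s_def by (metis fun_upd_same)
      then show "l = l'" using l by simp
    next
      fix x assume "x \<in> s ` L"
      then obtain l where l: "l \<in> L" "x = s l" by blast
      have "(t m \<otimes> l) <# L = t m <# (l <# L)" using l tm subgroup.subset[OF L] by (simp add: lcos_m_assoc)
      also have "l <# L = L" using l L by (simp add: coset_join3)
      finally have "g x = y"
        unfolding gt[symmetric] g_def l(2) s_def using J(2) by (auto simp: restrict_def fun_eq_iff)
      then show "x \<in> {x \<in> tuples I. g x = y}" using s_tup l by simp
    next
      fix x assume x: "x \<in> {x \<in> tuples I. g x = y}"
      then have xt: "restrict x J = restrict t J" "x m <# L = t m <# L" unfolding gt[symmetric] g_def by auto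
      have "x m \<in> carrier G" using x unfolding IJ by auto
      then have "x m \<in> x m <# L" using subgroup.one_closed[OF L] by (force simp: l_coset_def)
      then obtain l where l: "l \<in> L" "x m = t m \<otimes> l" unfolding xt(2) by (auto simp: l_coset_def)
      have "x = s l"
      proof
        fix j
        show "x j = s l j"
        proof (cases "j \<in> I")
          case True
          then have "j = m \<or> j \<in> J" unfolding IJ by blast
          then show ?thesis
          proof
            assume "j \<in> J"
            then show ?thesis using fun_cong[OF xt(1), of j] J(2) unfolding s_def by auto
          qed (simp add: s_def l(2))
        next
          case False
          have "x \<in> tuples I" using x by blast
          from PiE_arb[OF this False] PiE_arb[OF s_tup[OF l(1)] False] show ?thesis by (rule trans[OF _ sym])
        qed
      qed
      then show "x \<in> s ` L" using l(1) by blast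
    qed
    \<comment> \<open>The change of the form when \<open>t m\<close> is multiplied by
      \<open>l\<close>. It is additive on \<open>L\<close> modulo \<open>q\<close> because the
      defect \<open>\<kappa> * b l l'\<close> of \<open>\<psi>\<close> vanishes there.\<close>
    define \<delta> where "\<delta> l = n m * (\<psi> l + \<kappa> * b (t m) l) + lin J c l t" for l
    have form: "[wordform I n a (s l) = wordform I n a t + \<delta> l] (mod q)" if l: "l \<in> L" for l
    proof -
      have sl: "\<And>j. j \<in> J \<Longrightarrow> s l j = t j" "s l m = t m \<otimes> l" using J(2) unfolding s_def by auto
      have A: "[quad I a t' = lin J c (t' m) t' + quad J a t'] (mod q)" if "t' \<in> tuples I" for t'
        using that unfolding IJ c_def by (intro quad_insert J) auto
      have "wordform I n a (s l) = n m * \<psi> (t m \<otimes> l) + (\<Sum>j\<in>J. n j * \<psi> (t j)) + quad I a (s l)"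
        using J sl unfolding wordform_def IJ by simp
      also have "[\<dots> = n m * (\<psi> (t m) + \<psi> l + \<kappa> * b (t m) l) + (\<Sum>j\<in>J. n j * \<psi> (t j)) +
          (lin J c (t m \<otimes> l) (s l) + quad J a (s l))] (mod q)"
        using A[OF s_tup[OF l]] l unfolding sl by (intro cong_add cong_mult cong_refl \<psi>_mult) auto
      also have "lin J c (t m \<otimes> l) (s l) = lin J c (t m \<otimes> l) t" by (rule lin_local) (rule sl)
      also have "quad J a (s l) = quad J a t" by (rule quad_local) (rule sl)
      also have "[n m * (\<psi> (t m) + \<psi> l + \<kappa> * b (t m) l) + (\<Sum>j\<in>J. n j * \<psi> (t j)) +
          (lin J c (t m \<otimes> l) t + quad J a t) = n m * (\<psi> (t m) + \<psi> l + \<kappa> * b (t m) l) + (\<Sum>j\<in>J. n j * \<psi> (t j)) +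
          ((lin J c (t m) t + lin J c l t) + quad J a t)] (mod q)"
        using l tJ by (intro cong_add cong_refl lin_mult) auto
      finally have 1: "[wordform I n a (s l) = n m * (\<psi> (t m) + \<psi> l + \<kappa> * b (t m) l) + (\<Sum>j\<in>J. n j * \<psi> (t j)) +
          ((lin J c (t m) t + lin J c l t) + quad J a t)] (mod q)" .
      have 2: "n m * (\<psi> (t m) + \<psi> l + \<kappa> * b (t m) l) + (\<Sum>j\<in>J. n j * \<psi> (t j)) +
          ((lin J c (t m) t + lin J c l t) + quad J a t) =
          (n m * \<psi> (t m) + (\<Sum>j\<in>J. n j * \<psi> (t j)) + (lin J c (t m) t + quad J a t)) + \<delta> l"
        by (simp add: \<delta>_def algebra_simps)
      have 3: "[(n m * \<psi> (t m) + (\<Sum>j\<in>J. n j * \<psi> (t j)) + (lin J c (t m) t + quad J a t)) + \<delta> l =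
          (n m * \<psi> (t m) + (\<Sum>j\<in>J. n j * \<psi> (t j)) + quad I a t) + \<delta> l] (mod q)"
        by (intro cong_add cong_refl cong_sym[OF A] t)
      have 4: "n m * \<psi> (t m) + (\<Sum>j\<in>J. n j * \<psi> (t j)) + quad I a t = wordform I n a t"
        using J unfolding wordform_def IJ by simp
      from cong_trans[OF 1[unfolded 2] 3] show ?thesis unfolding 4 .
    qed
    have \<delta>_mult: "[\<delta> (l \<otimes> l') = \<delta> l + \<delta> l'] (mod q)" if l: "l \<in> L" "l' \<in> L" for l l'
    proof -
      have "[\<delta> (l \<otimes> l') = n m * ((\<psi> l + \<psi> l' + \<kappa> * b l l') + \<kappa> * (b (t m) l + b (t m) l')) + (lin J c l t + lin J c l' t)] (mod q)"
        unfolding \<delta>_def using l tJ by (intro cong_add cong_mult cong_refl \<psi>_mult lin_mult b_mult2) auto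
      also have "[n m * ((\<psi> l + \<psi> l' + \<kappa> * b l l') + \<kappa> * (b (t m) l + b (t m) l')) + (lin J c l t + lin J c l' t) =
          n m * ((\<psi> l + \<psi> l' + \<kappa> * 0) + \<kappa> * (b (t m) l + b (t m) l')) + (lin J c l t + lin J c l' t)] (mod q)"
        using l by (intro cong_add cong_mult cong_refl L_iso)
      finally show ?thesis by (simp add: \<delta>_def algebra_simps)
    qed
    have sum_eq: "sum h {x \<in> tuples I. g x = y} = (\<Sum>l\<in>L. h (s l))"
      using sum.reindex_bij_betw[OF bij, of h] by simp
    show ?thesis
    proof (cases "\<forall>l\<in>L. [\<delta> l = 0] (mod q)")
      case True
      have "h (s l) = h t" if "l \<in> L" for l
      proof -
        have "[wordform I n a (s l) = wordform I n a t] (mod q)"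
          using cong_trans[OF form[OF that] cong_add[OF cong_refl bspec[OF True that]]] by simp
        then show ?thesis unfolding h_def by (simp add: cong_def)
      qed
      then show ?thesis unfolding sum_eq by simp
    next
      case False
      then obtain l0 where l0: "l0 \<in> L" "\<not> [\<delta> l0 = 0] (mod q)" by blast
      obtain k :: nat where k: "[int k * \<delta> l0 = e] (mod q)"
        using exists_multiple_cong_socle[OF p l0(2)[unfolded q]] unfolding q e_def by blast
      define l1 where "l1 = l0 [^] k"
      have pow_L: "l0 [^] j \<in> L" for j :: nat
        using l0(1) L by (induction j) (auto intro: subgroup.one_closed subgroup.m_closed)
      have "[\<delta> (l0 [^] j) = int j * \<delta> l0] (mod q)" for j
      proof (induction j)
        case 0
        have "[\<delta> (\<one> \<otimes> \<one>) = \<delta> \<one> + \<delta> \<one>] (mod q)"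
          by (intro \<delta>_mult subgroup.one_closed[OF L])
        then show ?case by (simp add: cong_iff_dvd_diff)
      next
        case (Suc j)
        have "[\<delta> (l0 [^] Suc j) = \<delta> (l0 [^] j) + \<delta> l0] (mod q)"
          using \<delta>_mult[OF pow_L l0(1)] by simp
        also have "[\<delta> (l0 [^] j) + \<delta> l0 = int j * \<delta> l0 + \<delta> l0] (mod q)"
          by (intro cong_add Suc cong_refl)
        finally show ?case by (simp add: algebra_simps)
      qed
      from cong_trans[OF this k] have \<delta>1: "[\<delta> l1 = e] (mod q)" unfolding l1_def .
      have l1: "l1 \<in> L" unfolding l1_def by (rule pow_L)
      \<comment> \<open>Translation by \<open>l1\<close> raises the form by \<open>e\<close>, so it
        matches the value 0 with the value \<open>e\<close> within the coset.\<close>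
      have shift: "bij_betw (\<lambda>l. l \<otimes> l1) L L"
        using l1 L by (intro bij_betw_byWitness[where f' = "\<lambda>l. l \<otimes> inv l1"])
          (auto simp: m_assoc subgroup.m_closed subgroup.m_inv_closed)
      have eq: "[wordform I n a (s (l \<otimes> l1)) = e] (mod q) \<longleftrightarrow> [wordform I n a (s l) = 0] (mod q)"
        if l: "l \<in> L" for l
      proof -
        have "[wordform I n a (s (l \<otimes> l1)) = wordform I n a t + \<delta> (l \<otimes> l1)] (mod q)"
          using l l1 L by (intro form subgroup.m_closed)
        also have "[wordform I n a t + \<delta> (l \<otimes> l1) = wordform I n a t + (\<delta> l + \<delta> l1)] (mod q)"
          by (intro cong_add cong_refl \<delta>_mult l l1)
        also have "[wordform I n a t + (\<delta> l + \<delta> l1) = wordform I n a t + (\<delta> l + e)] (mod q)"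
          by (intro cong_add cong_refl \<delta>1)
        also have "wordform I n a t + (\<delta> l + e) = (wordform I n a t + \<delta> l) + e" by simp
        also have "[\<dots> = wordform I n a (s l) + e] (mod q)"
          by (intro cong_add cong_refl cong_sym[OF form] l)
        finally have "[wordform I n a (s (l \<otimes> l1)) = wordform I n a (s l) + e] (mod q)" .
        then have "[wordform I n a (s (l \<otimes> l1)) = e] (mod q) \<longleftrightarrow> [wordform I n a (s l) + e = 0 + e] (mod q)"
          by (simp add: cong_def)
        then show ?thesis by (simp only: cong_add_rcancel)
      qed
      have "(\<Sum>l\<in>L. of_bool [wordform I n a (s l) = e] (mod q)) = (\<Sum>l\<in>L. of_bool [wordform I n a (s (l \<otimes> l1)) = e] (mod q) :: int)"
        using sum.reindex_bij_betw[OF shift, of "\<lambda>l. of_bool [wordform I n a (s l) = e] (mod q) :: int"] by simp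
      also have "\<dots> = (\<Sum>l\<in>L. of_bool [wordform I n a (s l) = 0] (mod q))"
        by (intro sum.cong refl) (simp only: eq)
      finally have "(\<Sum>l\<in>L. h (s l)) = 0" by (simp add: h_def sum_subtractf)
      then show ?thesis unfolding sum_eq by simp
    qed
  qed
  have "int (card L) dvd (\<Sum>y\<in>g ` tuples I. sum h {x \<in> tuples I. g x = y})"
    by (rule dvd_sum) (rule dvd)
  moreover have "(\<Sum>y\<in>g ` tuples I. sum h {x \<in> tuples I. g x = y}) = sum h (tuples I)"
    using finT by (intro sum.group) auto
  moreover have "sum h (tuples I) = int (card {t \<in> tuples I. [wordform I n a t = 0] (mod q)}) -
      int (card {t \<in> tuples I. [wordform I n a t = e] (mod q)})"
  proof -
    have "(\<Sum>t\<in>tuples I. of_bool (P t)) = int (card {t \<in> tuples I. P t})" for P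
      using finT by (simp only: sum_of_bool_eq Int_def mem_Collect_eq)
    note this[of "\<lambda>t. [wordform I n a t = 0] (mod q)"] this[of "\<lambda>t. [wordform I n a t = e] (mod q)"]
    moreover have "sum h (tuples I) = (\<Sum>t\<in>tuples I. of_bool [wordform I n a t = 0] (mod q) -
        of_bool [wordform I n a t = e] (mod q))"
      by (intro sum.cong refl) (rule h_def)
    ultimately show ?thesis by (simp only: sum_subtractf)
  qed
  ultimately show ?thesis unfolding e_def by simp
qed

end

section \<open>Words in class two groups with cyclic center\<close>

text \<open>Class at most two: unlike class exactly two, this passes to quotients, as the induction
  requires.\<close>

locale class2_p_group = group G for G (structure) +
  fixes p N :: nat
  assumes prime_p: "prime p" and fin: "finite (carrier G)" and card_G: "card (carrier G) = p ^ N"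
    and comm_central: "\<lbrakk>x \<in> carrier G; y \<in> carrier G; z \<in> carrier G\<rbrakk> \<Longrightarrow>
      (x \<otimes> y \<otimes> inv x \<otimes> inv y) \<otimes> z = z \<otimes> (x \<otimes> y \<otimes> inv x \<otimes> inv y)"

definition center :: "('a, 'b) monoid_scheme \<Rightarrow> 'a set" where
  "center G = {z \<in> carrier G. \<forall>x\<in>carrier G. z \<otimes>\<^bsub>G\<^esub> x = x \<otimes>\<^bsub>G\<^esub> z}"

locale cyclic_center = class2_p_group +
  fixes \<zeta> :: 'a and r :: nat
  assumes \<zeta>_center: "\<zeta> \<in> center G" and r_pos: "r > 0" and ord_\<zeta>: "ord \<zeta> = p ^ r"
    and center_generated: "z \<in> center G \<Longrightarrow> \<exists>i::int. z = \<zeta> [^] i"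
begin

definition q :: int where "q = int (p ^ r)"

lemma q_pos: "q > 0"
  using prime_p by (simp add: q_def prime_gt_0_nat)

lemma \<zeta>_carrier [simp]: "\<zeta> \<in> carrier G"
  using \<zeta>_center by (simp add: center_def)

lemma \<zeta>_commute: "x \<in> carrier G \<Longrightarrow> \<zeta> [^] (i::int) \<otimes> x = x \<otimes> \<zeta> [^] i"
proof -
  assume x [simp]: "x \<in> carrier G"
  have \<zeta>x: "\<zeta> \<otimes> x = x \<otimes> \<zeta>" using \<zeta>_center by (simp add: center_def)
  have pow: "\<zeta> [^] n \<otimes> x = x \<otimes> \<zeta> [^] n" for n :: nat
    using group_commutes_pow[OF \<zeta>x] by simp
  show ?thesis
  proof (cases i rule: int_cases2)
    case (nonneg n)
    then show ?thesis by (simp add: int_pow_int pow)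
  next
    case (nonpos n)
    have "inv (\<zeta> [^] n) \<otimes> (\<zeta> [^] n \<otimes> x) \<otimes> inv (\<zeta> [^] n) = inv (\<zeta> [^] n) \<otimes> (x \<otimes> \<zeta> [^] n) \<otimes> inv (\<zeta> [^] n)"
      by (simp add: pow)
    then have "x \<otimes> inv (\<zeta> [^] n) = inv (\<zeta> [^] n) \<otimes> x"
      by (simp add: m_assoc)
    then show ?thesis using nonpos by (simp add: int_pow_neg_int)
  qed
qed

text \<open>Multiplication by \<open>\<zeta> [^] i\<close> is treated as an operation of its own, so that the simplifier
  collects central factors in front.\<close>

definition tw :: "int \<Rightarrow> 'a \<Rightarrow> 'a" where
  "tw i x = \<zeta> [^] i \<otimes> x"

lemma tw_closed [simp]: "x \<in> carrier G \<Longrightarrow> tw i x \<in> carrier G"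
  by (simp add: tw_def)

lemma tw_mult_left [simp]: "x \<in> carrier G \<Longrightarrow> y \<in> carrier G \<Longrightarrow> tw i x \<otimes> y = tw i (x \<otimes> y)"
  by (simp add: tw_def m_assoc)

lemma tw_mult_right [simp]:
  assumes "x \<in> carrier G" "y \<in> carrier G"
  shows "x \<otimes> tw i y = tw i (x \<otimes> y)"
proof -
  have "x \<otimes> (\<zeta> [^] i \<otimes> y) = (x \<otimes> \<zeta> [^] i) \<otimes> y" using assms by (simp add: m_assoc)
  also have "\<dots> = (\<zeta> [^] i \<otimes> x) \<otimes> y" using assms by (simp add: \<zeta>_commute)
  finally show ?thesis using assms by (simp add: tw_def m_assoc)
qed

lemma tw_tw [simp]: "x \<in> carrier G \<Longrightarrow> tw i (tw j x) = tw (i + j) x"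
  by (simp add: tw_def int_pow_mult m_assoc)

lemma tw_0 [simp]: "x \<in> carrier G \<Longrightarrow> tw 0 x = x"
  by (simp add: tw_def)

lemma tw_eq_iff [simp]:
  assumes "x \<in> carrier G"
  shows "tw i x = tw j x \<longleftrightarrow> [i = j] (mod q)"
proof -
  have "tw i x = tw j x \<longleftrightarrow> \<zeta> [^] i = \<zeta> [^] j" using assms by (simp add: tw_def)
  also have "\<dots> \<longleftrightarrow> int (ord \<zeta>) dvd j - i" by (rule int_pow_eq) simp
  also have "\<dots> \<longleftrightarrow> [i = j] (mod q)"
    by (simp add: ord_\<zeta> q_def cong_iff_dvd_diff dvd_diff_commute)
  finally show ?thesis .
qed

lemma tw_cancel [simp]: "x \<in> carrier G \<Longrightarrow> y \<in> carrier G \<Longrightarrow> tw i x = tw i y \<longleftrightarrow> x = y"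
  by (simp add: tw_def)

lemma tw_one: "tw i \<one> = \<zeta> [^] i"
  by (simp add: tw_def)

lemma tw_inv [simp]: "x \<in> carrier G \<Longrightarrow> inv (tw i x) = tw (- i) (inv x)"
  by (rule inv_equality) (simp_all add: tw_tw)

lemma tw_move:
  assumes "x \<in> carrier G" "y \<in> carrier G" "x = tw i y"
  shows "y = tw (- i) x"
  using assms by simp

lemma tw_pow:
  assumes "x \<in> carrier G"
  shows "(tw i x) [^] (n::int) = tw (i * n) (x [^] n)"
  using assms unfolding tw_def
  by (subst int_pow_mult_distrib) (simp_all add: \<zeta>_commute int_pow_pow)

lemma mem_center_iff: "z \<in> center G \<longleftrightarrow> (\<exists>i. z = tw i \<one>)"
  using center_generated by (force simp: tw_one center_def \<zeta>_commute)

text \<open>The integers chosen by \<open>SOME\<close> here and in \<open>\<psi>\<close> are only determined modulo \<open>q\<close>; \<open>b x y\<close> is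
  the exponent of the commutator of \<open>x\<close> and \<open>y\<close>.\<close>

definition b :: "'a \<Rightarrow> 'a \<Rightarrow> int" where
  "b x y = (SOME i. x \<otimes> y = tw i (y \<otimes> x))"

lemma b_eq:
  assumes [simp]: "x \<in> carrier G" "y \<in> carrier G"
  shows "x \<otimes> y = tw (b x y) (y \<otimes> x)"
proof -
  have "x \<otimes> y \<otimes> inv x \<otimes> inv y \<in> center G"
    using comm_central by (simp add: center_def)
  then obtain i where i: "x \<otimes> y \<otimes> inv x \<otimes> inv y = tw i \<one>" using mem_center_iff by blast
  have "x \<otimes> y = (x \<otimes> y \<otimes> inv x \<otimes> inv y) \<otimes> (y \<otimes> x)"
    by (simp add: m_assoc)
  also have "\<dots> = tw i (y \<otimes> x)" unfolding i by simp
  finally show ?thesis unfolding b_def by (rule someI)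
qed

lemma b_unique:
  assumes "x \<in> carrier G" "y \<in> carrier G" "x \<otimes> y = tw i (y \<otimes> x)"
  shows "[b x y = i] (mod q)"
  using b_eq[OF assms(1,2)] assms by (simp add: cong_sym)

sublocale alternating_map G q b
proof
  fix x y z assume [simp]: "x \<in> carrier G" "y \<in> carrier G"
  show "[b x y = - b y x] (mod q)"
    using tw_move[OF _ _ b_eq[of y x]] by (intro b_unique) auto
  show "[b x x = 0] (mod q)" by (intro b_unique) auto
  show "[b (x \<otimes> y) z = b x z + b y z] (mod q)" if [simp]: "z \<in> carrier G"
  proof (rule b_unique)
    have "(x \<otimes> y) \<otimes> z = x \<otimes> (y \<otimes> z)" by (simp add: m_assoc)
    also have "y \<otimes> z = tw (b y z) (z \<otimes> y)" by (rule b_eq) auto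
    also have "x \<otimes> tw (b y z) (z \<otimes> y) = tw (b y z) ((x \<otimes> z) \<otimes> y)" by (simp add: m_assoc)
    also have "x \<otimes> z = tw (b x z) (z \<otimes> x)" by (rule b_eq) auto
    finally show "x \<otimes> y \<otimes> z = tw (b x z + b y z) (z \<otimes> (x \<otimes> y))"
      by (simp add: m_assoc add.commute)
  qed auto
qed

lemma b_tw_left:
  assumes "x \<in> carrier G" "y \<in> carrier G"
  shows "[b (tw i x) y = b x y] (mod q)"
  using assms b_eq[of x y] by (intro b_unique) (auto simp: add.commute)

text \<open>The commutator of \<open>x [^] (p ^ r)\<close> with \<open>y\<close> is the
  \<open>p ^ r\<close>-th power of a central element, and the center has exponent
  \<open>p ^ r\<close>.\<close>

lemma pow_q_central:
  assumes [simp]: "x \<in> carrier G"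
  shows "\<exists>i. x [^] (p ^ r) = tw i \<one>"
proof -
  have "x [^] (p ^ r) \<otimes> y = y \<otimes> x [^] (p ^ r)" if [simp]: "y \<in> carrier G" for y
  proof -
    have "x [^] (p ^ r) \<otimes> y = tw (b (x [^] (p ^ r)) y) (y \<otimes> x [^] (p ^ r))" by (intro b_eq) auto
    also have "\<dots> = tw 0 (y \<otimes> x [^] (p ^ r))"
    proof (subst tw_eq_iff)
      have "[b (x [^] (p ^ r)) y = int (p ^ r) * b x y] (mod q)" by (intro b_pow) auto
      then show "[b (x [^] (p ^ r)) y = 0] (mod q)"
        by (rule cong_trans) (simp add: q_def cong_0_iff)
    qed auto
    finally show ?thesis by simp
  qed
  then have "x [^] (p ^ r) \<in> center G" by (simp add: center_def)
  then show ?thesis by (simp add: mem_center_iff)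
qed

text \<open>Each new factor \<open>x\<close> has to pass the powers of \<open>y\<close> collected so
  far, at the cost of \<open>- int n * b x y\<close>; the constant built here is minus the binomial
  coefficient of \<open>n\<close> over 2. For \<open>n = p ^ r\<close> it is divisible by
  \<open>q\<close> if \<open>p\<close> is odd but not if \<open>p = 2\<close>, which is why
  \<open>\<kappa>\<close> is carried along.\<close>

lemma power_of_product:
  fixes n :: nat
  shows "\<exists>c. \<forall>x\<in>carrier G. \<forall>y\<in>carrier G. (x \<otimes> y) [^] n = tw (c * b x y) (x [^] n \<otimes> y [^] n)"
proof (induction n)
  case 0
  show ?case by (intro exI[of _ 0]) simp
next
  case (Suc n)
  then obtain c where c: "\<And>x y. x \<in> carrier G \<Longrightarrow> y \<in> carrier G \<Longrightarrow>
    (x \<otimes> y) [^] n = tw (c * b x y) (x [^] n \<otimes> y [^] n)" by blast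
  show ?case
  proof (intro exI[of _ "c - int n"] ballI)
    fix x y assume [simp]: "x \<in> carrier G" "y \<in> carrier G"
    have 1: "y [^] n \<otimes> x = tw (- (int n * b x y)) (x \<otimes> y [^] n)"
    proof -
      have "y [^] n \<otimes> x = tw (b (y [^] n) x) (x \<otimes> y [^] n)" by (intro b_eq) auto
      moreover have "[b (y [^] n) x = - (int n * b x y)] (mod q)"
      proof -
        have "[b (y [^] n) x = int n * b y x] (mod q)" by (intro b_pow) auto
        also have "[int n * b y x = int n * (- b x y)] (mod q)"
          by (intro cong_mult cong_refl b_skew) auto
        finally show ?thesis by simp
      qed
      ultimately show ?thesis by simp
    qed
    have "(x \<otimes> y) [^] Suc n = tw (c * b x y) (x [^] n \<otimes> (y [^] n \<otimes> x) \<otimes> y)"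
      by (simp add: c m_assoc)
    also have "\<dots> = tw (c * b x y - int n * b x y) (x [^] Suc n \<otimes> y [^] Suc n)"
      unfolding 1 by (simp add: m_assoc)
    finally show "(x \<otimes> y) [^] Suc n = tw ((c - int n) * b x y) (x [^] Suc n \<otimes> y [^] Suc n)"
      by (simp add: left_diff_distrib)
  qed
qed

definition \<kappa> :: int where
  "\<kappa> = (SOME c. \<forall>x\<in>carrier G. \<forall>y\<in>carrier G.
    (x \<otimes> y) [^] (p ^ r) = tw (c * b x y) (x [^] (p ^ r) \<otimes> y [^] (p ^ r)))"

definition \<psi> :: "'a \<Rightarrow> int" where
  "\<psi> x = (SOME i. x [^] (p ^ r) = tw i \<one>)"

lemma \<psi>_eq: "x \<in> carrier G \<Longrightarrow> x [^] (p ^ r) = tw (\<psi> x) \<one>"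
  unfolding \<psi>_def by (rule someI_ex) (rule pow_q_central)

sublocale quadratic_map G q b \<psi> \<kappa>
proof
  fix x y assume [simp]: "x \<in> carrier G" "y \<in> carrier G"
  have "(x \<otimes> y) [^] (p ^ r) = tw (\<kappa> * b x y) (x [^] (p ^ r) \<otimes> y [^] (p ^ r))"
    using someI_ex[OF power_of_product[of "p ^ r"]] unfolding \<kappa>_def by simp
  then have "tw (\<psi> (x \<otimes> y)) \<one> = tw (\<kappa> * b x y + (\<psi> x + \<psi> y)) \<one>"
    by (simp add: \<psi>_eq ac_simps)
  then show "[\<psi> (x \<otimes> y) = \<psi> x + \<psi> y + \<kappa> * b x y] (mod q)"
    by (simp add: ac_simps)
qed

section \<open>Collecting a word into an ordered product times a central factor\<close>

primrec ordered_product :: "(nat \<Rightarrow> int) \<Rightarrow> (nat \<Rightarrow> 'a) \<Rightarrow> nat \<Rightarrow> 'a" where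
  "ordered_product s t 0 = \<one>"
| "ordered_product s t (Suc k) = ordered_product s t k \<otimes> t k [^] s k"

lemma ordered_product_closed [simp]:
  "(\<And>j. j < k \<Longrightarrow> t j \<in> carrier G) \<Longrightarrow> ordered_product s t k \<in> carrier G"
  by (induction k) auto

lemma ordered_product_cong:
  "(\<And>j. j < k \<Longrightarrow> s j = s' j \<and> t j = t' j) \<Longrightarrow> ordered_product s t k = ordered_product s' t' k"
  by (induction k) auto

lemma b_ordered_product:
  assumes "\<And>j. j < k \<Longrightarrow> t j \<in> carrier G" "h \<in> carrier G"
  shows "[b h (ordered_product s t k) = lin {..<k} s h t] (mod q)"
  using assms(1)
proof (induction k)
  case 0
  have "[b h \<one> = 0] (mod q)" using assms(2) by (intro b_unique) auto
  then show ?case by (simp add: lin_def)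
next
  case (Suc k)
  then have [simp]: "t k \<in> carrier G" "ordered_product s t k \<in> carrier G" by simp_all
  have "[b h (ordered_product s t (Suc k)) = b h (ordered_product s t k) + b h (t k [^] s k)] (mod q)"
    using assms(2) by (simp add: b_mult2)
  also have "[b h (ordered_product s t k) + b h (t k [^] s k) = lin {..<k} s h t + s k * b h (t k)] (mod q)"
  proof (intro cong_add)
    show "[b h (ordered_product s t k) = lin {..<k} s h t] (mod q)"
      using Suc by simp
    have "[b h (t k [^] s k) = - b (t k [^] s k) h] (mod q)" using assms(2) by (intro b_skew) auto
    also have "[- b (t k [^] s k) h = - (s k * b (t k) h)] (mod q)"
      unfolding cong_minus_minus_iff using assms(2) by (intro b_int_pow) auto
    also have "- (s k * b (t k) h) = s k * (- b (t k) h)" by simp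
    also have "[s k * (- b (t k) h) = s k * b h (t k)] (mod q)"
      using assms(2) by (intro cong_mult cong_refl cong_sym[OF b_skew]) auto
    finally show "[b h (t k [^] s k) = s k * b h (t k)] (mod q)" .
  qed
  finally show ?case by (simp add: lin_def add.commute)
qed

text \<open>To reach its place the new power moves right past the powers of \<open>t 0\<close>, ...,
  \<open>t (i - 1)\<close> only, and passing \<open>t j [^] s j\<close> costs
  \<open>e * s j * b (t i) (t j)\<close>.\<close>

lemma letter_ordered_product:
  assumes "\<And>j. j < k \<Longrightarrow> t j \<in> carrier G" "i < k"
  shows "t i [^] (e::int) \<otimes> ordered_product s t k =
    tw (e * lin {..<i} s (t i) t) (ordered_product (s(i := s i + e)) t k)"
  using assms
proof (induction k)
  case (Suc k)
  have [simp]: "t j \<in> carrier G" if "j < Suc k" for j using Suc.prems(1) that .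
  have [simp]: "ordered_product s t k \<in> carrier G" for s by simp
  show ?case
  proof (cases "i = k")
    case True
    have "t k [^] e \<otimes> ordered_product s t k =
        tw (b (t k [^] e) (ordered_product s t k)) (ordered_product s t k \<otimes> t k [^] e)"
      by (intro b_eq) auto
    also have "\<dots> = tw (e * lin {..<k} s (t k) t) (ordered_product s t k \<otimes> t k [^] e)"
    proof (subst tw_eq_iff)
      have "[b (t k [^] e) (ordered_product s t k) = e * b (t k) (ordered_product s t k)] (mod q)"
        by (intro b_int_pow) auto
      also have "[e * b (t k) (ordered_product s t k) = e * lin {..<k} s (t k) t] (mod q)"
        by (intro cong_mult cong_refl b_ordered_product) auto
      finally show "[b (t k [^] e) (ordered_product s t k) = e * lin {..<k} s (t k) t] (mod q)" .
    qed auto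
    finally have 1: "t k [^] e \<otimes> ordered_product s t k =
        tw (e * lin {..<k} s (t k) t) (ordered_product s t k \<otimes> t k [^] e)" .
    have 2: "ordered_product (s(k := s k + e)) t k = ordered_product s t k"
      by (rule ordered_product_cong) auto
    have "t i [^] e \<otimes> ordered_product s t (Suc k) = (t k [^] e \<otimes> ordered_product s t k) \<otimes> t k [^] s k"
      by (simp add: True m_assoc)
    also have "\<dots> = tw (e * lin {..<k} s (t k) t) (ordered_product s t k \<otimes> (t k [^] e \<otimes> t k [^] s k))"
      unfolding 1 by (simp add: m_assoc)
    also have "t k [^] e \<otimes> t k [^] s k = t k [^] (s k + e)"
      by (simp add: int_pow_mult[symmetric] add.commute)
    finally show ?thesis by (simp add: True 2 del: fun_upd_apply add: fun_upd_same)
  next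
    case False
    then have i: "i < k" using Suc.prems by simp
    have "t i [^] e \<otimes> ordered_product s t (Suc k) = (t i [^] e \<otimes> ordered_product s t k) \<otimes> t k [^] s k"
      using i by (simp add: m_assoc)
    also have "t i [^] e \<otimes> ordered_product s t k =
      tw (e * lin {..<i} s (t i) t) (ordered_product (s(i := s i + e)) t k)"
      using i by (intro Suc.IH) auto
    finally show ?thesis using False by (simp del: fun_upd_apply add: fun_upd_other)
  qed
qed simp

text \<open>The letters are collected from the right end of the word. The construction makes
  \<open>s\<close> the exponent sums, and both \<open>s\<close> and \<open>a\<close> depend on the
  word alone, not on the tuple.\<close>

lemma word_normal_form:
  assumes "fst ` set w \<subseteq> {..<k}"
  shows "\<exists>s a. \<forall>t. (\<forall>j<k. t j \<in> carrier G) \<longrightarrow>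
    word_eval G t w = tw (quad {..<k} a t) (ordered_product s t k)"
  using assms
proof (induction w)
  case Nil
  have "ordered_product (\<lambda>_. 0) t k = \<one>" for t by (induction k) auto
  then show ?case
    by (intro exI[of _ "\<lambda>_. 0"] exI[of _ "\<lambda>_ _. 0"]) (simp add: quad_def)
next
  case (Cons l w)
  then obtain s a where sa: "\<And>t. (\<forall>j<k. t j \<in> carrier G) \<Longrightarrow>
    word_eval G t w = tw (quad {..<k} a t) (ordered_product s t k)" by auto
  define i where "i = fst l"
  define e :: int where "e = (if snd l then 1 else -1)"
  have i: "i < k" using Cons.prems by (simp add: i_def)
  define a' where "a' x y = a x y + (if x = i \<and> y < i then e * s y else 0)" for x y
  show ?case
  proof (intro exI[of _ "s(i := s i + e)"] exI[of _ a'] allI impI)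
    fix t assume t: "\<forall>j<k. t j \<in> carrier G"
    have [simp]: "t i \<in> carrier G" "\<And>s. ordered_product s t k \<in> carrier G" using t i by auto
    have "letter_eval G t l = t i [^] e"
      by (simp add: letter_eval_def e_def i_def[symmetric] int_pow_neg)
    then have "word_eval G t (l # w) = t i [^] e \<otimes> tw (quad {..<k} a t) (ordered_product s t k)"
      using sa[OF t] by simp
    also have "\<dots> = tw (quad {..<k} a t) (t i [^] e \<otimes> ordered_product s t k)" by simp
    also have "t i [^] e \<otimes> ordered_product s t k =
        tw (e * lin {..<i} s (t i) t) (ordered_product (s(i := s i + e)) t k)"
      using t i by (intro letter_ordered_product) auto
    also have "tw (quad {..<k} a t) (tw (e * lin {..<i} s (t i) t) (ordered_product (s(i := s i + e)) t k)) =
        tw (quad {..<k} a t + e * lin {..<i} s (t i) t) (ordered_product (s(i := s i + e)) t k)" by simp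
    also have "quad {..<k} a t + e * lin {..<i} s (t i) t = quad {..<k} a' t"
    proof -
      have "e * lin {..<i} s (t i) t = (\<Sum>y\<in>{..<k}. (if y < i then e * s y else 0) * b (t i) (t y))"
        unfolding lin_def sum_distrib_left using i
        by (intro sum.mono_neutral_cong_left) auto
      also have "\<dots> = (\<Sum>x\<in>{..<k}. if x = i then (\<Sum>y\<in>{..<k}. (if y < i then e * s y else 0) * b (t x) (t y)) else 0)"
        using i by simp
      also have "\<dots> = quad {..<k} (\<lambda>x y. if x = i \<and> y < i then e * s y else 0) t"
        unfolding quad_def by (intro sum.cong) auto
      finally show ?thesis unfolding a'_def quad_add[symmetric] by simp
    qed
    finally show "word_eval G t (l # w) = tw (quad {..<k} a' t) (ordered_product (s(i := s i + e)) t k)" .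
  qed
qed

lemma ordered_product_shift:
  assumes "\<And>j. j < k \<Longrightarrow> t j \<in> carrier G" "i < k"
  shows "ordered_product s (t(i := tw z (t i))) k = tw (z * s i) (ordered_product s t k)"
  using assms
proof (induction k)
  case (Suc k)
  have [simp]: "t j \<in> carrier G" if "j < Suc k" for j using Suc.prems(1) that .
  show ?case
  proof (cases "i = k")
    case True
    have "ordered_product s (t(k := tw z (t k))) k = ordered_product s t k"
      by (rule ordered_product_cong) auto
    then show ?thesis using True by (simp add: tw_pow del: fun_upd_apply add: fun_upd_same)
  next
    case False
    then show ?thesis using Suc by (simp del: fun_upd_apply add: fun_upd_other)
  qed
qed simp

text \<open>A central factor does not affect commutators, so it enters the value only through the
  exponent sum of its variable.\<close>

lemma word_shift:
  assumes "\<forall>t. (\<forall>j<k. t j \<in> carrier G) \<longrightarrow>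
      word_eval G t w = tw (quad {..<k} a t) (ordered_product s t k)"
    and t: "\<And>j. j < k \<Longrightarrow> t j \<in> carrier G" and i: "i < k"
  shows "word_eval G (t(i := tw z (t i))) w = tw (z * s i) (word_eval G t w)"
proof -
  let ?t = "t(i := tw z (t i))"
  have t': "?t j \<in> carrier G" if "j < k" for j using t that i by auto
  have left: "[b (?t x) h = b (t x) h] (mod q)" if "x < k" "h \<in> carrier G" for x h
    using b_tw_left t that by auto
  have "[b (?t x) (?t y) = b (t x) (t y)] (mod q)" if "x < k" "y < k" for x y
  proof -
    have "[b (?t x) (?t y) = b (t x) (?t y)] (mod q)" using that t' by (intro left) auto
    also have "[b (t x) (?t y) = - b (?t y) (t x)] (mod q)" using that t' t by (intro b_skew) auto
    also have "[- b (?t y) (t x) = - b (t y) (t x)] (mod q)"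
      unfolding cong_minus_minus_iff using that t by (intro left) auto
    also have "[- b (t y) (t x) = b (t x) (t y)] (mod q)" using that t by (intro cong_sym[OF b_skew]) auto
    finally show ?thesis .
  qed
  then have "[quad {..<k} a ?t = quad {..<k} a t] (mod q)"
    unfolding quad_def by (intro cong_sum cong_mult cong_refl) auto
  then have q: "tw (z * s i + quad {..<k} a ?t) (ordered_product s t k) =
      tw (z * s i + quad {..<k} a t) (ordered_product s t k)"
    using t by (simp add: cong_add)
  have "word_eval G ?t w = tw (quad {..<k} a ?t) (ordered_product s ?t k)"
    using assms(1) t' by blast
  also have "ordered_product s ?t k = tw (z * s i) (ordered_product s t k)"
    using t i by (rule ordered_product_shift)
  also have "tw (quad {..<k} a ?t) (tw (z * s i) (ordered_product s t k)) =
      tw (z * s i) (tw (quad {..<k} a t) (ordered_product s t k))"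
    using t q by (simp only: tw_tw ordered_product_closed add.commute)
  also have "tw (quad {..<k} a t) (ordered_product s t k) = word_eval G t w"
    using assms(1) t by simp
  finally show ?thesis .
qed

text \<open>Powers with exponent divisible by \<open>q\<close> are central, with exponents given by
  \<open>\<psi>\<close>; the noncentral part of the normal form disappears.\<close>

lemma ordered_product_central:
  assumes "\<And>j. j < k \<Longrightarrow> t j \<in> carrier G" "\<And>j. j < k \<Longrightarrow> s j = q * n j"
  shows "ordered_product s t k = tw (\<Sum>j<k. n j * \<psi> (t j)) \<one>"
  using assms
proof (induction k)
  case (Suc k)
  have [simp]: "t k \<in> carrier G" using Suc.prems(1) by simp
  have "t k [^] s k = (t k [^] (p ^ r)) [^] n k"
    using Suc.prems(2)[of k] by (simp add: q_def int_pow_pow[symmetric] int_pow_int del: of_nat_power)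
  also have "\<dots> = tw (\<psi> (t k) * n k) \<one>"
    by (simp add: \<psi>_eq tw_pow)
  finally show ?case using Suc by (simp add: mult.commute add.commute)
qed simp

section \<open>Characters induced from a maximal isotropic subgroup\<close>

text \<open>A faithful character of the center, as a function of the exponent of
  \<open>\<zeta>\<close>.\<close>

definition unity_root :: "int \<Rightarrow> complex" where
  "unity_root i = cis (2 * pi * (of_int i / of_int q))"

lemma unity_root_add: "unity_root (i + j) = unity_root i * unity_root j"
  by (simp add: unity_root_def cis_mult add_divide_distrib distrib_left)

lemma unity_root_0 [simp]: "unity_root 0 = 1"
  by (simp add: unity_root_def)

lemma unity_root_nonzero [simp]: "unity_root i \<noteq> 0"
  using cis_neq_zero by (simp add: unity_root_def)

lemma unity_root_power: "unity_root i ^ n = unity_root (int n * i)"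
  by (induction n) (simp_all add: unity_root_add distrib_right)

lemma unity_root_eq_1_iff: "unity_root i = 1 \<longleftrightarrow> [i = 0] (mod q)"
proof -
  have "unity_root (q * m) = 1" for m
    using q_pos cis_multiple_2pi[of "of_int m"] by (simp add: unity_root_def)
  then have mod: "unity_root i = unity_root (i mod q)"
    using unity_root_add[of "q * (i div q)" "i mod q"] by simp
  define k where "k = nat (i mod q)"
  have k: "i mod q = int k" "k < p ^ r" using q_pos by (simp_all add: k_def q_def nat_less_iff)
  have "bij_betw (\<lambda>k. cis (2 * pi * real k / real (p ^ r))) {..<p ^ r} {z. z ^ (p ^ r) = 1}"
    using prime_p by (intro bij_betw_roots_unity) (simp add: prime_gt_0_nat)
  then have inj: "inj_on (\<lambda>k. cis (2 * pi * real k / real (p ^ r))) {..<p ^ r}"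
    by (simp add: bij_betw_def)
  have "unity_root i = 1 \<longleftrightarrow> cis (2 * pi * real k / real (p ^ r)) = cis (2 * pi * real 0 / real (p ^ r))"
    unfolding mod k(1) by (simp add: unity_root_def q_def)
  also have "\<dots> \<longleftrightarrow> k = 0"
    using inj_on_eq_iff[OF inj, of k 0] k(2) prime_gt_0_nat[OF prime_p] by simp
  also have "\<dots> \<longleftrightarrow> [i = 0] (mod q)" using k(1) by (simp add: cong_def)
  finally show ?thesis .
qed

lemma unity_root_cong: "[i = j] (mod q) \<Longrightarrow> unity_root i = unity_root j"
  using unity_root_eq_1_iff[of "i - j"] unity_root_add[of "i - j" j] by (simp add: cong_diff_iff_cong_0)

text \<open>For \<open>H\<close> inside the group this is the usual centralizer, written as an
  orthogonal complement for \<open>b\<close>.\<close>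

definition centralizer :: "'a set \<Rightarrow> 'a set" where
  "centralizer H = {c \<in> carrier G. \<forall>h\<in>H. [b c h = 0] (mod q)}"

text \<open>The last conjunct is the invariant of the construction: once \<open>H\<close> is its own centralizer it
  reads $|G| |Z(G)| \le |H|^2$.\<close>

definition isotropic_ext :: "'a set \<Rightarrow> ('a \<Rightarrow> complex) \<Rightarrow> bool" where
  "isotropic_ext H \<phi> \<longleftrightarrow> subgroup H G \<and> center G \<subseteq> H \<and> H \<subseteq> centralizer H \<and>
    (\<forall>x\<in>H. \<forall>y\<in>H. \<phi> (x \<otimes> y) = \<phi> x * \<phi> y) \<and> (\<forall>i. \<phi> (tw i \<one>) = unity_root i) \<and>
    card (carrier G) * p ^ r \<le> card H * card (centralizer H)"

text \<open>The n-torsion modulo \<open>q\<close> embeds into \<open>{0..<n}\<close> by sending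
  \<open>v\<close> to the quotient of \<open>n * v\<close> by \<open>q\<close>.\<close>

lemma card_annihilator_le:
  fixes n :: nat
  assumes "n > 0"
  shows "card {v \<in> {0..<q}. q dvd int n * v} \<le> n"
proof -
  have "card {v \<in> {0..<q}. q dvd int n * v} \<le> card {0..<int n}"
  proof (rule card_inj_on_le[where f = "\<lambda>v. (int n * v) div q"])
    show "inj_on (\<lambda>v. (int n * v) div q) {v \<in> {0..<q}. q dvd int n * v}"
    proof (rule inj_onI)
      fix v w assume v: "v \<in> {v \<in> {0..<q}. q dvd int n * v}" and w: "w \<in> {v \<in> {0..<q}. q dvd int n * v}"
        and eq: "(int n * v) div q = (int n * w) div q"
      have "int n * v = ((int n * v) div q) * q" "int n * w = ((int n * w) div q) * q"
        using v w by simp_all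
      then have "int n * v = int n * w" using eq by simp
      then show "v = w" using assms by simp
    qed
    show "(\<lambda>v. (int n * v) div q) ` {v \<in> {0..<q}. q dvd int n * v} \<subseteq> {0..<int n}"
    proof (rule image_subsetI)
      fix v assume "v \<in> {v \<in> {0..<q}. q dvd int n * v}"
      then have v: "0 \<le> v" "v < q" by auto
      have "int n * v < int n * q" using v assms by simp
      moreover have "((int n * v) div q) * q = int n * v"
        using \<open>v \<in> {v \<in> {0..<q}. q dvd int n * v}\<close> by simp
      ultimately have "((int n * v) div q) * q < int n * q" by simp
      then have "(int n * v) div q < int n" using q_pos by (simp add: mult_less_cancel_right)
      moreover have "0 \<le> (int n * v) div q" using v q_pos by (simp add: pos_imp_zdiv_nonneg_iff)
      ultimately show "(int n * v) div q \<in> {0..<int n}" by simp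
    qed
  qed simp
  then show ?thesis by simp
qed

text \<open>The map from \<open>c\<close> to \<open>b c x\<close> is a homomorphism on the
  centralizer modulo \<open>q\<close>. Its values are killed by \<open>n\<close> because
  \<open>x [^] n\<close> lies in \<open>H\<close>, so at most \<open>n\<close> occur, and a largest
  fibre can be translated into the kernel by one of its elements.\<close>

lemma card_centralizer_insert:
  assumes H: "subgroup H G" and x: "x \<in> carrier G" and n: "n > 0" "x [^] (n::nat) \<in> H"
  shows "card (centralizer H) \<le> n * card {c \<in> centralizer H. [b c x = 0] (mod q)}"
proof -
  let ?B = "{v \<in> {0..<q}. q dvd int n * v}"
  have finC: "finite (centralizer H)" using fin by (simp add: centralizer_def)
  have finB: "finite ?B" by (rule finite_subset[of _ "{0..<q}"]) auto
  have "(\<lambda>c. b c x mod q) \<in> centralizer H \<rightarrow> ?B"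
  proof
    fix c assume c: "c \<in> centralizer H"
    have "[int n * b c x = b c (x [^] n)] (mod q)"
      using c x by (intro cong_sym[OF b_pow2]) (auto simp: centralizer_def)
    also have "[b c (x [^] n) = 0] (mod q)" using c n(2) by (simp add: centralizer_def)
    finally have "q dvd int n * b c x" by (simp add: cong_0_iff)
    then have "q dvd int n * (b c x mod q)"
      by (metis dvd_eq_mod_eq_0 mod_mult_right_eq)
    then show "b c x mod q \<in> ?B" using q_pos by simp
  qed
  moreover have "0 \<in> ?B" using q_pos by simp
  then have "?B \<noteq> {}" by blast
  ultimately obtain v where v: "card (centralizer H) \<le> card ((\<lambda>c. b c x mod q) -` {v} \<inter> centralizer H) * card ?B"
    using pigeonhole_card[OF _ finC finB, of "\<lambda>c. b c x mod q"] by blast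
  let ?K = "{c \<in> centralizer H. [b c x = 0] (mod q)}"
  have "card ((\<lambda>c. b c x mod q) -` {v} \<inter> centralizer H) \<le> card ?K"
  proof (cases "(\<lambda>c. b c x mod q) -` {v} \<inter> centralizer H = {}")
    case False
    then obtain c0 where c0: "c0 \<in> centralizer H" "b c0 x mod q = v" by auto
    then have c0c [simp]: "c0 \<in> carrier G" by (simp add: centralizer_def)
    have diff: "[b (c \<otimes> inv c0) h = b c h - b c0 h] (mod q)" if "c \<in> carrier G" "h \<in> carrier G" for c h
    proof -
      have "[b (c \<otimes> inv c0) h = b c h + b (inv c0) h] (mod q)" using that by (intro b_mult) auto
      also have "[b c h + b (inv c0) h = b c h + - b c0 h] (mod q)"
        using that by (intro cong_add cong_refl b_inv) auto
      finally show ?thesis by simp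
    qed
    show ?thesis
    proof (rule card_inj_on_le[where f = "\<lambda>c. c \<otimes> inv c0"])
      show "inj_on (\<lambda>c. c \<otimes> inv c0) ((\<lambda>c. b c x mod q) -` {v} \<inter> centralizer H)"
        by (auto simp: inj_on_def centralizer_def)
      show "finite ?K" using finC by simp
      show "(\<lambda>c. c \<otimes> inv c0) ` ((\<lambda>c. b c x mod q) -` {v} \<inter> centralizer H) \<subseteq> ?K"
      proof (rule image_subsetI)
        fix c assume c: "c \<in> (\<lambda>c. b c x mod q) -` {v} \<inter> centralizer H"
        then have cc: "c \<in> carrier G" by (simp add: centralizer_def)
        have "[b (c \<otimes> inv c0) h = 0] (mod q)" if h: "h \<in> H" for h
        proof -
          have hc: "h \<in> carrier G" using h H subgroup.mem_carrier by metis
          have "[b c h - b c0 h = 0 - 0] (mod q)"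
            using c c0 h by (intro cong_diff) (auto simp: centralizer_def)
          then show ?thesis using cong_trans[OF diff[OF cc hc]] by simp
        qed
        moreover have "[b (c \<otimes> inv c0) x = 0] (mod q)"
        proof -
          have "[b c x - b c0 x = 0] (mod q)"
            using c c0 by (simp add: cong_diff_iff_cong_0) (simp add: cong_def)
          then show ?thesis using cong_trans[OF diff[OF cc x]] by simp
        qed
        ultimately show "c \<otimes> inv c0 \<in> ?K" using cc by (simp add: centralizer_def)
      qed
    qed
  qed simp
  then have "card ((\<lambda>c. b c x mod q) -` {v} \<inter> centralizer H) * card ?B \<le> card ?K * n"
    using card_annihilator_le[OF n(1)] by (intro mult_le_mono)
  then show ?thesis using v by (simp add: mult.commute)
qed

text \<open>Adjoin \<open>x\<close>: if \<open>n\<close> is minimal with \<open>x [^] n \<in> H\<close>, then \<open>H\<close> grows by the factor \<open>n\<close>, its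
  centralizer shrinks by at most that factor, and an \<open>n\<close>-th root \<open>\<mu>\<close> of \<open>\<phi> (x [^] n)\<close> extends
  \<open>\<phi>\<close>.\<close>

lemma isotropic_ext_step:
  assumes H: "isotropic_ext H \<phi>" and x: "x \<in> centralizer H" "x \<notin> H"
  shows "\<exists>H' \<phi>'. isotropic_ext H' \<phi>' \<and> card H < card H'"
proof -
  have sub: "subgroup H G" and ZH: "center G \<subseteq> H" and Hiso: "H \<subseteq> centralizer H"
    and \<phi>_mult: "\<And>x y. x \<in> H \<Longrightarrow> y \<in> H \<Longrightarrow> \<phi> (x \<otimes> y) = \<phi> x * \<phi> y"
    and \<phi>_tw: "\<And>i. \<phi> (tw i \<one>) = unity_root i"
    and card_le: "card (carrier G) * p ^ r \<le> card H * card (centralizer H)"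
    using H unfolding isotropic_ext_def by blast+
  have Hc: "h \<in> carrier G" if "h \<in> H" for h using subgroup.mem_carrier[OF sub that] .
  have finH: "finite H" using finite_subset[OF subgroup.subset[OF sub] fin] .
  have xc [simp]: "x \<in> carrier G" and xb: "\<And>h. h \<in> H \<Longrightarrow> [b x h = 0] (mod q)"
    using x(1) by (auto simp: centralizer_def)
  have Hb: "[b h h' = 0] (mod q)" if "h \<in> H" "h' \<in> H" for h h'
    using Hiso that by (auto simp: centralizer_def)
  have comm: "y \<otimes> z = z \<otimes> y" if "y \<in> carrier G" "z \<in> carrier G" "[b y z = 0] (mod q)" for y z
    using b_eq[OF that(1,2)] tw_eq_iff[of "z \<otimes> y" "b y z" 0] that by simp
  have xh: "x \<otimes> h = h \<otimes> x" if "h \<in> H" for h using comm xb[OF that] Hc[OF that] by simp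
  have xnh: "x [^] (i::nat) \<otimes> h = h \<otimes> x [^] i" if "h \<in> H" for h i
    using group_commutes_pow[OF xh[OF that]] Hc[OF that] by simp
  have H1: "\<one> \<in> H" by (rule subgroup.one_closed[OF sub])
  have Hpow: "h [^] (i::nat) \<in> H" if "h \<in> H" for h i
    using that H1 by (induction i) (auto intro: subgroup.m_closed[OF sub])
  define M where "M = card (carrier G)"
  have M: "M > 0" "x [^] M = \<one>"
    using fin prime_p card_G pow_order_eq_1[OF xc] by (simp_all add: M_def prime_gt_0_nat Coset.order_def)
  define n where "n = (LEAST n. n > 0 \<and> x [^] (n::nat) \<in> H)"
  have n: "n > 0" "x [^] n \<in> H" and n_least: "\<And>m. m > 0 \<Longrightarrow> x [^] m \<in> H \<Longrightarrow> n \<le> m"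
    unfolding n_def using LeastI[of "\<lambda>n. n > 0 \<and> x [^] n \<in> H" M] M H1
    by (auto intro: Least_le)
  have pow_mem: "n dvd i" if "x [^] i \<in> H" for i :: nat
  proof -
    have "x [^] i = x [^] (i mod n) \<otimes> (x [^] n) [^] (i div n)"
      by (simp add: nat_pow_pow nat_pow_mult)
    then have "x [^] (i mod n) = x [^] i \<otimes> inv ((x [^] n) [^] (i div n))"
      by (simp add: m_assoc)
    also have "\<dots> \<in> H"
      using that Hpow[OF n(2)] by (intro subgroup.m_closed[OF sub] subgroup.m_inv_closed[OF sub])
    finally show ?thesis using n_least[of "i mod n"] n(1) by (meson dvd_eq_mod_eq_0 mod_less_divisor not_le zero_less_iff_neq_zero)
  qed
  have "\<phi> (x [^] n) * \<phi> (inv (x [^] n)) = \<phi> \<one>"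
    using \<phi>_mult[of "x [^] n" "inv (x [^] n)"] n(2) subgroup.m_inv_closed[OF sub] by simp
  moreover have "\<phi> \<one> = 1" using \<phi>_tw[of 0] by simp
  ultimately have \<phi>_nz: "\<phi> (x [^] n) \<noteq> 0" by auto
  have "card {z. z ^ n = \<phi> (x [^] n)} = n" using \<phi>_nz n(1) by (intro card_nth_roots)
  then have "{z. z ^ n = \<phi> (x [^] n)} \<noteq> {}" using n(1) by (metis card.empty less_irrefl)
  then obtain \<mu> where \<mu>: "\<mu> ^ n = \<phi> (x [^] n)" by blast
  have \<mu>_nz: "\<mu> \<noteq> 0" using \<mu> \<phi>_nz n(1) by (metis zero_power)
  have \<phi>_pow: "\<phi> ((x [^] n) [^] m) = \<mu> ^ (n * m)" for m
  proof (induction m)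
    case (Suc m)
    then show ?case using \<phi>_mult[OF Hpow[OF n(2)] n(2), of m] \<mu> by (simp add: power_add mult.commute)
  qed (simp add: \<open>\<phi> \<one> = 1\<close>)
  \<comment> \<open>Two expressions of one element as \<open>h \<otimes> x [^] i\<close> differ by a
    power of \<open>x [^] n\<close>. This gives both the consistency of the extended character and
    the count of \<open>H'\<close>.\<close>
  have cancel: "\<exists>m. i - j = n * m \<and> h' = h \<otimes> (x [^] n) [^] m"
    if "h \<in> H" "h' \<in> H" "h \<otimes> x [^] i = h' \<otimes> x [^] j" "j \<le> i" for h h' i j
  proof -
    have hc: "h \<in> carrier G" "h' \<in> carrier G" using that Hc by auto
    have "x [^] i = x [^] (i - j) \<otimes> x [^] j" using that(4) by (simp add: nat_pow_mult)
    then have "(h \<otimes> x [^] (i - j)) \<otimes> x [^] j = h' \<otimes> x [^] j" using that(3) hc by (simp add: m_assoc)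
    then have e: "h \<otimes> x [^] (i - j) = h'" using hc by simp
    then have "x [^] (i - j) = inv h \<otimes> h'" using hc by auto
    then have "x [^] (i - j) \<in> H"
      using that(1,2) by (simp add: subgroup.m_closed[OF sub] subgroup.m_inv_closed[OF sub])
    then have "n dvd (i - j)" by (rule pow_mem)
    then show ?thesis using e by (auto simp: nat_pow_pow elim!: dvdE)
  qed
  \<comment> \<open>The extension will take this value at \<open>h \<otimes> x [^] i\<close>; it
    does not depend on the expression chosen.\<close>
  have wd: "\<phi> h * \<mu> ^ i = \<phi> h' * \<mu> ^ j"
    if h: "h \<in> H" "h' \<in> H" "h \<otimes> x [^] i = h' \<otimes> x [^] j" "j \<le> i" for h h' i j
  proof -
    obtain m where m: "i - j = n * m" "h' = h \<otimes> (x [^] n) [^] m" using cancel[OF h] by blast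
    have "\<phi> h' = \<phi> h * \<mu> ^ (i - j)" using \<phi>_mult[OF h(1) Hpow[OF n(2)]] \<phi>_pow m by simp
    then show ?thesis using h(4) by (simp add: power_add[symmetric])
  qed
  have wd': "\<phi> h * \<mu> ^ i = \<phi> h' * \<mu> ^ j"
    if "h \<in> H" "h' \<in> H" "h \<otimes> x [^] i = h' \<otimes> x [^] j" for h h' i j
    using wd[of h h' i j] wd[of h' h j i] that by (cases "j \<le> i") auto
  \<comment> \<open>Natural exponents below the group order suffice since
    \<open>x [^] M = \<one>\<close>; the bound lets the inverse be written with the exponent
    \<open>M - i\<close>.\<close>
  define H' where "H' = {h \<otimes> x [^] i | h i. h \<in> H \<and> (i::nat) < M}"
  have H'I: "h \<otimes> x [^] (i::nat) \<in> H'" if "h \<in> H" for h i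
  proof -
    have "x [^] i = (x [^] M) [^] (i div M) \<otimes> x [^] (i mod M)"
      unfolding nat_pow_pow[OF xc] nat_pow_mult[OF xc] by simp
    then have "x [^] i = x [^] (i mod M)" by (simp add: M(2))
    then show ?thesis
      using that M(1) unfolding H'_def by (auto intro!: exI[of _ h] exI[of _ "i mod M"])
  qed
  define \<phi>' where "\<phi>' y = (SOME v. \<exists>h i. h \<in> H \<and> y = h \<otimes> x [^] (i::nat) \<and> v = \<phi> h * \<mu> ^ i)" for y
  have \<phi>': "\<phi>' (h \<otimes> x [^] i) = \<phi> h * \<mu> ^ i" if "h \<in> H" for h i
  proof -
    have "\<exists>h' j. h' \<in> H \<and> h \<otimes> x [^] i = h' \<otimes> x [^] (j::nat) \<and> \<phi>' (h \<otimes> x [^] i) = \<phi> h' * \<mu> ^ j"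
      unfolding \<phi>'_def by (rule someI_ex) (use that in blast)
    then show ?thesis using wd'[OF that] by metis
  qed
  have prod: "(h \<otimes> x [^] i) \<otimes> (h' \<otimes> x [^] j) = (h \<otimes> h') \<otimes> x [^] (i + j)"
    if "h \<in> H" "h' \<in> H" for h h' and i j :: nat
  proof -
    have hc: "h \<in> carrier G" "h' \<in> carrier G" using that Hc by auto
    have "(h \<otimes> x [^] i) \<otimes> (h' \<otimes> x [^] j) = h \<otimes> (x [^] i \<otimes> h') \<otimes> x [^] j"
      using hc by (simp add: m_assoc)
    also have "\<dots> = h \<otimes> (h' \<otimes> x [^] i) \<otimes> x [^] j" using that by (simp add: xnh)
    finally show ?thesis using hc by (simp add: m_assoc nat_pow_mult)
  qed
  have sub': "subgroup H' G"
  proof (rule subgroupI)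
    show "H' \<subseteq> carrier G" using Hc by (auto simp: H'_def)
    show "H' \<noteq> {}" using H'I[OF H1, of 0] by auto
    fix y assume "y \<in> H'"
    then obtain h i where y: "y = h \<otimes> x [^] i" "h \<in> H" "i < M" by (auto simp: H'_def)
    have hc: "h \<in> carrier G" using y(2) Hc by simp
    have ih: "inv h \<in> H" using y(2) by (rule subgroup.m_inv_closed[OF sub])
    have "(inv h \<otimes> x [^] (M - i)) \<otimes> (h \<otimes> x [^] i) = (inv h \<otimes> h) \<otimes> x [^] (M - i + i)"
      by (rule prod[OF ih y(2)])
    also have "\<dots> = \<one>" using y(3) hc M(2) by simp
    finally have "inv y = inv h \<otimes> x [^] (M - i)"
      unfolding y(1) using hc by (intro inv_equality) auto
    then show "inv y \<in> H'" using H'I[OF ih] by simp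
    fix z assume "z \<in> H'"
    then obtain h' j where z: "z = h' \<otimes> x [^] (j::nat)" "h' \<in> H" unfolding H'_def by blast
    show "y \<otimes> z \<in> H'"
      unfolding y(1) z(1) prod[OF y(2) z(2)] using y(2) z(2) by (intro H'I subgroup.m_closed[OF sub])
  qed
  have \<phi>'_mult: "\<phi>' (y \<otimes> z) = \<phi>' y * \<phi>' z" if "y \<in> H'" "z \<in> H'" for y z
  proof -
    obtain h i h' j where y: "y = h \<otimes> x [^] (i::nat)" "h \<in> H" and z: "z = h' \<otimes> x [^] (j::nat)" "h' \<in> H"
      using \<open>y \<in> H'\<close> \<open>z \<in> H'\<close> by (auto simp: H'_def)
    show ?thesis
      unfolding y(1) z(1) prod[OF y(2) z(2)]
      using y(2) z(2) \<phi>_mult[OF y(2) z(2)] by (simp add: \<phi>' subgroup.m_closed[OF sub] power_add)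
  qed
  have HH': "H \<subseteq> H'" using H'I[of _ 0] Hc by fastforce
  have \<phi>'_H: "\<phi>' h = \<phi> h" if "h \<in> H" for h using \<phi>'[OF that, of 0] Hc[OF that] by simp
  have tw_H: "tw i \<one> \<in> H" for i using ZH mem_center_iff by blast
  have cent: "centralizer H' = {c \<in> centralizer H. [b c x = 0] (mod q)}"
  proof (intro equalityI subsetI)
    fix c assume c: "c \<in> centralizer H'"
    have "x \<in> H'" using H'I[OF H1, of 1] by simp
    then show "c \<in> {c \<in> centralizer H. [b c x = 0] (mod q)}" using c HH' by (auto simp: centralizer_def)
  next
    fix c assume c: "c \<in> {c \<in> centralizer H. [b c x = 0] (mod q)}"
    then have cc: "c \<in> carrier G" by (simp add: centralizer_def)
    have "[b c (h \<otimes> x [^] i) = 0] (mod q)" if "h \<in> H" for h and i :: nat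
    proof -
      have "[b c (h \<otimes> x [^] i) = b c h + b c (x [^] i)] (mod q)" using cc Hc[OF that] by (intro b_mult2) auto
      also have "[b c h + b c (x [^] i) = 0 + int i * b c x] (mod q)"
        using c cc that by (intro cong_add b_pow2) (auto simp: centralizer_def)
      also have "[0 + int i * b c x = 0 + int i * 0] (mod q)"
        using c by (intro cong_add cong_mult cong_refl) auto
      finally show ?thesis by simp
    qed
    then show "c \<in> centralizer H'" using cc by (auto simp: centralizer_def H'_def)
  qed
  have "H' \<subseteq> centralizer H'"
  proof
    fix y assume "y \<in> H'"
    then obtain h i where y: "y = h \<otimes> x [^] (i::nat)" "h \<in> H" by (auto simp: H'_def)
    have hc: "h \<in> carrier G" using y Hc by simp
    have "[b y z = 0] (mod q)" if z: "z \<in> carrier G" "[b h z = 0] (mod q)" "[b x z = 0] (mod q)" for z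
    proof -
      have "[b y z = b h z + b (x [^] i) z] (mod q)" unfolding y(1) using hc z by (intro b_mult) auto
      also have "[b h z + b (x [^] i) z = 0 + int i * b x z] (mod q)" using z by (intro cong_add b_pow) auto
      also have "[0 + int i * b x z = 0 + int i * 0] (mod q)" using z by (intro cong_add cong_mult cong_refl)
      finally show ?thesis by simp
    qed
    note * = this
    have "[b h x = 0] (mod q)"
      using cong_trans[OF b_skew[OF hc xc], of 0] xb[OF y(2)] by (simp add: cong_0_iff)
    then have "[b y x = 0] (mod q)" using b_alt by (intro *) auto
    moreover have "[b y h' = 0] (mod q)" if "h' \<in> H" for h' using that Hb y(2) xb Hc by (intro *) auto
    moreover have "y \<in> carrier G" using y hc by simp
    ultimately show "y \<in> centralizer H'" unfolding cent by (simp add: centralizer_def)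
  qed
  have cardH': "card H' \<ge> n * card H"
  proof -
    have "card ({..<n} \<times> H) \<le> card H'"
    proof (rule card_inj_on_le[where f = "\<lambda>(i, h). h \<otimes> x [^] i"])
      show "finite H'" using finite_subset[OF subgroup.subset[OF sub'] fin] .
      show "(\<lambda>(i, h). h \<otimes> x [^] i) ` ({..<n} \<times> H) \<subseteq> H'" using H'I by auto
      have *: "i = j \<and> h = h'"
        if h: "h \<in> H" "h' \<in> H" "h \<otimes> x [^] i = h' \<otimes> x [^] j" "j \<le> i" and i: "i < n" for h h' i j
      proof -
        obtain m where m: "i - j = n * m" "h' = h \<otimes> (x [^] n) [^] m" using cancel[OF h] by blast
        have "n * m < n * 1" using m(1) i by linarith
        then have "m = 0" by simp
        then show ?thesis using m h(4) Hc[OF h(1)] by simp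
      qed
      show "inj_on (\<lambda>(i, h). h \<otimes> x [^] i) ({..<n} \<times> H)"
      proof (rule inj_onI)
        fix a c assume ac: "a \<in> {..<n} \<times> H" "c \<in> {..<n} \<times> H" "(case a of (i, h) \<Rightarrow> h \<otimes> x [^] i) = (case c of (i, h) \<Rightarrow> h \<otimes> x [^] i)"
        obtain i h j h' where a: "a = (i, h)" and c: "c = (j, h')" by fastforce
        show "a = c" using ac *[of h h' i j] *[of h' h j i] unfolding a c by (cases "j \<le> i") auto
      qed
    qed
    then show ?thesis by (simp add: card_cartesian_product)
  qed
  have "x \<in> H'" using H'I[OF H1, of 1] by simp
  then have "H \<subset> H'" using x(2) HH' by blast
  then have "card H < card H'"
    using finite_subset[OF subgroup.subset[OF sub'] fin] by (rule psubset_card_mono[rotated])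
  moreover have "card (carrier G) * p ^ r \<le> card H' * card (centralizer H')"
  proof -
    have "card H * card (centralizer H) \<le> card H * (n * card (centralizer H'))"
      using card_centralizer_insert[OF sub xc n] unfolding cent by simp
    also have "\<dots> = (n * card H) * card (centralizer H')" by simp
    also have "\<dots> \<le> card H' * card (centralizer H')" using cardH' by (intro mult_le_mono) auto
    finally show ?thesis using card_le by simp
  qed
  ultimately show ?thesis
    unfolding isotropic_ext_def
    using sub' ZH HH' \<open>H' \<subseteq> centralizer H'\<close> \<phi>'_mult \<phi>'_H[OF tw_H] \<phi>_tw
    by (intro exI[of _ H'] exI[of _ \<phi>'] conjI) auto
qed

text \<open>The start of the construction: everything centralizes the center, and the powers of
  \<open>\<zeta>\<close> already provide \<open>p ^ r\<close> central elements for the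
  invariant.\<close>

lemma isotropic_ext_center: "\<exists>\<phi>. isotropic_ext (center G) \<phi>"
proof -
  define \<phi> where "\<phi> z = unity_root (SOME i. z = tw i \<one>)" for z
  have \<phi>: "\<phi> (tw i \<one>) = unity_root i" for i
  proof -
    have "tw i \<one> = tw (SOME j. tw i \<one> = tw j \<one>) \<one>" by (rule someI[of _ i]) simp
    then have "[i = (SOME j. tw i \<one> = tw j \<one>)] (mod q)" by (subst (asm) tw_eq_iff) auto
    from unity_root_cong[OF this] show ?thesis unfolding \<phi>_def by (rule sym)
  qed
  have mem: "tw i \<one> \<in> center G" for i using mem_center_iff by blast
  have sub: "subgroup (center G) G"
  proof (rule subgroupI)
    show "center G \<subseteq> carrier G" by (auto simp: center_def)
    show "center G \<noteq> {}" using mem by blast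
    fix a assume "a \<in> center G"
    then obtain i where i: "a = tw i \<one>" using mem_center_iff by blast
    show "inv a \<in> center G" unfolding i using mem by simp
    fix c assume "c \<in> center G"
    then obtain j where j: "c = tw j \<one>" using mem_center_iff by blast
    show "a \<otimes> c \<in> center G" unfolding i j using mem by simp
  qed
  have b_center: "[b c h = 0] (mod q)" if "c \<in> carrier G" "h \<in> center G" for c h
    using that by (intro b_unique) (auto simp: center_def)
  have cent: "centralizer (center G) = carrier G"
    using b_center by (auto simp: centralizer_def)
  have "card {0..<q} \<le> card (center G)"
  proof (rule card_inj_on_le[where f = "\<lambda>i. tw i \<one>"])
    show "inj_on (\<lambda>i. tw i \<one>) {0..<q}"
      by (auto simp: inj_on_def cong_def)
    show "finite (center G)" using fin by (simp add: center_def)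
  qed (use mem in auto)
  then have "p ^ r \<le> card (center G)" by (simp add: q_def nat_int del: of_nat_power)
  then have "card (carrier G) * p ^ r \<le> card (center G) * card (centralizer (center G))"
    unfolding cent by (simp add: mult.commute)
  moreover have "\<phi> (x \<otimes> y) = \<phi> x * \<phi> y" if "x \<in> center G" "y \<in> center G" for x y
  proof -
    obtain i where "x = tw i \<one>" using \<open>x \<in> center G\<close> mem_center_iff by blast
    moreover obtain j where "y = tw j \<one>" using \<open>y \<in> center G\<close> mem_center_iff by blast
    ultimately show ?thesis by (simp add: \<phi> unity_root_add)
  qed
  moreover have "center G \<subseteq> centralizer (center G)" unfolding cent by (auto simp: center_def)
  ultimately have "isotropic_ext (center G) \<phi>"
    unfolding isotropic_ext_def using sub \<phi> by (intro conjI ballI allI) simp_all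
  then show ?thesis by (rule exI[of _ \<phi>])
qed

text \<open>In an isotropic extension of largest order nothing outside \<open>L\<close> can
  centralize \<open>L\<close>, as \<open>isotropic_ext_step\<close> would adjoin it.\<close>

lemma lagrangian_exists:
  obtains L \<phi> where "isotropic_ext L \<phi>" "centralizer L = L"
proof -
  define P where "P m \<longleftrightarrow> (\<exists>L \<phi>. isotropic_ext L \<phi> \<and> card L = m)" for m
  obtain \<phi>\<^sub>0 where "isotropic_ext (center G) \<phi>\<^sub>0" using isotropic_ext_center by blast
  then have "P (card (center G))" unfolding P_def by blast
  moreover have bound: "m \<le> card (carrier G)" if m: "P m" for m
  proof -
    obtain L \<phi> where L: "isotropic_ext L \<phi>" "card L = m" using m unfolding P_def by blast
    then have "subgroup L G" by (simp add: isotropic_ext_def)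
    then have "card L \<le> card (carrier G)" using card_mono[OF fin subgroup.subset] by blast
    then show ?thesis using L(2) by simp
  qed
  ultimately obtain m where m: "P m" "\<And>m'. P m' \<Longrightarrow> m' \<le> m"
    using Greatest_le_nat[of P _ "card (carrier G)"] GreatestI_nat[of P _ "card (carrier G)"] by blast
  then obtain L \<phi> where L: "isotropic_ext L \<phi>" "card L = m" unfolding P_def by blast
  have "centralizer L \<subseteq> L"
  proof
    fix x assume x: "x \<in> centralizer L"
    show "x \<in> L"
    proof (rule ccontr)
      assume "x \<notin> L"
      from isotropic_ext_step[OF L(1) x this] obtain L' \<phi>' where "isotropic_ext L' \<phi>'" "card L < card L'"
        by blast
      then have "P (card L')" "m < card L'" unfolding P_def using L(2) by auto
      then show False using m(2) by fastforce
    qed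
  qed
  moreover have "L \<subseteq> centralizer L" using L(1) by (simp add: isotropic_ext_def)
  ultimately show ?thesis using that L(1) by blast
qed

text \<open>The character is induced from the \<open>u\<close>-th power of \<open>\<phi>\<close>.
  Conjugating \<open>l\<close> by \<open>g\<close> multiplies \<open>\<phi> l\<close> by
  \<open>unity_root (b l g)\<close>, which for \<open>g\<close> outside
  \<open>L = centralizer L\<close> is nontrivial for some \<open>l\<close>, even after taking
  \<open>u\<close>-th powers; this gives irreducibility. The value is zero off the normal subgroup
  \<open>L\<close>. At a noncentral element of \<open>L\<close> it contains the sum over the group
  of a nontrivial linear character, which is zero as well.\<close>

lemma lagrangian_character:
  assumes L: "isotropic_ext L \<phi>" "centralizer L = L" and u: "coprime u p"
  shows "\<exists>\<chi>\<in>irreducible_characters G.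
    (\<forall>i. \<chi> (tw i \<one>) = of_nat (card (carrier G)) / of_nat (card L) * unity_root (int u * i)) \<and>
    (\<forall>g\<in>carrier G - center G. \<chi> g = 0)"
proof -
  have sub: "subgroup L G" and ZL: "center G \<subseteq> L"
    and \<phi>_mult: "\<And>x y. x \<in> L \<Longrightarrow> y \<in> L \<Longrightarrow> \<phi> (x \<otimes> y) = \<phi> x * \<phi> y"
    and \<phi>_tw: "\<And>i. \<phi> (tw i \<one>) = unity_root i"
    using L unfolding isotropic_ext_def by blast+
  have Lc [simp]: "l \<in> carrier G" if "l \<in> L" for l using subgroup.mem_carrier[OF sub that] .
  have tw_L: "tw i \<one> \<in> L" for i using ZL mem_center_iff by blast
  have tw_split: "tw i l = tw i \<one> \<otimes> l" if "l \<in> carrier G" for i l using that by simp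
  have tw_mem: "tw i l \<in> L" if "l \<in> L" for i l
    using subgroup.m_closed[OF sub tw_L that] tw_split[OF Lc[OF that]] by simp
  have tw_mem_iff: "tw i g \<in> L \<longleftrightarrow> g \<in> L" if "g \<in> carrier G" for i g
    using tw_mem[of g i] tw_mem[of "tw i g" "- i"] that by auto
  have \<phi>_tw': "\<phi> (tw i l) = unity_root i * \<phi> l" if "l \<in> L" for i l
    using \<phi>_mult[OF tw_L that] tw_split[OF Lc[OF that]] \<phi>_tw by simp
  have \<phi>_nz: "\<phi> l \<noteq> 0" if "l \<in> L" for l
  proof -
    have "\<phi> l * \<phi> (inv l) = \<phi> (tw 0 \<one>)"
      using \<phi>_mult[OF that subgroup.m_inv_closed[OF sub that]] that by simp
    also have "\<dots> = 1" unfolding \<phi>_tw by simp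
    finally show ?thesis by auto
  qed
  have conj: "inv g \<otimes> l \<otimes> g = tw (b l g) l" if "l \<in> carrier G" "g \<in> carrier G" for l g
  proof -
    have "inv g \<otimes> l \<otimes> g = inv g \<otimes> (l \<otimes> g)" using that by (simp add: m_assoc)
    also have "l \<otimes> g = tw (b l g) (g \<otimes> l)" by (intro b_eq that)
    finally show ?thesis using that by simp
  qed
  have normal: "L \<lhd> G"
    unfolding normal_inv_iff
  proof (intro conjI ballI sub)
    fix x l assume x: "x \<in> carrier G" "l \<in> L"
    then show "x \<otimes> l \<otimes> inv x \<in> L"
      using conj[of l "inv x"] tw_mem by simp
  qed
  have \<phi>_1: "\<phi> \<one> = 1" using \<phi>_tw[of 0] by simp
  interpret M: monomial_induction G L "\<lambda>x. \<phi> x ^ u"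
    by (intro monomial_induction.intro monomial_induction_axioms.intro is_group fin normal)
      (simp_all only: \<phi>_mult \<phi>_1 power_mult_distrib power_one)
  have root_u: "unity_root i ^ u = 1 \<longleftrightarrow> [i = 0] (mod q)" for i
  proof -
    have "coprime q (int u)" using u by (simp add: q_def coprime_commute)
    then have "q dvd int u * i \<longleftrightarrow> q dvd i" by (rule coprime_dvd_mult_right_iff)
    then show ?thesis unfolding unity_root_power unity_root_eq_1_iff by (simp add: cong_0_iff)
  qed
  define \<chi> where "\<chi> = (\<lambda>g\<in>carrier G. (\<Sum>x\<in>carrier G. M.\<nu> (inv x \<otimes> g \<otimes> x)) / of_nat (card L))"
  have irr: "\<chi> \<in> irreducible_characters G"
    unfolding \<chi>_def
  proof (rule M.induced_irreducible_character)
    fix g assume g: "g \<in> carrier G" "g \<notin> L"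
    then have "g \<notin> centralizer L" using L(2) by simp
    then obtain l where l: "l \<in> L" "\<not> [b g l = 0] (mod q)" using g(1) by (auto simp: centralizer_def)
    have skew: "[b g l = - b l g] (mod q)" using l(1) g(1) by (intro b_skew) auto
    have "\<not> [b l g = 0] (mod q)"
    proof
      assume "[b l g = 0] (mod q)"
      then have "[- b l g = 0] (mod q)" by (simp add: cong_0_iff)
      from cong_trans[OF skew this] show False using l(2) by simp
    qed
    then have "unity_root (b l g) ^ u \<noteq> 1" using root_u by simp
    then have "\<phi> (inv g \<otimes> l \<otimes> g) ^ u \<noteq> \<phi> l ^ u"
      using l(1) g(1) \<phi>_nz[OF l(1)] by (simp add: conj \<phi>_tw' power_mult_distrib)
    then show "\<exists>l\<in>L. \<phi> (inv g \<otimes> l \<otimes> g) ^ u \<noteq> \<phi> l ^ u" using l(1) by blast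
  qed
  have \<nu>: "M.\<nu> (inv x \<otimes> g \<otimes> x) = (if g \<in> L then unity_root (b g x) ^ u * \<phi> g ^ u else 0)"
    if "x \<in> carrier G" "g \<in> carrier G" for x g
    using that tw_mem_iff[OF that(2)] unfolding M.\<nu>_def conj[OF that(2,1)]
    by (simp add: \<phi>_tw' power_mult_distrib)
  have val_center: "\<chi> (tw i \<one>) = of_nat (card (carrier G)) / of_nat (card L) * unity_root (int u * i)" for i
  proof -
    have "[b (tw i \<one>) x = 0] (mod q)" if "x \<in> carrier G" for x
      using that by (intro b_unique) auto
    then have "M.\<nu> (inv x \<otimes> tw i \<one> \<otimes> x) = unity_root (int u * i)" if "x \<in> carrier G" for x
      using that \<nu>[OF that, of "tw i \<one>"] tw_L[of i] root_u[of "b (tw i \<one>) x"]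
      by (simp add: \<phi>_tw unity_root_power)
    then show ?thesis by (simp add: \<chi>_def)
  qed
  have val_0: "\<chi> g = 0" if g: "g \<in> carrier G - center G" for g
  proof (cases "g \<in> L")
    case True
    have gc: "g \<in> carrier G" using g by simp
    obtain y where y: "y \<in> carrier G" "g \<otimes> y \<noteq> y \<otimes> g" using g by (auto simp: center_def)
    then have "\<not> [b g y = 0] (mod q)"
      using b_eq[OF gc y(1)] tw_eq_iff[of "y \<otimes> g" "b g y" 0] gc by auto
    then have ne: "unity_root (b g y) ^ u \<noteq> 1" using root_u by simp
    let ?S = "\<Sum>x\<in>carrier G. unity_root (b g x) ^ u"
    have "?S = (\<Sum>x\<in>carrier G. unity_root (b g (x \<otimes> y)) ^ u)"
    proof (rule sum.reindex_bij_witness[of _ "\<lambda>x. x \<otimes> y" "\<lambda>x. x \<otimes> inv y"])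
    qed (use y(1) in \<open>auto simp: m_assoc\<close>)
    also have "\<dots> = (\<Sum>x\<in>carrier G. unity_root (b g x) ^ u * unity_root (b g y) ^ u)"
    proof (intro sum.cong refl)
      fix x assume x: "x \<in> carrier G"
      have "unity_root (b g (x \<otimes> y)) = unity_root (b g x + b g y)"
        using x y(1) gc by (intro unity_root_cong b_mult2)
      then show "unity_root (b g (x \<otimes> y)) ^ u = unity_root (b g x) ^ u * unity_root (b g y) ^ u"
        by (simp add: unity_root_add power_mult_distrib)
    qed
    also have "\<dots> = ?S * unity_root (b g y) ^ u" by (simp add: sum_distrib_right)
    finally have "?S * (1 - unity_root (b g y) ^ u) = 0" by (simp add: right_diff_distrib)
    then have "?S = 0" using ne by simp
    then have "(\<Sum>x\<in>carrier G. M.\<nu> (inv x \<otimes> g \<otimes> x)) = 0"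
      using gc True \<nu> by (simp add: sum_distrib_right[symmetric])
    then show ?thesis using gc by (simp add: \<chi>_def)
  next
    case False
    then show ?thesis using g \<nu> by (simp add: \<chi>_def)
  qed
  show ?thesis using irr val_center val_0 by blast
qed

section \<open>Sums of roots of unity\<close>

lemma sum_powers_of_root:
  fixes z :: complex and n :: nat
  assumes "z ^ n = 1"
  shows "(\<Sum>j<n. z ^ j) = (if z = 1 then of_nat n else 0)"
  using assms geometric_sum[of z n] by auto

text \<open>A Ramanujan sum of prime power modulus: the sum over all residues minus the sum over the
  multiples of \<open>p\<close>, both of them geometric.\<close>

lemma sum_coprime_roots:
  "(\<Sum>u | u < p ^ r \<and> coprime u p. unity_root (int u * i)) =
    (if [i = 0] (mod q) then of_nat (p ^ r) else 0) -
    (if [i = 0] (mod int (p ^ (r - 1))) then of_nat (p ^ (r - 1)) else 0)"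
proof -
  have pr: "p ^ r = p * p ^ (r - 1)" using r_pos by (cases r) auto
  have qp: "q = int p * int (p ^ (r - 1))" by (simp add: q_def pr)
  have p0: "p > 0" using prime_p by (rule prime_gt_0_nat)
  have A: "{..<p ^ r} = {u. u < p ^ r \<and> coprime u p} \<union> (\<lambda>j. p * j) ` {..<p ^ (r - 1)}"
  proof (intro equalityI subsetI)
    fix u assume u: "u \<in> {..<p ^ r}"
    show "u \<in> {u. u < p ^ r \<and> coprime u p} \<union> (\<lambda>j. p * j) ` {..<p ^ (r - 1)}"
    proof (cases "coprime u p")
      case False
      then have "p dvd u" using prime_p by (metis coprime_commute prime_imp_coprime)
      then obtain j where "u = p * j" by (elim dvdE)
      then show ?thesis using u p0 unfolding pr by auto
    qed (use u in auto)
  qed (use p0 in \<open>auto simp: pr\<close>)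
  have disj: "{u. u < p ^ r \<and> coprime u p} \<inter> (\<lambda>j. p * j) ` {..<p ^ (r - 1)} = {}"
    using prime_p by (auto simp: prime_nat_iff)
  have "(\<Sum>u<p ^ r. unity_root (int u * i)) =
      (\<Sum>u | u < p ^ r \<and> coprime u p. unity_root (int u * i)) +
      (\<Sum>u\<in>(\<lambda>j. p * j) ` {..<p ^ (r - 1)}. unity_root (int u * i))"
    unfolding A using disj by (intro sum.union_disjoint) auto
  also have "(\<Sum>u\<in>(\<lambda>j. p * j) ` {..<p ^ (r - 1)}. unity_root (int u * i)) =
      (\<Sum>j<p ^ (r - 1). unity_root (int p * i) ^ j)"
    using p0 by (subst sum.reindex) (auto simp: inj_on_def unity_root_power algebra_simps)
  also have "\<dots> = (if [i = 0] (mod int (p ^ (r - 1))) then of_nat (p ^ (r - 1)) else 0)"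
  proof -
    have "unity_root (int p * i) ^ (p ^ (r - 1)) = 1"
      unfolding unity_root_power unity_root_eq_1_iff qp by (simp add: cong_0_iff mult.left_commute)
    moreover have "unity_root (int p * i) = 1 \<longleftrightarrow> [i = 0] (mod int (p ^ (r - 1)))"
      unfolding unity_root_eq_1_iff qp using p0 by (simp add: cong_0_iff)
    ultimately show ?thesis using sum_powers_of_root by simp
  qed
  also have "(\<Sum>u<p ^ r. unity_root (int u * i)) = (if [i = 0] (mod q) then of_nat (p ^ r) else 0)"
  proof -
    have "unity_root i ^ (p ^ r) = 1"
      unfolding unity_root_power unity_root_eq_1_iff q_def by (simp add: cong_0_iff)
    then show ?thesis
      using sum_powers_of_root[of "unity_root i" "p ^ r"] by (simp add: unity_root_power unity_root_eq_1_iff)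
  qed
  finally show ?thesis by simp
qed

section \<open>The case of a cyclic center\<close>

text \<open>\<open>\<zeta> [^] socle\<close> generates the subgroup of order \<open>p\<close> of the center.\<close>

definition socle :: int where
  "socle = int (p ^ (r - 1))"

lemma p_power_r: "p ^ r = p * p ^ (r - 1)"
  using r_pos by (metis Suc_pred' power_Suc)

lemma q_socle: "q = int p * socle"
  unfolding q_def socle_def p_power_r by simp

lemma socle_pos: "socle > 0"
  using prime_gt_0_nat[OF prime_p] by (simp add: socle_def)

lemma unit_representative:
  fixes v :: int
  assumes "\<not> int p dvd v"
  obtains u :: nat where "coprime u p" "[int u = v] (mod q)"
proof -
  define u where "u = nat (v mod q)"
  have u: "int u = v mod q" using q_pos by (simp add: u_def)
  have cong: "[int u = v] (mod q)" unfolding u by (simp add: cong_def)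
  have "\<not> p dvd u"
  proof
    assume "p dvd u"
    then have "int p dvd v mod q" unfolding u[symmetric] by simp
    moreover have "int p dvd q" unfolding q_socle by simp
    ultimately show False using assms by (simp add: dvd_mod_iff)
  qed
  then have "coprime u p" using prime_p by (metis coprime_commute prime_imp_coprime)
  then show ?thesis using that cong by blast
qed

text \<open>The function \<open>h\<close> will count the tuples at which the word takes the value
  \<open>\<zeta> [^] i\<close>.\<close>

context
  fixes h :: "int \<Rightarrow> int"
  assumes h_cong: "\<And>i j. [i = j] (mod q) \<Longrightarrow> h i = h j"
    and h_unit: "\<And>i u. coprime u p \<Longrightarrow> h (int u * i) = h i"
begin

lemma unit_invariant:
  assumes "\<not> int p dvd v"
  shows "h (v * i) = h i"
proof -
  obtain u where u: "coprime u p" "[int u = v] (mod q)" by (rule unit_representative[OF assms])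
  have "h (v * i) = h (int u * i)" using u(2) by (intro h_cong cong_scalar_right) (rule cong_sym)
  then show ?thesis using h_unit[OF u(1)] by simp
qed

text \<open>Here \<open>i\<close> has p-adic valuation \<open>a\<close> below \<open>r - 1\<close>,
  and adding multiples of \<open>socle\<close> preserves it. Both arguments are therefore
  \<open>p ^ a\<close> times a number prime to \<open>p\<close>.\<close>

lemma off_socle_invariant:
  assumes "\<not> socle dvd i"
  shows "h (i + j * socle) = h i"
proof -
  have i: "i \<noteq> 0" using assms by auto
  have nu: "\<not> is_unit (int p)" using prime_p prime_gt_1_nat[OF prime_p] by simp
  obtain v where v: "i = int p ^ multiplicity (int p) i * v" "\<not> int p dvd v"
    using multiplicity_decompose'[OF i nu] by metis
  define a where "a = multiplicity (int p) i"
  have a: "a < r - 1"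
  proof (rule ccontr)
    assume "\<not> a < r - 1"
    then have "int p ^ (r - 1) dvd int p ^ a" by (intro le_imp_power_dvd) simp
    moreover have "int p ^ a dvd i" using v(1) unfolding a_def by (metis dvd_triv_left)
    ultimately show False using assms dvd_trans unfolding socle_def of_nat_power by blast
  qed
  have soc: "socle = int p ^ a * int p ^ (r - 1 - a)"
    using a by (simp add: socle_def flip: power_add)
  have "i + j * socle = (v + j * int p ^ (r - 1 - a)) * int p ^ a"
    unfolding soc using v(1) by (simp add: a_def algebra_simps)
  moreover have "\<not> int p dvd v + j * int p ^ (r - 1 - a)"
  proof -
    have "int p dvd int p ^ (r - 1 - a)" using a by (intro dvd_power disjI1) linarith
    then have "int p dvd j * int p ^ (r - 1 - a)" by (rule dvd_mult)
    then show ?thesis using v(2) dvd_add_left_iff by blast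
  qed
  ultimately have "h (i + j * socle) = h (int p ^ a)" using unit_invariant by simp
  moreover have "h i = h (int p ^ a)"
    using unit_invariant[OF v(2), of "int p ^ a"] v(1) by (simp add: a_def mult.commute)
  ultimately show ?thesis by simp
qed

text \<open>Off the multiples of \<open>socle\<close> both sides vanish. On them \<open>h\<close>
  takes only the values \<open>h 0\<close>, at multiples of \<open>q\<close>, and
  \<open>h socle\<close>, and exactly one of the \<open>p\<close> translates of \<open>i\<close> is
  a multiple of \<open>q\<close>.\<close>

lemma socle_average:
  "int p * h i - (\<Sum>j<p. h (i + int j * socle)) =
    (h 0 - h socle) * (int p * of_bool [i = 0] (mod q) - of_bool [i = 0] (mod socle))"
proof (cases "socle dvd i")
  case False
  then have "\<not> q dvd i" unfolding q_socle using dvd_mult_right by blast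
  then show ?thesis using False off_socle_invariant[OF False] by (simp add: cong_0_iff)
next
  case True
  then obtain i' where i': "i = socle * i'" by (elim dvdE)
  have val: "h (socle * v) = h socle + (h 0 - h socle) * of_bool (int p dvd v)" for v
  proof (cases "int p dvd v")
    case True
    then have "[socle * v = 0] (mod q)" unfolding q_socle by (simp add: cong_0_iff)
    from h_cong[OF this] show ?thesis using True by simp
  next
    case False
    then show ?thesis using unit_invariant[OF False, of socle] by (simp add: mult.commute)
  qed
  have p0: "p > 0" by (rule prime_gt_0_nat[OF prime_p])
  have one: "(\<Sum>j<p. of_bool (int p dvd i' + int j)) = (1 :: int)"
  proof -
    define j0 where "j0 = nat ((- i') mod int p)"
    have j0: "j0 < p" "int j0 = (- i') mod int p" using p0 by (simp_all add: j0_def nat_less_iff)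
    have "int p dvd i' + int j \<longleftrightarrow> j = j0" if "j < p" for j
    proof -
      have "int p dvd i' + int j \<longleftrightarrow> [int j = - i'] (mod int p)"
        by (simp add: cong_iff_dvd_diff add.commute)
      also have "\<dots> \<longleftrightarrow> int j = int j0" using that j0(2) by (simp add: cong_def)
      finally show ?thesis by simp
    qed
    then have "(\<Sum>j<p. of_bool (int p dvd i' + int j)) = (\<Sum>j<p. if j = j0 then 1 else 0 :: int)"
      by (intro sum.cong) auto
    then show ?thesis using j0(1) by simp
  qed
  have "(\<Sum>j<p. h (i + int j * socle)) = (\<Sum>j<p. h (socle * (i' + int j)))"
    by (simp add: i' algebra_simps)
  also have "\<dots> = int p * h socle + (h 0 - h socle)"
    unfolding val by (simp only: sum.distrib sum_distrib_left[symmetric] one) simp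
  finally have sum: "(\<Sum>j<p. h (i + int j * socle)) = int p * h socle + (h 0 - h socle)" .
  have "[i = 0] (mod q) \<longleftrightarrow> int p dvd i'"
    unfolding i' q_socle cong_0_iff using socle_pos by (simp add: mult.commute)
  moreover have "[i = 0] (mod socle)" using True by (simp add: cong_0_iff)
  moreover have "h i = h socle + (h 0 - h socle) * of_bool (int p dvd i')"
    using val[of i'] unfolding i' .
  ultimately show ?thesis
    unfolding sum by (cases "int p dvd i'") (simp_all add: algebra_simps)
qed

end

lemma tw_mem_center: "x \<in> carrier G \<Longrightarrow> tw i x \<in> center G \<longleftrightarrow> x \<in> center G"
proof -
  have *: "tw j y \<in> center G" if "y \<in> center G" for j y
  proof -
    obtain m where "y = tw m \<one>" using \<open>y \<in> center G\<close> mem_center_iff by blast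
    then have "tw j y = tw (j + m) \<one>" by simp
    then show ?thesis using mem_center_iff by blast
  qed
  show "x \<in> carrier G \<Longrightarrow> tw i x \<in> center G \<longleftrightarrow> x \<in> center G"
    using *[of x i] *[of "tw i x" "- i"] by auto
qed

text \<open>All orders are powers of \<open>p\<close>, so the inequality kept in
  \<open>isotropic_ext\<close> turns into a divisibility after cancelling one factor
  \<open>card L\<close>.\<close>

lemma lagrangian_index_dvd:
  assumes "isotropic_ext L \<phi>" "centralizer L = L"
  obtains M where "card (carrier G) = M * card L" "M * p ^ r dvd card L"
proof -
  have sub: "subgroup L G" and le: "card (carrier G) * p ^ r \<le> card L * card L"
    using assms unfolding isotropic_ext_def by auto
  have lag: "card (rcosets L) * card L = card (carrier G)"
    using lagrange[OF sub] by (simp add: Coset.order_def)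
  then have "card L dvd p ^ N" using card_G by (metis dvd_triv_right)
  then obtain l where l: "l \<le> N" "card L = p ^ l" using divides_primepow_nat[OF prime_p] by blast
  have p1: "p > 1" by (rule prime_gt_1_nat[OF prime_p])
  have "p ^ (N + r) \<le> p ^ (l + l)" using le unfolding l(2) card_G by (simp add: power_add)
  then have "N + r \<le> l + l" using p1 by simp
  then have *: "N - l + r \<le> l" using l(1) by simp
  show ?thesis
  proof (rule that[of "p ^ (N - l)"])
    show "card (carrier G) = p ^ (N - l) * card L"
      using l by (simp add: card_G flip: power_add)
    show "p ^ (N - l) * p ^ r dvd card L"
      unfolding l(2) power_add[symmetric] using * by (rule le_imp_power_dvd)
  qed
qed

text \<open>In the application \<open>g\<close> is the pullback of the word count of the quotient by
  the central subgroup of order \<open>p\<close>. The outcome is either \<open>p ^ (k - 1)\<close>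
  times \<open>g\<close> alone, or this plus an integer multiple of a sum of induced
  characters.\<close>

lemma generalized_character_cyclic_center:
  assumes w: "fst ` set w \<subseteq> {..<k}" and k: "k \<ge> 1"
    and g: "generalized_character G g"
    and sum_g: "\<And>x. x \<in> carrier G \<Longrightarrow>
      (\<Sum>j<p. of_nat (word_count k w G (tw (int j * socle) x))) = of_nat (p ^ k) * g x"
  shows "generalized_character G (\<lambda>x. of_nat (word_count k w G x))"
proof -
  let ?f = "word_count k w G"
  let ?T = "{..<k} \<rightarrow>\<^sub>E carrier G"
  have finT: "finite ?T" using fin by (intro finite_PiE) auto
  have p0: "p > 0" by (rule prime_gt_0_nat[OF prime_p])
  have pk: "p ^ k = p * p ^ (k - 1)" using k by (cases k) auto
  \<comment> \<open>If \<open>?f\<close> is constant on the cosets of the subgroup of order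
    \<open>p\<close>, the sum in \<open>sum_g\<close> is \<open>p\<close> times \<open>?f x\<close>,
    and \<open>k \<ge> 1\<close> allows cancelling \<open>p\<close>.\<close>
  have invariant_case: ?thesis if inv: "\<And>x. x \<in> carrier G \<Longrightarrow> ?f (tw socle x) = ?f x"
  proof -
    have rep: "?f (tw (int j * socle) x) = ?f x" if x: "x \<in> carrier G" for x j
    proof (induction j)
      case (Suc j)
      have "int (Suc j) * socle = socle + int j * socle" by (simp add: distrib_right)
      then have "tw (int (Suc j) * socle) x = tw socle (tw (int j * socle) x)"
        using x by (simp only: tw_tw)
      then show ?case using inv[of "tw (int j * socle) x"] Suc x by (simp only: tw_closed)
    qed (use x in simp)
    have "of_nat (?f x) = of_int (int (p ^ (k - 1))) * g x" if x: "x \<in> carrier G" for x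
    proof -
      have "of_nat p * of_nat (?f x) = of_nat (p ^ k) * g x"
        using sum_g[OF x] rep[OF x] by simp
      then have "of_nat p * of_nat (?f x) = of_nat p * (of_nat (p ^ (k - 1)) * g x)"
        unfolding pk by (simp add: mult.assoc)
      then show ?thesis using p0 by simp
    qed
    with generalized_character_cmult[OF g, of "int (p ^ (k - 1))"]
    show ?thesis by (rule generalized_character_cong)
  qed
  obtain s a where sa: "\<forall>t. (\<forall>j<k. t j \<in> carrier G) \<longrightarrow>
    word_eval G t w = tw (quad {..<k} a t) (ordered_product s t k)"
    using word_normal_form[OF w] by (elim exE) (rule that)
  have T_mem: "t j \<in> carrier G" if "t \<in> ?T" "j < k" for t j using that by auto
  have upd: "t(i := y) \<in> ?T" if "t \<in> ?T" "i < k" "y \<in> carrier G" for t i y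
    using that by (simp add: PiE_iff extensional_def)
  show ?thesis
  proof (cases "\<forall>i<k. [s i = 0] (mod q)")
    case False
    then obtain i where i: "i < k" "\<not> [s i = 0] (mod q)" by blast
    \<comment> \<open>Multiplying variable \<open>i\<close> by \<open>\<zeta> [^] n\<close>
      multiplies the value of the word by \<open>\<zeta> [^] socle\<close>, a bijection between the
      tuples over \<open>x\<close> and those over \<open>tw socle x\<close>.\<close>
    obtain n :: nat where n: "[int n * s i = socle] (mod q)"
      using exists_multiple_cong_socle[OF prime_p i(2)[unfolded q_def]] unfolding q_def socle_def by blast
    have shift: "word_eval G (t(i := tw (int n * c) (t i))) w = tw (c * socle) (word_eval G t w)"
      if t: "t \<in> ?T" for t c
    proof -
      have "word_eval G (t(i := tw (int n * c) (t i))) w = tw ((int n * c) * s i) (word_eval G t w)"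
        using word_shift[OF sa _ i(1)] T_mem[OF t] by blast
      moreover have "[(int n * c) * s i = c * socle] (mod q)"
        using cong_scalar_left[OF n, of c] by (simp add: algebra_simps)
      moreover have "word_eval G t w \<in> carrier G"
        using word_eval_closed[of t "{..<k}" w] w T_mem[OF t] by blast
      ultimately show ?thesis by simp
    qed
    have wc: "word_eval G t w \<in> carrier G" if "t \<in> ?T" for t
      using word_eval_closed[of t "{..<k}" w] w T_mem[OF that] by blast
    have "?f (tw socle x) = ?f x" if x: "x \<in> carrier G" for x
    proof -
      have "bij_betw (\<lambda>t. t(i := tw (int n) (t i))) {t \<in> ?T. word_eval G t w = x}
          {t \<in> ?T. word_eval G t w = tw socle x}"
      proof (rule bij_betw_byWitness[where f' = "\<lambda>t. t(i := tw (int n * (-1)) (t i))"])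
        show "(\<lambda>t. t(i := tw (int n) (t i))) ` {t \<in> ?T. word_eval G t w = x} \<subseteq>
            {t \<in> ?T. word_eval G t w = tw socle x}"
        proof (rule image_subsetI)
          fix t assume t: "t \<in> {t \<in> ?T. word_eval G t w = x}"
          then have tT: "t \<in> ?T" by blast
          show "t(i := tw (int n) (t i)) \<in> {t \<in> ?T. word_eval G t w = tw socle x}"
            using shift[OF tT, of 1] t upd[OF tT i(1) tw_closed[OF T_mem[OF tT i(1)]]] by simp
        qed
        show "(\<lambda>t. t(i := tw (int n * (-1)) (t i))) ` {t \<in> ?T. word_eval G t w = tw socle x} \<subseteq>
            {t \<in> ?T. word_eval G t w = x}"
        proof (rule image_subsetI)
          fix t assume t: "t \<in> {t \<in> ?T. word_eval G t w = tw socle x}"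
          then have tT: "t \<in> ?T" by blast
          show "t(i := tw (int n * (-1)) (t i)) \<in> {t \<in> ?T. word_eval G t w = x}"
            using shift[OF tT, of "-1"] t upd[OF tT i(1) tw_closed[OF T_mem[OF tT i(1)]]] x by simp
        qed
      qed (use T_mem i(1) in \<open>simp_all\<close>)
      from bij_betw_same_card[OF this] show ?thesis unfolding word_count_def by (rule sym)
    qed
    then show ?thesis by (rule invariant_case)
  next
    case True
    define n where "n i = s i div q" for i
    have s: "s i = q * n i" if "i < k" for i using True that by (simp add: n_def cong_0_iff)
    let ?\<Phi> = "wordform {..<k} n a"
    have eval: "word_eval G t w = tw (?\<Phi> t) \<one>" if t: "t \<in> ?T" for t
    proof -
      have "word_eval G t w = tw (quad {..<k} a t) (ordered_product s t k)"
        using sa T_mem[OF t] by blast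
      also have "ordered_product s t k = tw (\<Sum>j<k. n j * \<psi> (t j)) \<one>"
        using T_mem[OF t] s by (rule ordered_product_central)
      finally show ?thesis by (simp add: wordform_def add.commute)
    qed
    define h where "h i = int (card {t \<in> ?T. [?\<Phi> t = i] (mod q)})" for i
    have f_center: "int (?f (tw i \<one>)) = h i" for i
    proof -
      have "{t \<in> ?T. word_eval G t w = tw i \<one>} = {t \<in> ?T. [?\<Phi> t = i] (mod q)}"
        using eval by auto
      then show ?thesis by (simp add: word_count_def h_def)
    qed
    \<comment> \<open>By \<open>eval\<close> all values of the word are central.\<close>
    have f_off: "?f x = 0" if "x \<notin> center G" for x
    proof -
      have "word_eval G t w \<noteq> x" if t: "t \<in> ?T" for t
        using eval[OF t] \<open>x \<notin> center G\<close> mem_center_iff by metis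
      then have empty: "{t \<in> ?T. word_eval G t w = x} = {}" by blast
      show ?thesis unfolding word_count_def empty by (rule card.empty)
    qed
    have h_cong: "h i = h j" if "[i = j] (mod q)" for i j
      using that unfolding h_def cong_def by simp
    have h_unit: "h (int u * i) = h i" if u: "coprime u p" for u i
    proof -
      have "coprime u (card (carrier G))" using u by (simp add: card_G)
      then obtain \<beta> where \<beta>: "bij_betw \<beta> ?T ?T" "\<And>t. t \<in> ?T \<Longrightarrow> [?\<Phi> (\<beta> t) = int u * ?\<Phi> t] (mod q)"
        using wordform_scaling[OF q_def prime_p fin, of u "{..<k}" n a] by auto
      have "coprime (int u) q" using u by (simp add: q_def)
      then have iff: "[?\<Phi> (\<beta> t) = int u * i] (mod q) \<longleftrightarrow> [?\<Phi> t = i] (mod q)" if "t \<in> ?T" for t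
        using \<beta>(2)[OF that] cong_mult_lcancel[of "int u" q "?\<Phi> t" i] by (simp add: cong_def)
      have "bij_betw \<beta> {t \<in> ?T. [?\<Phi> t = i] (mod q)} {t \<in> ?T. [?\<Phi> t = int u * i] (mod q)}"
      proof (rule bij_betw_subset[OF \<beta>(1)])
        show "\<beta> ` {t \<in> ?T. [?\<Phi> t = i] (mod q)} = {t \<in> ?T. [?\<Phi> t = int u * i] (mod q)}"
        proof (intro equalityI subsetI)
          fix t' assume "t' \<in> \<beta> ` {t \<in> ?T. [?\<Phi> t = i] (mod q)}"
          then obtain t where "t' = \<beta> t" "t \<in> ?T" "[?\<Phi> t = i] (mod q)" by blast
          then show "t' \<in> {t \<in> ?T. [?\<Phi> t = int u * i] (mod q)}"
            using iff bij_betw_apply[OF \<beta>(1)] by blast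
        next
          fix t' assume t': "t' \<in> {t \<in> ?T. [?\<Phi> t = int u * i] (mod q)}"
          then have "t' \<in> \<beta> ` ?T" using \<beta>(1) unfolding bij_betw_def by blast
          then obtain t where "t' = \<beta> t" "t \<in> ?T" by blast
          then show "t' \<in> \<beta> ` {t \<in> ?T. [?\<Phi> t = i] (mod q)}" using iff t' by blast
        qed
      qed blast
      from arg_cong[where f = int, OF bij_betw_same_card[OF this]] show ?thesis unfolding h_def by (rule sym)
    qed
    obtain L \<phi> where L: "isotropic_ext L \<phi>" "centralizer L = L" by (rule lagrangian_exists)
    obtain M where M: "card (carrier G) = M * card L" "M * p ^ r dvd card L"
      by (rule lagrangian_index_dvd[OF L])
    have subL: "subgroup L G" and L_iso: "\<And>x y. x \<in> L \<Longrightarrow> y \<in> L \<Longrightarrow> [b x y = 0] (mod q)"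
      using L unfolding isotropic_ext_def centralizer_def by blast+
    have cardL: "card L > 0"
      using finite_subset[OF subgroup.subset[OF subL] fin] subgroup.one_closed[OF subL] card_gt_0_iff by blast
    define D where "D = h 0 - h socle"
    \<comment> \<open>\<open>k \<ge> 1\<close> supplies the variable 0, along which the cosets of
      \<open>L\<close> are taken.\<close>
    have "int (card L) dvd D"
      unfolding D_def h_def socle_def using k
      by (intro card_isotropic_dvd[OF q_def prime_p fin _ _ subL L_iso, where m = 0]) auto
    moreover have "int (M * p ^ r) dvd int (card L)" using M(2) by (simp only: int_dvd_int_iff)
    ultimately have "int (M * p ^ r) dvd D" using dvd_trans by blast
    \<comment> \<open>\<open>M\<close> is the index of \<open>L\<close>, and \<open>c\<close>
      becomes the multiplicity of each character \<open>\<chi> u\<close>.\<close>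
    then obtain c where c: "D = int (M * p ^ r) * c" by (elim dvdE)
    define U where "U = {u. u < p ^ r \<and> coprime u p}"
    have "\<forall>u\<in>U. \<exists>\<chi>. \<chi> \<in> irreducible_characters G \<and>
      (\<forall>i. \<chi> (tw i \<one>) = of_nat (card (carrier G)) / of_nat (card L) * unity_root (int u * i)) \<and>
      (\<forall>g\<in>carrier G - center G. \<chi> g = 0)"
      using lagrangian_character[OF L] unfolding U_def by blast
    from bchoice[OF this] obtain \<chi> where \<chi>: "\<And>u. u \<in> U \<Longrightarrow> \<chi> u \<in> irreducible_characters G"
      and \<chi>_center: "\<And>u i. u \<in> U \<Longrightarrow> \<chi> u (tw i \<one>) = of_nat (card (carrier G)) / of_nat (card L) * unity_root (int u * i)"
      and \<chi>_off: "\<And>u x. u \<in> U \<Longrightarrow> x \<in> carrier G - center G \<Longrightarrow> \<chi> u x = 0"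
      by auto
    have gen: "generalized_character G (\<lambda>x. of_int (int (p ^ (k - 1))) * g x + of_int c * (\<Sum>u\<in>U. \<chi> u x))"
      by (intro generalized_character_lincomb generalized_character_sum g generalized_character_irreducible \<chi>)
    show ?thesis
    proof (rule generalized_character_cong[OF gen])
      fix x assume x: "x \<in> carrier G"
      have gx: "of_nat p * (of_nat (p ^ (k - 1)) * g x) = (\<Sum>j<p. of_nat (?f (tw (int j * socle) x)))"
        unfolding sum_g[OF x] pk by (simp add: mult.assoc)
      show "of_nat (?f x) = of_int (int (p ^ (k - 1))) * g x + of_int c * (\<Sum>u\<in>U. \<chi> u x)"
      proof (cases "x \<in> center G")
        case False
        \<comment> \<open>Central translates of a noncentral element are noncentral, so the whole
          sum that defines \<open>g x\<close> vanishes.\<close>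
        then have "?f (tw i x) = 0" for i using f_off tw_mem_center[OF x] by blast
        then have "g x = 0" using gx p0 by simp
        then show ?thesis using False \<chi>_off x f_off[OF False] by simp
      next
        case True
        then obtain i where i: "x = tw i \<one>" using mem_center_iff by blast
        have f_tw: "of_nat (?f (tw j x)) = (of_int (h (i + j)) :: complex)" for j
        proof -
          have "int (?f (tw j x)) = h (i + j)" using f_center[of "i + j"] by (simp add: i add.commute)
          then show ?thesis by (metis of_int_of_nat_eq)
        qed
        let ?A = "of_bool [i = 0] (mod q) :: complex" and ?B = "of_bool [i = 0] (mod socle) :: complex"
        have "(\<Sum>u\<in>U. \<chi> u x) = of_nat M * (\<Sum>u\<in>U. unity_root (int u * i))"
          using cardL by (simp add: i \<chi>_center M(1) sum_distrib_left)
        also have "\<dots> = of_nat M * (of_nat (p ^ r) * ?A - of_nat (p ^ (r - 1)) * ?B)"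
          unfolding U_def sum_coprime_roots socle_def by simp
        finally have \<chi>x: "(\<Sum>u\<in>U. \<chi> u x) = of_nat M * (of_nat (p ^ r) * ?A - of_nat (p ^ (r - 1)) * ?B)" .
        have pr: "(of_nat (p ^ r) :: complex) = of_nat p * of_nat (p ^ (r - 1))"
          unfolding p_power_r by simp
        \<comment> \<open>The claim is proved multiplied by \<open>p\<close>: the subtracted sum is
          the part given by \<open>g\<close>, and the right side is the Ramanujan sum up to the
          factor determined by \<open>c\<close>.\<close>
        have "of_int (int p * h i - (\<Sum>j<p. h (i + int j * socle))) =
            (of_int (D * (int p * of_bool [i = 0] (mod q) - of_bool [i = 0] (mod socle))) :: complex)"
          using socle_average[of h i] h_cong h_unit unfolding D_def by simp
        then have 1: "of_nat p * of_int (h i) - (\<Sum>j<p. of_int (h (i + int j * socle))) =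
            of_int D * (of_nat p * ?A - ?B)" by simp
        have 2: "(\<Sum>j<p. of_int (h (i + int j * socle))) = of_nat p * (of_nat (p ^ (k - 1)) * g x)"
          unfolding gx by (simp add: f_tw)
        have 3: "of_int D * (of_nat p * ?A - ?B) = of_nat p * (of_int c * (\<Sum>u\<in>U. \<chi> u x))"
          unfolding c \<chi>x of_int_mult of_int_of_nat_eq of_nat_mult pr by (simp add: algebra_simps)
        from 1 have "of_nat p * of_int (h i) = of_nat p * (of_nat (p ^ (k - 1)) * g x + of_int c * (\<Sum>u\<in>U. \<chi> u x))"
          unfolding 2 3 by (simp only: distrib_left diff_eq_eq add.commute)
        then have "of_int (h i) = of_nat (p ^ (k - 1)) * g x + of_int c * (\<Sum>u\<in>U. \<chi> u x)"
          using p0 by simp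
        then show ?thesis using f_tw[of 0] x by simp
      qed
    qed
  qed
qed

end

section \<open>Word counts in quotients\<close>

text \<open>The induction on the order needs all groups on one type, so quotients are realised on
  natural numbers.\<close>

lemma (in group) quotient_on_nat:
  assumes fin: "finite (carrier G)" and B: "B \<lhd> G"
  obtains H :: "nat monoid" and f where "group_hom G H f" "f ` carrier G = carrier H"
    "\<And>a c. a \<in> carrier G \<Longrightarrow> c \<in> carrier G \<Longrightarrow> f a = f c \<longleftrightarrow> a \<otimes> inv c \<in> B"
proof -
  have sub: "subgroup B G" using B by (simp add: normal_def)
  from finite_imp_inj_to_nat_seg[OF finite_imageI[OF fin, of "\<lambda>a. B #> a"]]
  obtain e :: "'a set \<Rightarrow> nat" where e: "inj_on e ((\<lambda>a. B #> a) ` carrier G)"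
    by (elim exE conjE) (rule that)
  define f where "f a = e (B #> a)" for a
  have f: "f a = f c \<longleftrightarrow> a \<otimes> inv c \<in> B" if ac: "a \<in> carrier G" "c \<in> carrier G" for a c
  proof
    assume "f a = f c"
    then have "B #> a = B #> c"
      unfolding f_def by (rule inj_onD[OF e _ imageI[OF ac(1)] imageI[OF ac(2)]])
    from coset_mult_inv2[OF this ac subgroup.subset[OF sub]]
    show "a \<otimes> inv c \<in> B" by (rule coset_join1) (simp_all add: ac sub)
  next
    assume "a \<otimes> inv c \<in> B"
    from coset_join2[OF m_closed[OF ac(1) inv_closed[OF ac(2)]] sub this]
    have "B #> (a \<otimes> inv c) = B" .
    from coset_mult_inv1[OF this ac subgroup.subset[OF sub]]
    show "f a = f c" by (simp add: f_def)
  qed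
  have "weak_group_morphism f B G" using B f by (rule weak_group_morphismsI)
  then have hom: "group_hom G (image_group f G) f" by (rule weak_group_morphism_group_hom)
  show ?thesis by (rule that[OF hom image_group_carrier[symmetric] f])
qed

lemma (in group_hom) hom_word_eval:
  assumes "t ` X \<subseteq> carrier G" "fst ` set w \<subseteq> X"
  shows "h (word_eval G t w) = word_eval H (h \<circ> t) w"
  using assms(2)
proof (induction w)
  case (Cons a w)
  have "letter_eval G t a \<in> carrier G" "word_eval G t w \<in> carrier G"
    using Cons.prems assms(1) G.letter_eval_closed[OF assms(1)] G.word_eval_closed[OF assms(1)] by auto
  moreover have "h (letter_eval G t a) = letter_eval H (h \<circ> t) a"
    using Cons.prems assms(1) by (auto simp: letter_eval_def)
  ultimately show ?case using Cons by (simp add: comp_def)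
qed simp

lemma word_eval_cong:
  "(\<And>i. i \<in> fst ` set w \<Longrightarrow> t i = t' i) \<Longrightarrow> word_eval G t w = word_eval G t' w"
  by (induction w) (auto simp: letter_eval_def)

text \<open>Both sides count the tuples whose value lies in the coset of \<open>x\<close>: on the
  left by that value, on the right by the image tuple in \<open>H\<close>, which has
  \<open>card B\<close> lifts in each of its \<open>k\<close> coordinates.\<close>

lemma (in group_hom) word_count_quotient:
  assumes fin: "finite (carrier G)" and surj: "h ` carrier G = carrier H"
    and B: "subgroup B G"
    and ker: "\<And>a c. a \<in> carrier G \<Longrightarrow> c \<in> carrier G \<Longrightarrow> h a = h c \<longleftrightarrow> a \<otimes> inv c \<in> B"
    and central: "\<And>c a. c \<in> B \<Longrightarrow> a \<in> carrier G \<Longrightarrow> c \<otimes> a = a \<otimes> c"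
    and w: "fst ` set w \<subseteq> {..<k}" and x: "x \<in> carrier G"
  shows "(\<Sum>c\<in>B. word_count k w G (x \<otimes> c)) = card B ^ k * word_count k w H (h x)"
proof -
  let ?T = "{..<k} \<rightarrow>\<^sub>E carrier G" and ?S = "{..<k} \<rightarrow>\<^sub>E carrier H"
  have Bc: "c \<in> carrier G" if "c \<in> B" for c using subgroup.mem_carrier[OF B that] .
  have finB: "finite B" using finite_subset[OF subgroup.subset[OF B] fin] .
  have finT: "finite ?T" using fin by (intro finite_PiE) auto
  have finH: "finite (carrier H)" using surj fin by (metis finite_imageI)
  have fiber: "{a \<in> carrier G. h a = h x} = (\<lambda>c. x \<otimes> c) ` B" if x: "x \<in> carrier G" for x
  proof (intro equalityI subsetI)
    fix a assume a: "a \<in> {a \<in> carrier G. h a = h x}"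
    then have "a \<otimes> inv x \<in> B" using ker x by auto
    moreover have "a = x \<otimes> (a \<otimes> inv x)"
    proof -
      have ac: "a \<in> carrier G" using a by blast
      have "x \<otimes> (a \<otimes> inv x) = (a \<otimes> inv x) \<otimes> x" using central[OF calculation x] by (rule sym)
      then show ?thesis using ac x by (simp add: G.m_assoc)
    qed
    ultimately show "a \<in> (\<lambda>c. x \<otimes> c) ` B" by blast
  next
    fix a assume "a \<in> (\<lambda>c. x \<otimes> c) ` B"
    then obtain c where c: "c \<in> B" "a = x \<otimes> c" by blast
    then have "a = c \<otimes> x" using central[OF c(1) x] by simp
    then have "a \<otimes> inv x = c" using Bc[OF c(1)] x by (simp add: G.m_assoc)
    then show "a \<in> {a \<in> carrier G. h a = h x}" using ker[of a x] c Bc x by simp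
  qed
  have inj: "inj_on (\<lambda>c. x \<otimes> c) B" if "x \<in> carrier G" for x
    using that Bc by (auto intro!: inj_onI)
  have card_fiber: "card {a \<in> carrier G. h a = y} = card B" if y: "y \<in> carrier H" for y
  proof -
    have "y \<in> h ` carrier G" using surj y by simp
    then obtain x where x: "x \<in> carrier G" "y = h x" by blast
    show ?thesis unfolding x(2) fiber[OF x(1)] by (rule card_image[OF inj[OF x(1)]])
  qed
  define F where "F t = restrict (h \<circ> t) {..<k}" for t
  have F_eval: "h (word_eval G t w) = word_eval H (F t) w" if t: "t \<in> ?T" for t
  proof -
    have "t ` {..<k} \<subseteq> carrier G" using t by auto
    from hom_word_eval[OF this w] show ?thesis
      unfolding F_def using w by (auto intro!: word_eval_cong)
  qed
  have F_fiber: "{t \<in> ?T. F t = s} = (\<Pi>\<^sub>E j\<in>{..<k}. {a \<in> carrier G. h a = s j})" if s: "s \<in> ?S" for s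
  proof (intro equalityI subsetI)
    fix t assume t: "t \<in> {t \<in> ?T. F t = s}"
    then have tT: "t \<in> ?T" and Ft: "F t = s" by blast+
    have "h (t j) = s j" if "j < k" for j using fun_cong[OF Ft, of j] that by (simp add: F_def)
    then show "t \<in> (\<Pi>\<^sub>E j\<in>{..<k}. {a \<in> carrier G. h a = s j})"
      using PiE_mem[OF tT] PiE_arb[OF tT] by (intro PiE_I) simp_all
  next
    fix t assume t: "t \<in> (\<Pi>\<^sub>E j\<in>{..<k}. {a \<in> carrier G. h a = s j})"
    then have tj: "t j \<in> carrier G" "h (t j) = s j" if "j < k" for j using PiE_mem[OF t, of j] that by auto
    have "F t j = s j" for j
      using tj[of j] PiE_arb[OF s, of j] unfolding F_def by (cases "j < k") auto
    moreover have "t \<in> ?T" using tj(1) PiE_arb[OF t] by (intro PiE_I) auto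
    ultimately show "t \<in> {t \<in> ?T. F t = s}" by (simp add: fun_eq_iff)
  qed
  have card_F: "card {t \<in> ?T. F t = s} = card B ^ k" if s: "s \<in> ?S" for s
  proof -
    have "card {t \<in> ?T. F t = s} = (\<Prod>j<k. card {a \<in> carrier G. h a = s j})"
      unfolding F_fiber[OF s] by (rule card_PiE) simp
    also have "\<dots> = (\<Prod>j<k. card B)" using s by (intro prod.cong card_fiber) auto
    finally show ?thesis by simp
  qed
  let ?S' = "{s \<in> ?S. word_eval H s w = h x}"
  have 1: "(\<Sum>c\<in>B. word_count k w G (x \<otimes> c)) = card (\<Union>c\<in>B. {t \<in> ?T. word_eval G t w = x \<otimes> c})"
    unfolding word_count_def
  proof (rule card_UN_disjoint[symmetric])
    show "\<forall>c\<in>B. finite {t \<in> ?T. word_eval G t w = x \<otimes> c}" using finT by simp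
    show "\<forall>c\<in>B. \<forall>c'\<in>B. c \<noteq> c' \<longrightarrow> {t \<in> ?T. word_eval G t w = x \<otimes> c} \<inter> {t \<in> ?T. word_eval G t w = x \<otimes> c'} = {}"
    proof (intro ballI impI)
      fix c c' assume "c \<in> B" "c' \<in> B" "c \<noteq> c'"
      then have "x \<otimes> c \<noteq> x \<otimes> c'" using inj_onD[OF inj[OF x]] by metis
      then show "{t \<in> ?T. word_eval G t w = x \<otimes> c} \<inter> {t \<in> ?T. word_eval G t w = x \<otimes> c'} = {}"
        by (simp only: disjoint_iff mem_Collect_eq) metis
    qed
  qed (rule finB)
  have 2: "(\<Union>c\<in>B. {t \<in> ?T. word_eval G t w = x \<otimes> c}) = (\<Union>s\<in>?S'. {t \<in> ?T. F t = s})"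
  proof -
    have iff: "word_eval G t w \<in> (\<lambda>c. x \<otimes> c) ` B \<longleftrightarrow> word_eval H (F t) w = h x" if t: "t \<in> ?T" for t
    proof -
      have "t ` {..<k} \<subseteq> carrier G" using t by auto
      then have "word_eval G t w \<in> carrier G" using w by (rule G.word_eval_closed)
      then show ?thesis unfolding fiber[OF x, symmetric] F_eval[OF t, symmetric] by simp
    qed
    have FS: "F t \<in> ?S" if t: "t \<in> ?T" for t
      unfolding F_def restrict_PiE_iff using PiE_mem[OF t] hom_closed by simp
    show ?thesis
    proof (intro equalityI subsetI)
      fix t assume "t \<in> (\<Union>c\<in>B. {t \<in> ?T. word_eval G t w = x \<otimes> c})"
      then have "t \<in> ?T" "word_eval G t w \<in> (\<lambda>c. x \<otimes> c) ` B" by auto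
      then show "t \<in> (\<Union>s\<in>?S'. {t \<in> ?T. F t = s})" using iff FS by simp
    next
      fix t assume "t \<in> (\<Union>s\<in>?S'. {t \<in> ?T. F t = s})"
      then have t: "t \<in> ?T" "word_eval H (F t) w = h x" by auto
      then have "word_eval G t w \<in> (\<lambda>c. x \<otimes> c) ` B" using iff by simp
      then show "t \<in> (\<Union>c\<in>B. {t \<in> ?T. word_eval G t w = x \<otimes> c})" using t(1) by blast
    qed
  qed
  have 3: "card (\<Union>s\<in>?S'. {t \<in> ?T. F t = s}) = (\<Sum>s\<in>?S'. card {t \<in> ?T. F t = s})"
  proof (rule card_UN_disjoint)
    show "finite ?S'" using finite_PiE[of "{..<k}" "\<lambda>_. carrier H"] finH by simp
    show "\<forall>s\<in>?S'. finite {t \<in> ?T. F t = s}" using finT by simp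
  qed blast
  have 4: "(\<Sum>s\<in>?S'. card {t \<in> ?T. F t = s}) = (\<Sum>s\<in>?S'. card B ^ k)"
    by (rule sum.cong[OF refl]) (use card_F in blast)
  show ?thesis unfolding 1 2 3 4 by (simp add: word_count_def)
qed

text \<open>In a finite group inverses are powers.\<close>

lemma (in group) submonoid_subgroup:
  assumes fin: "finite (carrier G)" and S: "S \<subseteq> carrier G" "\<one> \<in> S"
    and mult: "\<And>x y. x \<in> S \<Longrightarrow> y \<in> S \<Longrightarrow> x \<otimes> y \<in> S"
  shows "subgroup S G"
proof (rule subgroupI)
  fix a assume a: "a \<in> S"
  then have ac: "a \<in> carrier G" using S by blast
  have pow: "a [^] n \<in> S" for n :: nat using a S(2) mult by (induction n) auto
  have "a [^] (card (carrier G) - 1) \<otimes> a = a [^] Suc (card (carrier G) - 1)" by simp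
  also have "Suc (card (carrier G) - 1) = card (carrier G)"
    using fin one_closed by (metis Suc_pred' card_gt_0_iff empty_iff)
  also have "a [^] card (carrier G) = \<one>"
    using pow_order_eq_1[OF ac] by (simp add: Coset.order_def)
  finally have "inv a = a [^] (card (carrier G) - 1)" using ac by (intro inv_equality) auto
  then show "inv a \<in> S" using pow by simp
qed (use S mult in auto)

section \<open>Reduction to a cyclic center\<close>

context class2_p_group
begin

lemma center_closed:
  "\<one> \<in> center G" "x \<in> center G \<Longrightarrow> y \<in> center G \<Longrightarrow> x \<otimes> y \<in> center G"
  "x \<in> center G \<Longrightarrow> x [^] (n::nat) \<in> center G"
proof -
  have mult: "x \<otimes> y \<in> center G" if "x \<in> center G" "y \<in> center G" for x y
  proof -
    have xy: "x \<in> carrier G" "y \<in> carrier G" using that by (auto simp: center_def)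
    have "x \<otimes> y \<otimes> z = z \<otimes> (x \<otimes> y)" if z: "z \<in> carrier G" for z
    proof -
      have "x \<otimes> y \<otimes> z = x \<otimes> (y \<otimes> z)" using xy z by (simp add: m_assoc)
      also have "y \<otimes> z = z \<otimes> y" using \<open>y \<in> center G\<close> z by (simp add: center_def)
      also have "x \<otimes> (z \<otimes> y) = (x \<otimes> z) \<otimes> y" using xy z by (simp add: m_assoc)
      also have "x \<otimes> z = z \<otimes> x" using \<open>x \<in> center G\<close> z by (simp add: center_def)
      finally show ?thesis using xy z by (simp add: m_assoc)
    qed
    then show ?thesis using xy by (simp add: center_def)
  qed
  show one: "\<one> \<in> center G" by (simp add: center_def)
  show "x \<in> center G \<Longrightarrow> y \<in> center G \<Longrightarrow> x \<otimes> y \<in> center G" by (rule mult)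
  show "x \<in> center G \<Longrightarrow> x [^] (n::nat) \<in> center G" using one mult by (induction n) auto
qed

lemma center_carrier: "x \<in> center G \<Longrightarrow> x \<in> carrier G"
  by (simp add: center_def)

text \<open>Commutators are central, so a trivial center makes the group abelian and hence equal to
  its center.\<close>

lemma center_trivial:
  assumes "center G = {\<one>}"
  shows "carrier G = {\<one>}"
proof -
  have "x \<in> center G" if x: "x \<in> carrier G" for x
  proof -
    have "x \<otimes> y = y \<otimes> x" if y: "y \<in> carrier G" for y
    proof -
      have "x \<otimes> y \<otimes> inv x \<otimes> inv y \<in> center G"
        using comm_central x y by (simp add: center_def)
      then have comm: "x \<otimes> y \<otimes> inv x \<otimes> inv y = \<one>" using assms by simp
      have "x \<otimes> y = (x \<otimes> y \<otimes> inv x \<otimes> inv y) \<otimes> (y \<otimes> x)" using x y by (simp add: m_assoc)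
      then show ?thesis using x y by (simp only: comm) simp
    qed
    then show ?thesis using x by (simp add: center_def)
  qed
  then show ?thesis using assms by blast
qed

text \<open>The case without a nontrivial central subgroup to divide by. The count is constantly 1,
  and the trivial character comes from inducing from the whole group to itself.\<close>

lemma trivial_group_generalized_character:
  assumes triv: "carrier G = {\<one>}" and w: "fst ` set w \<subseteq> {..<k}"
  shows "generalized_character G (\<lambda>x. of_nat (word_count k w G x))"
proof -
  interpret M: monomial_induction G "carrier G" "\<lambda>_. 1"
    by (intro monomial_induction.intro monomial_induction_axioms.intro is_group fin)
      (simp_all add: normal_inv_iff subgroup_self)
  have irr: "(\<lambda>g\<in>carrier G. (\<Sum>x\<in>carrier G. M.\<nu> (inv x \<otimes> g \<otimes> x)) / of_nat (card (carrier G)))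
    \<in> irreducible_characters G"
    by (rule M.induced_irreducible_character) simp
  have T: "{..<k} \<rightarrow>\<^sub>E carrier G = {\<lambda>j\<in>{..<k}. \<one>}"
    unfolding triv by (simp add: PiE_eq_singleton)
  have "word_eval G t w = \<one>" if t: "t \<in> {..<k} \<rightarrow>\<^sub>E carrier G" for t
  proof -
    have "t ` {..<k} \<subseteq> carrier G" using t by auto
    from word_eval_closed[OF this w] show ?thesis unfolding triv by simp
  qed
  then have "{t \<in> {..<k} \<rightarrow>\<^sub>E carrier G. word_eval G t w = \<one>} = {..<k} \<rightarrow>\<^sub>E carrier G"
    by blast
  then have "word_count k w G \<one> = 1" unfolding word_count_def T by simp
  moreover have "(\<Sum>x\<in>carrier G. M.\<nu> (inv x \<otimes> g \<otimes> x)) / of_nat (card (carrier G)) = 1"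
    if "g \<in> carrier G" for g
  proof -
    have "(\<Sum>x\<in>carrier G. M.\<nu> (inv x \<otimes> g \<otimes> x)) = (\<Sum>x\<in>carrier G. 1)"
      using that by (intro sum.cong refl) (simp only: M.\<nu>_def m_closed inv_closed if_True)
    moreover have "card (carrier G) \<noteq> 0" using fin one_closed by auto
    ultimately show ?thesis by simp
  qed
  ultimately show ?thesis
    by (intro generalized_character_cong[OF generalized_character_irreducible[OF irr]])
      (auto simp: triv)
qed

lemma powers_subgroup:
  assumes z: "z \<in> center G" "z [^] p = \<one>" "z \<noteq> \<one>"
  defines "B \<equiv> (\<lambda>j. z [^] (j::nat)) ` {..<p}"
  shows "inj_on (\<lambda>j. z [^] (j::nat)) {..<p}" and "subgroup B G" and "B \<subseteq> center G" and "B \<noteq> {\<one>}"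
    and "z [^] (i::nat) \<in> B"
proof -
  have zc [simp]: "z \<in> carrier G" using z by (simp add: center_carrier)
  have p1: "p > 1" by (rule prime_gt_1_nat[OF prime_p])
  have "ord z dvd p" using z(2) pow_eq_id[of z p] by simp
  moreover have "ord z \<noteq> 1" using z(3) ord_eq_1[of z] by simp
  ultimately have ord: "ord z = p" using prime_p by (auto simp: prime_nat_iff)
  show inj: "inj_on (\<lambda>j. z [^] (j::nat)) {..<p}"
  proof -
    have "{0..ord z - 1} = {..<p}" unfolding ord using p1 by auto
    then show ?thesis using ord_inj[OF zc] by simp
  qed
  have mem: "z [^] (i::nat) \<in> B" for i
  proof -
    have "z [^] i = (z [^] p) [^] (i div p) \<otimes> z [^] (i mod p)"
      by (simp add: nat_pow_pow nat_pow_mult)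
    also have "\<dots> = z [^] (i mod p)" using z(2) by simp
    finally show ?thesis unfolding B_def using p1 by auto
  qed
  show "z [^] (i::nat) \<in> B" by (rule mem)
  show "subgroup B G"
  proof (rule submonoid_subgroup[OF fin])
    show "B \<subseteq> carrier G" unfolding B_def by auto
    show "\<one> \<in> B" using mem[of 0] by simp
    fix x y assume "x \<in> B" "y \<in> B"
    then obtain i j :: nat where "x = z [^] i" "y = z [^] j" unfolding B_def by blast
    then show "x \<otimes> y \<in> B" using mem[of "i + j"] by (simp add: nat_pow_mult)
  qed
  show "B \<subseteq> center G" unfolding B_def using center_closed(3)[OF z(1)] by blast
  show "B \<noteq> {\<one>}" using mem[of 1] z(3) by auto
qed

lemma center_subgroup: "subgroup (center G) G"
  by (rule submonoid_subgroup[OF fin _ center_closed(1,2)]) (auto simp: center_def)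

lemma ord_prime_power: "x \<in> carrier G \<Longrightarrow> \<exists>m. ord x = p ^ m"
  using ord_dvd_group_order[of x] divides_primepow_nat[OF prime_p] card_G by (auto simp: Coset.order_def)

lemma sum_over_powers:
  assumes "z \<in> center G" "z [^] p = \<one>" "z \<noteq> \<one>"
  shows "(\<Sum>c\<in>(\<lambda>j. z [^] (j::nat)) ` {..<p}. F c) = (\<Sum>j<p. F (z [^] j))"
  using powers_subgroup(1)[OF assms] by (simp add: sum.reindex)

lemma card_powers:
  assumes "z \<in> center G" "z [^] p = \<one>" "z \<noteq> \<one>"
  shows "card ((\<lambda>j. z [^] (j::nat)) ` {..<p}) = p"
  using powers_subgroup(1)[OF assms] by (simp add: card_image)

text \<open>A unique central subgroup of order \<open>p\<close> bounds the central solutions of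
  \<open>z [^] (p ^ i) = \<one>\<close> by \<open>p ^ i\<close>, by induction along the p-th power
  map. If \<open>p ^ m\<close> is the largest order of a central element, all of the center solves
  this for \<open>i = m\<close>, so an element of order \<open>p ^ m\<close> generates it.\<close>

lemma center_cyclic:
  assumes b: "b \<in> center G" "b [^] p = \<one>" "b \<noteq> \<one>"
    and unique: "\<And>c. c \<in> center G \<Longrightarrow> c [^] p = \<one> \<Longrightarrow> c \<in> (\<lambda>j. b [^] (j::nat)) ` {..<p}"
  obtains \<zeta> m where "cyclic_center G p N \<zeta> m"
proof -
  let ?B = "(\<lambda>j. b [^] (j::nat)) ` {..<p}"
  define W where "W i = {z \<in> center G. z [^] (p ^ i) = \<one>}" for i :: nat
  have finZ: "finite (center G)" using fin by (simp add: center_def)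
  have finW: "finite (W i)" for i using finZ by (simp add: W_def)
  have W_ne: "W i \<noteq> {}" for i using center_closed(1) by (force simp: W_def)
  have cardW: "card (W i) \<le> p ^ i" for i
  proof (induction i)
    case 0
    have "W 0 \<subseteq> {\<one>}" by (auto simp: W_def dest: center_carrier)
    then have "card (W 0) \<le> card {\<one>}" by (intro card_mono) auto
    then show ?case by simp
  next
    case (Suc i)
    have "(\<lambda>z. z [^] p) \<in> W (Suc i) \<rightarrow> W i"
      using center_closed(3) center_carrier by (auto simp: W_def nat_pow_pow)
    from pigeonhole_card[OF this finW finW W_ne] obtain y where
      y: "card (W (Suc i)) \<le> card ((\<lambda>z. z [^] p) -` {y} \<inter> W (Suc i)) * card (W i)" by blast
    have "card ((\<lambda>z. z [^] p) -` {y} \<inter> W (Suc i)) \<le> p"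
    proof (cases "(\<lambda>z. z [^] p) -` {y} \<inter> W (Suc i) = {}")
      case False
      then obtain v where v: "v \<in> center G" "v [^] p = y" by (auto simp: W_def)
      have vc: "v \<in> carrier G" using v(1) by (rule center_carrier)
      have vi: "inv v \<in> center G" using subgroup.m_inv_closed[OF center_subgroup v(1)] .
      \<comment> \<open>Two central elements with the same p-th power differ by an element killed by
        \<open>p\<close>, hence by a power of \<open>b\<close>.\<close>
      have "card ((\<lambda>z. z [^] p) -` {y} \<inter> W (Suc i)) \<le> card ?B"
      proof (rule card_inj_on_le[where f = "\<lambda>z. z \<otimes> inv v"])
        show "inj_on (\<lambda>z. z \<otimes> inv v) ((\<lambda>z. z [^] p) -` {y} \<inter> W (Suc i))"
        proof (rule inj_onI)
          fix s t assume "s \<in> (\<lambda>z. z [^] p) -` {y} \<inter> W (Suc i)" "t \<in> (\<lambda>z. z [^] p) -` {y} \<inter> W (Suc i)"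
            and eq: "s \<otimes> inv v = t \<otimes> inv v"
          then have "s \<in> carrier G" "t \<in> carrier G" by (auto simp: W_def center_def)
          then show "s = t" using eq vc by simp
        qed
        show "(\<lambda>z. z \<otimes> inv v) ` ((\<lambda>z. z [^] p) -` {y} \<inter> W (Suc i)) \<subseteq> ?B"
        proof (rule image_subsetI)
          fix z assume "z \<in> (\<lambda>z. z [^] p) -` {y} \<inter> W (Suc i)"
          then have z: "z \<in> center G" "z [^] p = y" by (auto simp: W_def)
          have zc: "z \<in> carrier G" using z(1) by (rule center_carrier)
          have "z \<otimes> inv v = inv v \<otimes> z" using z(1) vc by (simp add: center_def)
          then have "(z \<otimes> inv v) [^] p = z [^] p \<otimes> inv v [^] p"
            using zc vc by (intro pow_mult_distrib) auto
          also have "\<dots> = y \<otimes> inv y" using z(2) v(2) vc by (simp add: nat_pow_inv)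
          finally have "(z \<otimes> inv v) [^] p = \<one>" using v(2) vc by auto
          then show "z \<otimes> inv v \<in> ?B" using unique center_closed(2)[OF z(1) vi] by blast
        qed
      qed simp
      then show ?thesis using card_powers[OF b] by simp
    qed simp
    then have "card (W (Suc i)) \<le> p * p ^ i" using y Suc by (meson le_trans mult_le_mono)
    then show ?case by simp
  qed
  define P where "P m \<longleftrightarrow> (\<exists>z\<in>center G. ord z = p ^ m)" for m :: nat
  have p1: "p > 1" by (rule prime_gt_1_nat[OF prime_p])
  have bound: "m \<le> N" if m: "P m" for m
  proof -
    obtain z where "z \<in> center G" "ord z = p ^ m" using m by (auto simp: P_def)
    then have "p ^ m dvd p ^ N"
      using ord_dvd_group_order[OF center_carrier] card_G by (metis Coset.order_def)
    then show ?thesis using p1 by (simp add: power_dvd_imp_le)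
  qed
  obtain m\<^sub>0 where "ord b = p ^ m\<^sub>0" using ord_prime_power[OF center_carrier[OF b(1)]] by blast
  then have P0: "P m\<^sub>0" using b(1) by (auto simp: P_def)
  define m where "m = Greatest P"
  have Pm: "P m" unfolding m_def using P0 bound by (rule GreatestI_nat)
  have max: "i \<le> m" if "P i" for i unfolding m_def using that bound by (rule Greatest_le_nat)
  obtain \<zeta> where \<zeta>: "\<zeta> \<in> center G" "ord \<zeta> = p ^ m" using Pm by (auto simp: P_def)
  have \<zeta>c: "\<zeta> \<in> carrier G" using \<zeta>(1) by (rule center_carrier)
  have "m\<^sub>0 \<noteq> 0"
    using \<open>ord b = p ^ m\<^sub>0\<close> b(3) ord_eq_1[OF center_carrier[OF b(1)]] by auto
  then have m: "m > 0" using max[OF P0] by simp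
  have "center G \<subseteq> W m"
  proof
    fix z assume z: "z \<in> center G"
    then have zc: "z \<in> carrier G" by (rule center_carrier)
    obtain i where i: "ord z = p ^ i" using ord_prime_power[OF zc] by blast
    then have "i \<le> m" using z by (intro max) (auto simp: P_def)
    then have "ord z dvd p ^ m" unfolding i by (rule le_imp_power_dvd)
    then show "z \<in> W m" using z pow_eq_id[OF zc] by (simp add: W_def)
  qed
  then have "card (center G) \<le> p ^ m" using card_mono[OF finW] cardW le_trans by blast
  moreover have sub: "(\<lambda>j. \<zeta> [^] j) ` {0..ord \<zeta> - 1} \<subseteq> center G"
    using center_closed(3)[OF \<zeta>(1)] by blast
  moreover have "card ((\<lambda>j. \<zeta> [^] j) ` {0..ord \<zeta> - 1}) = p ^ m"
    using card_image[OF ord_inj[OF \<zeta>c]] \<zeta>(2) p1 by simp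
  ultimately have eq: "(\<lambda>j. \<zeta> [^] j) ` {0..ord \<zeta> - 1} = center G"
    using finZ by (intro card_seteq) auto
  have gen: "\<exists>i::int. z = \<zeta> [^] i" if z: "z \<in> center G" for z
  proof -
    obtain j :: nat where "z = \<zeta> [^] j" using z unfolding eq[symmetric] by blast
    then show ?thesis by (intro exI[of _ "int j"]) (simp add: int_pow_int)
  qed
  have "cyclic_center G p N \<zeta> m"
    by (intro cyclic_center.intro cyclic_center_axioms.intro class2_p_group_axioms \<zeta> m gen)
  then show ?thesis by (rule that)
qed

text \<open>\<open>quotients\<close> is the form in which the induction hypothesis is used:
  averaging over a nontrivial central subgroup reduces to a smaller group.\<close>

lemma generalized_character_if_quotients:
  assumes w: "fst ` set w \<subseteq> {..<k}" and k: "k \<ge> 1"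
    and quotients: "\<And>B. subgroup B G \<Longrightarrow> B \<subseteq> center G \<Longrightarrow> B \<noteq> {\<one>} \<Longrightarrow>
      \<exists>g. generalized_character G g \<and> (\<forall>x\<in>carrier G.
        (\<Sum>c\<in>B. of_nat (word_count k w G (x \<otimes> c))) = of_nat (card B ^ k) * g x)"
  shows "generalized_character G (\<lambda>x. of_nat (word_count k w G x))"
proof (cases "center G = {\<one>}")
  case True
  then show ?thesis using trivial_group_generalized_character[OF center_trivial w] by blast
next
  case False
  let ?f = "\<lambda>x. of_nat (word_count k w G x) :: complex"
  have p1: "p > 1" by (rule prime_gt_1_nat[OF prime_p])
  have pk: "p ^ k = p * p ^ (k - 1)" using k by (cases k) auto
  have powers_quotient: "\<exists>g. generalized_character G g \<and> (\<forall>x\<in>carrier G.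
        (\<Sum>j<p. ?f (x \<otimes> z [^] j)) = of_nat (p ^ k) * g x)"
    if z: "z \<in> center G" "z [^] p = \<one>" "z \<noteq> \<one>" for z
    using quotients[OF powers_subgroup(2,3,4)[OF z]]
    unfolding sum_over_powers[OF z] card_powers[OF z] .
  obtain z where z: "z \<in> center G" "z \<noteq> \<one>" using False center_closed(1) by blast
  have zc: "z \<in> carrier G" using z(1) by (rule center_carrier)
  obtain m where m: "ord z = p ^ m" using ord_prime_power[OF zc] by blast
  have "m \<noteq> 0" using m z(2) ord_eq_1[OF zc] by auto
  then have pm: "p ^ m = p ^ (m - 1) * p" by (cases m) auto
  define b where "b = z [^] (p ^ (m - 1))"
  have b: "b \<in> center G" "b [^] p = \<one>" "b \<noteq> \<one>"
  proof -
    show "b \<in> center G" unfolding b_def by (rule center_closed(3)[OF z(1)])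
    show "b [^] p = \<one>" unfolding b_def nat_pow_pow[OF zc] pm[symmetric] m[symmetric] using zc by simp
    show "b \<noteq> \<one>"
    proof
      assume "b = \<one>"
      then have "p ^ m dvd p ^ (m - 1)" using pow_eq_id[OF zc] m by (simp add: b_def)
      then show False using p1 \<open>m \<noteq> 0\<close> power_dvd_imp_le[of p m "m - 1"] by simp
    qed
  qed
  have bc: "b \<in> carrier G" using b(1) by (rule center_carrier)
  show ?thesis
  proof (cases "\<forall>c\<in>center G. c [^] p = \<one> \<longrightarrow> c \<in> (\<lambda>j. b [^] (j::nat)) ` {..<p}")
    case True
    obtain \<zeta> r where "cyclic_center G p N \<zeta> r"
      using center_cyclic[OF b] True by blast
    then interpret C: cyclic_center G p N \<zeta> r .
    \<comment> \<open>The generator of the subgroup of order \<open>p\<close> that matches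
      translation by \<open>C.socle\<close>.\<close>
    define e where "e = \<zeta> [^] (p ^ (r - 1))"
    have e: "e \<in> center G" "e [^] p = \<one>" "e \<noteq> \<one>"
    proof -
      show "e \<in> center G" unfolding e_def by (rule center_closed(3)[OF C.\<zeta>_center])
      have "e [^] p = \<zeta> [^] (p ^ r)" unfolding e_def C.p_power_r by (simp add: nat_pow_pow mult.commute)
      then show "e [^] p = \<one>" using pow_ord_eq_1[OF C.\<zeta>_carrier] C.ord_\<zeta> by simp
      show "e \<noteq> \<one>"
      proof
        assume "e = \<one>"
        then have "p ^ r dvd p ^ (r - 1)" using pow_eq_id[OF C.\<zeta>_carrier] C.ord_\<zeta> by (simp add: e_def)
        then show False using p1 C.r_pos power_dvd_imp_le[of p r "r - 1"] by simp
      qed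
    qed
    have tw: "C.tw (int j * C.socle) x = x \<otimes> e [^] j" if "x \<in> carrier G" for j x
    proof -
      have "int j * C.socle = int (p ^ (r - 1) * j)" by (simp add: C.socle_def)
      then have "\<zeta> [^] (int j * C.socle) = e [^] j"
        by (simp only: int_pow_int e_def nat_pow_pow[OF C.\<zeta>_carrier])
      then show ?thesis using C.\<zeta>_commute[OF that, of "int j * C.socle"] by (simp add: C.tw_def)
    qed
    obtain g where g: "generalized_character G g" "\<And>x. x \<in> carrier G \<Longrightarrow>
        (\<Sum>j<p. ?f (x \<otimes> e [^] j)) = of_nat (p ^ k) * g x"
      using powers_quotient[OF e] by blast
    show ?thesis
      by (rule C.generalized_character_cyclic_center[OF w k g(1)]) (simp only: tw g(2))
  next
    case False
    then obtain c where c: "c \<in> center G" "c [^] p = \<one>" "c \<notin> (\<lambda>j. b [^] (j::nat)) ` {..<p}" by blast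
    have cc: "c \<in> carrier G" using c(1) by (rule center_carrier)
    have mod_p: "y [^] i = y [^] (i mod p)" if "y \<in> carrier G" "y [^] p = \<one>" for y and i :: nat
    proof -
      have "y [^] i = (y [^] p) [^] (i div p) \<otimes> y [^] (i mod p)"
        unfolding nat_pow_pow[OF that(1)] nat_pow_mult[OF that(1)] by simp
      then show ?thesis using that by simp
    qed
    have bc_comm: "b [^] (i::nat) \<otimes> c [^] (j::nat) = c [^] j \<otimes> b [^] i" for i j
      using center_closed(3)[OF b(1), of i] cc by (simp add: center_def)
    \<comment> \<open>The powers of \<open>c\<close> meet those of \<open>b\<close> trivially: a
      nonzero \<open>j\<close> would be invertible modulo \<open>p\<close> and put \<open>c\<close>
      itself among the powers of \<open>b\<close>.\<close>
    have c_pow: "j = 0" if cj: "c [^] j \<in> (\<lambda>j. b [^] (j::nat)) ` {..<p}" and "j < p" for j :: nat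
    proof (rule ccontr)
      assume "j \<noteq> 0"
      then have "coprime j p" using \<open>j < p\<close> prime_p
        by (metis coprime_commute dvd_imp_le gr0I not_le prime_imp_coprime)
      then obtain v where v: "[j * v = 1] (mod p)" using cong_solve_coprime_nat by auto
      obtain i :: nat where i: "c [^] j = b [^] i" using cj by blast
      have "c = c [^] (1 mod p)" using p1 cc by simp
      also have "\<dots> = c [^] ((j * v) mod p)" using v by (simp only: cong_def)
      also have "\<dots> = c [^] (j * v)" by (rule mod_p[OF cc c(2), symmetric])
      also have "\<dots> = b [^] (i * v)" using i cc bc by (simp flip: nat_pow_pow)
      finally show False using c(3) powers_subgroup(5)[OF b] by metis
    qed
    define A where "A = (\<lambda>(i, j). b [^] (i::nat) \<otimes> c [^] (j::nat)) ` ({..<p} \<times> {..<p})"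
    have A_mem: "b [^] i \<otimes> c [^] j \<in> A" for i j :: nat
      unfolding A_def using mod_p[OF bc b(2), of i] mod_p[OF cc c(2), of j] p1
      by (intro image_eqI[of _ _ "(i mod p, j mod p)"]) auto
    have A_prod: "(b [^] i \<otimes> c [^] j) \<otimes> (b [^] i' \<otimes> c [^] j') = b [^] (i + i') \<otimes> c [^] (j + j')"
      for i j i' j' :: nat
    proof -
      have "(b [^] i \<otimes> c [^] j) \<otimes> (b [^] i' \<otimes> c [^] j') = b [^] i \<otimes> (c [^] j \<otimes> b [^] i') \<otimes> c [^] j'"
        using bc cc by (simp add: m_assoc)
      also have "\<dots> = b [^] i \<otimes> (b [^] i' \<otimes> c [^] j) \<otimes> c [^] j'" by (simp only: bc_comm)
      finally show ?thesis using bc cc by (simp add: m_assoc flip: nat_pow_mult)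
    qed
    have A_sub: "subgroup A G"
    proof (rule submonoid_subgroup[OF fin])
      show "A \<subseteq> carrier G" unfolding A_def using bc cc by auto
      show "\<one> \<in> A" using A_mem[of 0 0] by simp
      fix x y assume "x \<in> A" "y \<in> A"
      then obtain i j i' j' :: nat where "x = b [^] i \<otimes> c [^] j" "y = b [^] i' \<otimes> c [^] j'"
        unfolding A_def by auto
      then show "x \<otimes> y \<in> A" using A_prod A_mem by simp
    qed
    have A_center: "A \<subseteq> center G"
      unfolding A_def using center_closed(2,3) b(1) c(1) by auto
    have A_ne: "A \<noteq> {\<one>}" using A_mem[of 1 0] b(3) bc by auto
    have A_inj: "inj_on (\<lambda>(i, j). b [^] (i::nat) \<otimes> c [^] (j::nat)) ({..<p} \<times> {..<p})"
    proof -
      have le: "i = i' \<and> j = j'"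
        if "i < p" "i' < p" "j < p" "j' \<le> j" "b [^] i \<otimes> c [^] j = b [^] i' \<otimes> c [^] j'" for i i' j j' :: nat
      proof -
        have "c [^] j = c [^] (j - j') \<otimes> c [^] j'" using that(4) cc by (simp add: nat_pow_mult)
        then have "(b [^] i \<otimes> c [^] (j - j')) \<otimes> c [^] j' = b [^] i' \<otimes> c [^] j'"
          using that(5) bc cc by (simp add: m_assoc)
        then have *: "b [^] i \<otimes> c [^] (j - j') = b [^] i'" using bc cc by simp
        then have "c [^] (j - j') = inv (b [^] i) \<otimes> b [^] i'" using bc cc by (metis m_inv_cancel(2) nat_pow_closed)
        also have "\<dots> \<in> (\<lambda>j. b [^] (j::nat)) ` {..<p}"
          using powers_subgroup(2,5)[OF b] by (meson subgroup.m_closed subgroup.m_inv_closed)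
        finally have "j - j' = 0" using that(3) by (intro c_pow) auto
        then have jj: "j = j'" using that(4) by simp
        then have "b [^] i = b [^] i'" using * bc by simp
        then have "i = i'" using powers_subgroup(1)[OF b] that(1,2) by (auto dest: inj_onD)
        then show ?thesis using jj by simp
      qed
      show ?thesis
      proof (rule inj_onI)
        fix s t assume st: "s \<in> {..<p} \<times> {..<p}" "t \<in> {..<p} \<times> {..<p}"
          "(case s of (i, j) \<Rightarrow> b [^] i \<otimes> c [^] j) = (case t of (i, j) \<Rightarrow> b [^] i \<otimes> c [^] j)"
        obtain i j i' j' where s: "s = (i, j)" and t: "t = (i', j')" by fastforce
        show "s = t" using st le[of i i' j j'] le[of i' i j' j] unfolding s t by (cases "j' \<le> j") auto
      qed
    qed
    have cardA: "card A = p * p" unfolding A_def using card_image[OF A_inj] by (simp add: card_cartesian_product)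
    have sumA: "(\<Sum>y\<in>A. F y) = (\<Sum>i<p. \<Sum>j<p. F (b [^] i \<otimes> c [^] j))" for F :: "'a \<Rightarrow> complex"
      unfolding A_def sum.reindex[OF A_inj] by (simp add: sum.cartesian_product comp_def case_prod_unfold)
    obtain gA where gA: "generalized_character G gA" "\<And>x. x \<in> carrier G \<Longrightarrow>
        (\<Sum>i<p. \<Sum>j<p. ?f (x \<otimes> (b [^] i \<otimes> c [^] j))) = of_nat ((p * p) ^ k) * gA x"
      using quotients[OF A_sub A_center A_ne] unfolding sumA cardA by blast
    obtain gb where gb: "generalized_character G gb" "\<And>x. x \<in> carrier G \<Longrightarrow>
        (\<Sum>j<p. ?f (x \<otimes> b [^] j)) = of_nat (p ^ k) * gb x"
      using powers_quotient[OF b] by blast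
    \<comment> \<open>The \<open>p + 1\<close> subgroups of order \<open>p\<close> in
      \<open>A\<close> are generated by \<open>b\<close> and by the elements
      \<open>b [^] i \<otimes> c\<close> with \<open>i < p\<close>; these are the latter.\<close>
    have line: "\<exists>g. generalized_character G g \<and> (\<forall>x\<in>carrier G.
        (\<Sum>j<p. ?f (x \<otimes> (b [^] (i * j) \<otimes> c [^] j))) = of_nat (p ^ k) * g x)" for i :: nat
    proof -
      let ?z = "b [^] i \<otimes> c"
      have pow: "?z [^] j = b [^] (i * j) \<otimes> c [^] j" for j :: nat
      proof -
        have "b [^] i \<otimes> c = c \<otimes> b [^] i" using bc_comm[of i 1] cc by simp
        then show ?thesis using bc cc by (subst pow_mult_distrib) (auto simp: nat_pow_pow)
      qed
      have "?z [^] p = (b [^] p) [^] i \<otimes> c [^] p" using bc by (simp add: pow nat_pow_pow mult.commute)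
      then have 1: "?z [^] p = \<one>" using b(2) c(2) by simp
      have 2: "?z \<noteq> \<one>"
      proof
        assume "?z = \<one>"
        then have "c = inv (b [^] i)" using bc cc by (metis inv_equality inv_inv nat_pow_closed bc_comm nat_pow_eone)
        also have "\<dots> \<in> (\<lambda>j. b [^] (j::nat)) ` {..<p}"
          using powers_subgroup(2,5)[OF b] by (meson subgroup.m_inv_closed)
        finally show False using c(3) by contradiction
      qed
      have "?z \<in> center G" using center_closed(2,3) b(1) c(1) by simp
      from powers_quotient[OF this 1 2] show ?thesis unfolding pow .
    qed
    have "\<forall>i. \<exists>g. generalized_character G g \<and> (\<forall>x\<in>carrier G.
        (\<Sum>j<p. ?f (x \<otimes> (b [^] (i * j) \<otimes> c [^] j))) = of_nat (p ^ k) * g x)"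
      using line by (rule allI)
    from choice[OF this] obtain gl where gl: "\<And>i. generalized_character G (gl i)" "\<And>i x. x \<in> carrier G \<Longrightarrow>
        (\<Sum>j<p. ?f (x \<otimes> (b [^] (i * j) \<otimes> c [^] j))) = of_nat (p ^ k) * gl i x"
      by blast
    define F where "F x i j = ?f (x \<otimes> (b [^] (i::nat) \<otimes> c [^] (j::nat)))" for x i j
    \<comment> \<open>For \<open>0 < j < p\<close> the elements \<open>b [^] (i * j)\<close>, \<open>i < p\<close>, are a rearrangement of the powers of \<open>b\<close>.\<close>
    have count: "(\<Sum>i<p. \<Sum>j<p. F x (i * j) j) + (\<Sum>i<p. F x i 0) =
        of_nat p * F x 0 0 + (\<Sum>i<p. \<Sum>j<p. F x i j)" for x
    proof -
      have F_mod: "F x i j = F x (i mod p) j" for i j unfolding F_def using mod_p[OF bc b(2), of i] by simp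
      have col: "(\<Sum>i<p. F x (i * j) j) = (\<Sum>i<p. F x i j)" if j: "j \<in> {1..<p}" for j
      proof -
        have cop: "coprime j p" using j prime_p
          by (metis atLeastLessThan_iff coprime_commute dvd_imp_le not_le not_one_le_zero gr0I prime_imp_coprime)
        have inj: "inj_on (\<lambda>i. (i * j) mod p) {..<p}"
        proof (rule inj_onI)
          fix i i' assume i: "i \<in> {..<p}" "i' \<in> {..<p}" "(i * j) mod p = (i' * j) mod p"
          then have "[i = i'] (mod p)" using cong_mult_rcancel_nat[OF cop, of i i'] by (simp add: cong_def)
          then show "i = i'" using i by (simp add: cong_def)
        qed
        have "(\<lambda>i. (i * j) mod p) ` {..<p} \<subseteq> {..<p}" using p1 by auto
        then have "bij_betw (\<lambda>i. (i * j) mod p) {..<p} {..<p}"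
          using inj by (simp add: bij_betw_def endo_inj_surj)
        then have "(\<Sum>i<p. F x ((i * j) mod p) j) = (\<Sum>i<p. F x i j)"
          using sum.reindex_bij_betw[of "\<lambda>i. (i * j) mod p" "{..<p}" "{..<p}" "\<lambda>i. F x i j"] by simp
        then show ?thesis using F_mod[symmetric] by simp
      qed
      have split: "{..<p} = insert 0 {1..<p}" using p1 by auto
      have "(\<Sum>j<p. \<Sum>i<p. F x (i * j) j) = of_nat p * F x 0 0 + (\<Sum>j\<in>{1..<p}. \<Sum>i<p. F x i j)"
        using col by (subst split) simp
      moreover have "(\<Sum>j<p. \<Sum>i<p. F x i j) = (\<Sum>i<p. F x i 0) + (\<Sum>j\<in>{1..<p}. \<Sum>i<p. F x i j)"
        by (subst split) simp
      ultimately show ?thesis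
        using sum.swap[of "\<lambda>i j. F x (i * j) j" "{..<p}" "{..<p}"] sum.swap[of "F x" "{..<p}" "{..<p}"] by simp
    qed
    \<comment> \<open>These coefficients are \<open>p ^ k\<close> and \<open>(p * p) ^ k\<close>
      divided by \<open>p\<close>, which are integers as \<open>k \<ge> 1\<close>.\<close>
    have gen: "generalized_character G (\<lambda>x. of_int (int (p ^ (k - 1))) * ((\<Sum>i<p. gl i x) + gb x)
        - of_int (int (p ^ (k - 1) * p ^ k)) * gA x)"
      by (intro generalized_character_diff generalized_character_cmult generalized_character_add
          generalized_character_sum gl(1) gb(1) gA(1))
    show ?thesis
    proof (rule generalized_character_cong[OF gen])
      fix x assume x: "x \<in> carrier G"
      have 1: "(\<Sum>i<p. \<Sum>j<p. F x (i * j) j) = of_nat (p ^ k) * (\<Sum>i<p. gl i x)"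
        unfolding F_def by (simp only: gl(2)[OF x] sum_distrib_left)
      have 2: "(\<Sum>i<p. F x i 0) = of_nat (p ^ k) * gb x"
        unfolding F_def using gb(2)[OF x] bc by simp
      have 3: "(\<Sum>i<p. \<Sum>j<p. F x i j) = of_nat ((p * p) ^ k) * gA x"
        unfolding F_def by (rule gA(2)[OF x])
      have 4: "F x 0 0 = ?f x" unfolding F_def using x by simp
      have "of_nat p * ?f x = of_nat (p ^ k) * (\<Sum>i<p. gl i x) + of_nat (p ^ k) * gb x - of_nat ((p * p) ^ k) * gA x"
        using count[of x] unfolding 1 2 3 4 by (simp add: algebra_simps)
      also have "\<dots> = of_nat p * (of_int (int (p ^ (k - 1))) * ((\<Sum>i<p. gl i x) + gb x)
        - of_int (int (p ^ (k - 1) * p ^ k)) * gA x)"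
        unfolding power_mult_distrib pk by (simp add: algebra_simps)
      finally show "?f x = of_int (int (p ^ (k - 1))) * ((\<Sum>i<p. gl i x) + gb x)
        - of_int (int (p ^ (k - 1) * p ^ k)) * gA x"
        using p1 by simp
    qed
  qed
qed

end

section \<open>Homomorphic images and the induction on the group order\<close>

lemma (in group_hom) card_image_mult_kernel:
  assumes surj: "h ` carrier G = carrier H"
  shows "card (carrier H) * card (kernel G H h) = card (carrier G)"
proof -
  have "card (carrier (G Mod kernel G H h)) = card (carrier H)"
    using FactGroup_iso[OF surj] by (rule iso_same_card)
  moreover have "card (rcosets (kernel G H h)) * card (kernel G H h) = card (carrier G)"
    using G.lagrange[OF subgroup_kernel] by (simp add: Coset.order_def)
  ultimately show ?thesis by (simp add: FactGroup_def)
qed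

context class2_p_group
begin

lemma class2_p_group_image:
  assumes f: "group_hom G H f" and surj: "f ` carrier G = carrier H"
  shows "\<exists>M. class2_p_group H p M"
proof -
  interpret f: group_hom G H f by (rule f)
  have "card (carrier H) dvd p ^ N"
    using f.card_image_mult_kernel[OF surj] card_G by (metis dvd_triv_left)
  then obtain M where M: "card (carrier H) = p ^ M" using divides_primepow_nat[OF prime_p] by blast
  have "class2_p_group H p M"
  proof (intro class2_p_group.intro class2_p_group_axioms.intro)
    show "finite (carrier H)" using surj fin by (metis finite_imageI)
    fix x y z assume "x \<in> carrier H" "y \<in> carrier H" "z \<in> carrier H"
    then obtain x' y' z' where [simp]: "x' \<in> carrier G" "y' \<in> carrier G" "z' \<in> carrier G"
      and [simp]: "x = f x'" "y = f y'" "z = f z'"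
      unfolding surj[symmetric] by blast
    have "f ((x' \<otimes> y' \<otimes> inv x' \<otimes> inv y') \<otimes> z') = f (z' \<otimes> (x' \<otimes> y' \<otimes> inv x' \<otimes> inv y'))"
      by (subst comm_central) auto
    then show "(x \<otimes>\<^bsub>H\<^esub> y \<otimes>\<^bsub>H\<^esub> inv\<^bsub>H\<^esub> x \<otimes>\<^bsub>H\<^esub> inv\<^bsub>H\<^esub> y) \<otimes>\<^bsub>H\<^esub> z =
        z \<otimes>\<^bsub>H\<^esub> (x \<otimes>\<^bsub>H\<^esub> y \<otimes>\<^bsub>H\<^esub> inv\<^bsub>H\<^esub> x \<otimes>\<^bsub>H\<^esub> inv\<^bsub>H\<^esub> y)"
      by simp
  qed (use M prime_p f.H.is_group in auto)
  then show ?thesis by (rule exI)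
qed

text \<open>The induction step for a group on any type, with smaller groups only on the naturals. It
  therefore drives the induction there and also, in one last application, transfers the result to
  arbitrary groups.\<close>

lemma generalized_character_from_smaller:
  assumes w: "fst ` set w \<subseteq> {..<k}" and k: "k \<ge> 1"
    and smaller: "\<And>(H :: nat monoid) M. class2_p_group H p M \<Longrightarrow> card (carrier H) < card (carrier G) \<Longrightarrow>
      generalized_character H (\<lambda>x. of_nat (word_count k w H x))"
  shows "generalized_character G (\<lambda>x. of_nat (word_count k w G x))"
proof (rule generalized_character_if_quotients[OF w k])
  fix B assume B: "subgroup B G" "B \<subseteq> center G" "B \<noteq> {\<one>}"
  have central: "c \<otimes> a = a \<otimes> c" if "c \<in> B" "a \<in> carrier G" for c a
    using B(2) that by (auto simp: center_def)
  have Bc: "c \<in> carrier G" if "c \<in> B" for c using subgroup.mem_carrier[OF B(1) that] .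
  have "B \<lhd> G"
    unfolding normal_inv_iff
  proof (intro conjI ballI B(1))
    fix x c assume "x \<in> carrier G" "c \<in> B"
    then have "x \<otimes> c \<otimes> inv x = c" using central[of c x] Bc[of c] by (simp add: m_assoc flip: central)
    then show "x \<otimes> c \<otimes> inv x \<in> B" using \<open>c \<in> B\<close> by simp
  qed
  from quotient_on_nat[OF fin this] obtain H :: "nat monoid" and f where
    f: "group_hom G H f" and surj: "f ` carrier G = carrier H"
    and ker: "\<And>a c. a \<in> carrier G \<Longrightarrow> c \<in> carrier G \<Longrightarrow> f a = f c \<longleftrightarrow> a \<otimes> inv c \<in> B"
    by blast
  interpret f: group_hom G H f by (rule f)
  obtain M where M: "class2_p_group H p M" using class2_p_group_image[OF f surj] by blast
  have "kernel G H f = B"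
    using ker[OF _ one_closed] Bc by (auto simp: kernel_def)
  then have cardH: "card (carrier H) * card B = card (carrier G)"
    using f.card_image_mult_kernel[OF surj] by simp
  have "\<one> \<in> B" by (rule subgroup.one_closed[OF B(1)])
  then have "{\<one>} \<subset> B" using B(3) by blast
  then have "card {\<one>} < card B"
    using finite_subset[OF subgroup.subset[OF B(1)] fin] by (intro psubset_card_mono)
  moreover have "card (carrier G) > 0" using fin one_closed by (auto simp: card_gt_0_iff)
  ultimately have "card (carrier H) < card (carrier G)"
    unfolding cardH[symmetric] by simp
  from smaller[OF M this] have "generalized_character G ((\<lambda>x. of_nat (word_count k w H x)) \<circ> f)"
    by (rule generalized_character_pullback[OF f.homh surj])
  moreover have "(\<Sum>c\<in>B. of_nat (word_count k w G (x \<otimes> c))) =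
      (of_nat (card B ^ k) * ((\<lambda>x. of_nat (word_count k w H x)) \<circ> f) x :: complex)"
    if x: "x \<in> carrier G" for x
    using arg_cong[where f = "of_nat :: nat \<Rightarrow> complex", OF f.word_count_quotient[OF fin surj B(1) ker central w x]]
    by simp
  ultimately show "\<exists>g. generalized_character G g \<and> (\<forall>x\<in>carrier G.
      (\<Sum>c\<in>B. of_nat (word_count k w G (x \<otimes> c))) = of_nat (card B ^ k) * g x)"
    by blast
qed

end

lemma generalized_character_nat:
  fixes G :: "nat monoid"
  assumes "class2_p_group G p N" "fst ` set w \<subseteq> {..<k}" "k \<ge> 1"
  shows "generalized_character G (\<lambda>x. of_nat (word_count k w G x))"
  using assms(1)
proof (induction "card (carrier G)" arbitrary: G N rule: less_induct)
  case less
  show ?case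
    by (rule class2_p_group.generalized_character_from_smaller[OF less.prems assms(2,3)]) (rule less.hyps)
qed

text \<open>With the shifted indices, \<open>lower_central G 2\<close> is the third term of the
  series; it contains the commutator of \<open>z\<close> with any commutator of \<open>x\<close> and
  \<open>y\<close>.\<close>

lemma nilpotency_class_2_commutator_central:
  assumes "group G" "has_nilpotency_class G 2"
    and x: "x \<in> carrier G" and y: "y \<in> carrier G" and z: "z \<in> carrier G"
  shows "(x \<otimes>\<^bsub>G\<^esub> y \<otimes>\<^bsub>G\<^esub> inv\<^bsub>G\<^esub> x \<otimes>\<^bsub>G\<^esub> inv\<^bsub>G\<^esub> y) \<otimes>\<^bsub>G\<^esub> z =
    z \<otimes>\<^bsub>G\<^esub> (x \<otimes>\<^bsub>G\<^esub> y \<otimes>\<^bsub>G\<^esub> inv\<^bsub>G\<^esub> x \<otimes>\<^bsub>G\<^esub> inv\<^bsub>G\<^esub> y)"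
proof -
  interpret group G by fact
  define c where "c = x \<otimes>\<^bsub>G\<^esub> y \<otimes>\<^bsub>G\<^esub> inv\<^bsub>G\<^esub> x \<otimes>\<^bsub>G\<^esub> inv\<^bsub>G\<^esub> y"
  have cc: "c \<in> carrier G" using x y by (simp add: c_def)
  have "c \<in> lower_central G 1"
    using x y by (auto simp: c_def intro!: generate.incl)
  then have "c \<otimes>\<^bsub>G\<^esub> z \<otimes>\<^bsub>G\<^esub> inv\<^bsub>G\<^esub> c \<otimes>\<^bsub>G\<^esub> inv\<^bsub>G\<^esub> z \<in> lower_central G (Suc 1)"
    using z by (subst lower_central.simps(2)) (blast intro: generate.incl)
  also have "lower_central G (Suc 1) = {\<one>\<^bsub>G\<^esub>}"
    using assms(2) by (simp add: has_nilpotency_class_def numeral_2_eq_2)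
  finally have one: "c \<otimes>\<^bsub>G\<^esub> z \<otimes>\<^bsub>G\<^esub> inv\<^bsub>G\<^esub> c \<otimes>\<^bsub>G\<^esub> inv\<^bsub>G\<^esub> z = \<one>\<^bsub>G\<^esub>" by simp
  have "c \<otimes>\<^bsub>G\<^esub> z = (c \<otimes>\<^bsub>G\<^esub> z \<otimes>\<^bsub>G\<^esub> inv\<^bsub>G\<^esub> c \<otimes>\<^bsub>G\<^esub> inv\<^bsub>G\<^esub> z) \<otimes>\<^bsub>G\<^esub> (z \<otimes>\<^bsub>G\<^esub> c)"
    using cc z by (simp add: m_assoc)
  then show ?thesis using cc z unfolding c_def[symmetric] by (simp only: one) simp
qed

theorem theorem3p2:
  fixes G :: "('a, 'b) monoid_scheme" and p k :: nat and w :: "nat letter list"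
  assumes "prime p"
    and "finite_p_group p G"
    and "has_nilpotency_class G 2"
    and "k \<ge> 1"
    and "w \<in> carrier (free_group {..<k})"
  shows "generalized_character G (\<lambda>x. of_nat (word_count k w G x))"
proof -
  obtain N where "group G" "finite (carrier G)" "card (carrier G) = p ^ N"
    using assms(2) unfolding finite_p_group_def Coset.order_def by blast
  then have C: "class2_p_group G p N"
    using assms(1) nilpotency_class_2_commutator_central[OF _ assms(3)]
    by (intro class2_p_group.intro class2_p_group_axioms.intro)
  have w: "fst ` set w \<subseteq> {..<k}" using assms(5) by (simp add: free_group_def)
  show ?thesis
    by (rule class2_p_group.generalized_character_from_smaller[OF C w assms(4)
          generalized_character_nat[OF _ w assms(4)]])
qed

end
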